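(* Let $\mathcal{A}$ be an elliptic arrangement in $E^n$ of rank $r$. Then $H^i(M(\mathcal{A});\mathbb{Z})=0$ for all $i>2n-r$.
   Context: Let $E$ be an elliptic curve with origin $O$. A divisor in $E^n$ is a subvariety $D=\{(P_1,\dots,P_n)\in E^n\mid \sum_{i=1}^n m_iP_i=Q\}$ with $m_i\in\mathbb{Z}$, $\gcd(m_1,\dots,m_n)=1$, $Q\in E$. An elliptic arrangement $\mathcal{A}=\{D_1,\dots,D_l\}$ is a finite collection of such divisors, with complement $M(\mathcal{A})=E^n\setminus\bigcup_i D_i$. A defining matrix of $\mathcal{A}$ is a matrix $N\in M(n,l;\mathbb{Z})$ whose $i$-th column is the coefficient vector of an equation of $D_i$. The rank $r$ of $\mathcal{A}$ is the rank of a defining matrix (equivalently, the maximal codimension of a layer); in particular $r=n$ when $\mathcal{A}$ is essential. *)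

theory Defs
  imports "HOL-Analysis.Analysis" "HOL-Homology.Homology"
begin

definition singular_cochain_group :: "nat \<Rightarrow> 'a topology \<Rightarrow> (((nat \<Rightarrow> real) \<Rightarrow> 'a) \<Rightarrow> int) monoid"
  where "singular_cochain_group k X =
    \<lparr>carrier = {\<phi>. \<forall>\<sigma>. \<not> singular_simplex k X \<sigma> \<longrightarrow> \<phi> \<sigma> = 0},
     monoid.mult = (\<lambda>\<phi> \<psi> \<sigma>. \<phi> \<sigma> + \<psi> \<sigma>),
     one = (\<lambda>\<sigma>. 0)\<rparr>"

definition singular_coboundary :: "nat \<Rightarrow> 'a topology \<Rightarrow> (((nat \<Rightarrow> real) \<Rightarrow> 'a) \<Rightarrow> int)
    \<Rightarrow> ((nat \<Rightarrow> real) \<Rightarrow> 'a) \<Rightarrow> int"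
  where "singular_coboundary k X \<phi> =
    (\<lambda>\<sigma>. if singular_simplex (Suc k) X \<sigma>
          then (\<Sum>j\<le>Suc k. (-1) ^ j * \<phi> (singular_face (Suc k) j \<sigma>)) else 0)"

definition singular_cocycles :: "nat \<Rightarrow> 'a topology \<Rightarrow> (((nat \<Rightarrow> real) \<Rightarrow> 'a) \<Rightarrow> int) set"
  where "singular_cocycles k X =
    {\<phi> \<in> carrier (singular_cochain_group k X). singular_coboundary k X \<phi> = (\<lambda>\<sigma>. 0)}"

definition singular_coboundaries :: "nat \<Rightarrow> 'a topology \<Rightarrow> (((nat \<Rightarrow> real) \<Rightarrow> 'a) \<Rightarrow> int) set"
  where "singular_coboundaries k X =
    (case k of 0 \<Rightarrow> {(\<lambda>\<sigma>. 0)}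
     | Suc j \<Rightarrow> singular_coboundary j X ` carrier (singular_cochain_group j X))"

definition singular_cohomology_group :: "nat \<Rightarrow> 'a topology \<Rightarrow> (((nat \<Rightarrow> real) \<Rightarrow> 'a) \<Rightarrow> int) set monoid"
  where "singular_cohomology_group k X =
    (subgroup_generated (singular_cochain_group k X) (singular_cocycles k X))
      Mod (singular_coboundaries k X)"

definition period_lattice :: "complex \<Rightarrow> complex \<Rightarrow> complex set"
  where "period_lattice \<omega>1 \<omega>2 = {of_int a * \<omega>1 + of_int b * \<omega>2 | a b. True}"

text \<open>omega1, omega2 are R-linearly independent, i.e. they span a lattice.\<close>
definition nondegenerate_periods :: "complex \<Rightarrow> complex \<Rightarrow> bool"
  where "nondegenerate_periods \<omega>1 \<omega>2 \<longleftrightarrow> Im (\<omega>2 / \<omega>1) \<noteq> 0"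

definition ell_point :: "complex set \<Rightarrow> complex \<Rightarrow> complex set"
  where "ell_point L z = {w. w - z \<in> L}"

definition ell_curve :: "complex set \<Rightarrow> complex set set"
  where "ell_curve L = range (ell_point L)"

text \<open>The point (z_1 + Lambda, ..., z_n + Lambda) of E^n, n = CARD('n).\<close>
definition ell_power_point :: "complex set \<Rightarrow> complex ^ 'n \<Rightarrow> (complex ^ 'n) set"
  where "ell_power_point L z = {w. \<forall>i. w $ i - z $ i \<in> L}"

definition ell_power :: "complex set \<Rightarrow> (complex ^ 'n) set set"
  where "ell_power L = range (ell_power_point L)"

definition ell_power_topology :: "complex set \<Rightarrow> (complex ^ 'n) set topology"
  where "ell_power_topology L = topology (\<lambda>U. U \<subseteq> ell_power L \<and> open (ell_power_point L -` U))"

text \<open>The divisor {(P_1,...,P_n) | sum m_i P_i = Q}; the group law of C/Lambda is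
induced from C, so sum m_i (z_i + Lambda) = (sum m_i z_i) + Lambda.\<close>
definition ell_divisor :: "complex set \<Rightarrow> int ^ 'n \<Rightarrow> complex set \<Rightarrow> (complex ^ 'n) set set"
  where "ell_divisor L m Q =
    {ell_power_point L z | z. ell_point L (\<Sum>i\<in>UNIV. of_int (m $ i) * z $ i) = Q}"

definition elliptic_arrangement :: "complex set \<Rightarrow> ((int ^ 'n) \<times> complex set) list \<Rightarrow> bool"
  where "elliptic_arrangement L A \<longleftrightarrow>
    (\<forall>(m, Q) \<in> set A. Gcd (range (\<lambda>i. m $ i)) = 1 \<and> Q \<in> ell_curve L)"

definition arrangement_complement :: "complex set \<Rightarrow> ((int ^ 'n) \<times> complex set) list \<Rightarrow> (complex ^ 'n) set set"
  where "arrangement_complement L A =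
    ell_power L - (\<Union>(m, Q) \<in> set A. ell_divisor L m Q)"

text \<open>Rank of the defining matrix = dimension of the span of its columns (over Q, equivalently R).\<close>
definition arrangement_rank :: "((int ^ 'n) \<times> complex set) list \<Rightarrow> nat"
  where "arrangement_rank A = dim ((\<lambda>(m, Q). (\<chi> i. real_of_int (m $ i)) :: real ^ 'n) ` set A)"

end

(*
  Consider all sets X(J, A) of points lying on the divisors in J and off those in A, where the
  coefficient vectors may be arbitrary. By induction on A, the cohomology of X(J, A) vanishes above
  degree 2 n - rank J - rank (J u A); the case J = {} is the theorem. Each step removes one divisor D from A:
  - if D depends on J, then X(J, A) is open and closed in X(J, A - D);
  - if D is independent of J u (A - D), translations make the equation of D a product projection of
    X(J, A) over the once-punctured curve, which is covered by two annuli meeting in a square;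
  - otherwise X(J, A - D) is the union of X(J, A) and a tube around X(J u D, A - D). The tube minus its
    core is covered by convex sectors times the core, so Mayer-Vietoris bounds it by one more than the core,
    and the bound passes to X(J, A) without any Thom isomorphism.
  For A = {} the same projections fibre X(J, {}) over the whole curve, down to discrete sets.
  Only vanishing statements are propagated, by Mayer-Vietoris and homotopy domination.
*)

theory Submission
  imports Defs
begin

section \<open>Vanishing of singular cohomology\<close>

text \<open>The layer cut out by J has real dimension 2 (n - rank J), and every independent
  direction that A adds to J lowers the bound by one; there are rank (J u A) - rank J of these,
  which yields 2 n - rank J - rank (J u A). Restriction to a divisor is expressed by enlarging J, so
  that no divisor has to be identified with a smaller power of E. Coefficients may have common
  factors, since intersections of divisors can be disconnected anyway. A divisor independent of all
  others resists the tube argument: the space without it has a bound that is one too large. The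
  missing degree is gained because its equation is free on the remaining stratum, so that the values
  fill the punctured curve, which adds one degree instead of two. All maps are written upstairs in
  C^n as displacements along a vector u that is in general no period. Translation along u carries
  one fibre of an equation to another, but it has monodromy around the curve; hence it is applied
  over pieces of the curve on which coordinates modulo 1 have continuous representatives.\<close>

text \<open>The detour through chains on a point lets additivity be inherited from \<open>frag_extend\<close>.\<close>
definition cochain_eval :: "('b \<Rightarrow> int) \<Rightarrow> ('b \<Rightarrow>\<^sub>0 int) \<Rightarrow> int"
  where "cochain_eval \<phi> c = Poly_Mapping.lookup (frag_extend (\<lambda>\<sigma>. frag_cmul (\<phi> \<sigma>) (frag_of ())) c) ()"

lemma cochain_eval_of [simp]: "cochain_eval \<phi> (frag_of \<sigma>) = \<phi> \<sigma>"
  by (simp add: cochain_eval_def)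

lemma cochain_eval_0 [simp]: "cochain_eval \<phi> 0 = 0"
  by (simp add: cochain_eval_def)

lemma cochain_eval_add: "cochain_eval \<phi> (a + b) = cochain_eval \<phi> a + cochain_eval \<phi> b"
  by (simp add: cochain_eval_def frag_extend_add lookup_add)

lemma cochain_eval_minus: "cochain_eval \<phi> (- a) = - cochain_eval \<phi> a"
  using cochain_eval_add [of \<phi> a "-a"] by simp

lemma cochain_eval_diff: "cochain_eval \<phi> (a - b) = cochain_eval \<phi> a - cochain_eval \<phi> b"
  using cochain_eval_add [of \<phi> a "-b"] by (simp add: cochain_eval_minus)

lemma cochain_eval_sum: "cochain_eval \<phi> (sum f I) = (\<Sum>i\<in>I. cochain_eval \<phi> (f i))"
  by (induction I rule: infinite_finite_induct) (simp_all add: cochain_eval_add)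

lemma cochain_eval_cmul: "cochain_eval \<phi> (frag_cmul k c) = k * cochain_eval \<phi> c"
  by (simp add: cochain_eval_def frag_extend_cmul)

lemma additive_eq_on_frag:
  assumes "Poly_Mapping.keys c \<subseteq> S"
    and "\<And>a b. f (a - b) = f a - (f b :: 'c :: ab_group_add)" "\<And>a b. g (a - b) = g a - g b"
    and "\<And>\<sigma>. \<sigma> \<in> S \<Longrightarrow> f (frag_of \<sigma>) = g (frag_of \<sigma>)"
  shows "f c = g c"
  using assms(1)
proof (induction c rule: frag_induction)
  case zero
  have "f (0 - 0) = f 0 - f 0" "g (0 - 0) = g 0 - g 0"
    by (rule assms)+
  then show ?case by simp
qed (simp_all add: assms)

text \<open>A cochain can therefore be prescribed by any additive formula in chains; the values on
  single simplices represent it.\<close>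

lemma cochain_eval_simplexwise:
  assumes "\<And>a b. f (a - b) = f a - (f b :: int)"
  shows "cochain_eval (\<lambda>\<sigma>. f (frag_of \<sigma>)) c = f c"
  by (rule additive_eq_on_frag [of c UNIV "cochain_eval (\<lambda>\<sigma>. f (frag_of \<sigma>))" f]) (simp_all add: assms cochain_eval_diff)

lemma singular_chain_eqI:
  assumes "singular_chain p X c"
    and "\<And>a b. f (a - b) = f a - (f b :: 'c :: ab_group_add)" "\<And>a b. g (a - b) = g a - g b"
    and "\<And>\<sigma>. singular_simplex p X \<sigma> \<Longrightarrow> f (frag_of \<sigma>) = g (frag_of \<sigma>)"
  shows "f c = g c"
  by (rule additive_eq_on_frag [of c "singular_simplex_set p X" f g])
     (use assms in \<open>auto simp: singular_chain_def\<close>)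

text \<open>In degree 0 this says that 0 is the only cocycle, because \<open>chain_boundary 0\<close> is 0.\<close>
definition cohomology_vanishes :: "nat \<Rightarrow> 'a topology \<Rightarrow> bool"
  where "cohomology_vanishes k X \<longleftrightarrow>
    (\<forall>\<phi>. (\<forall>c. singular_chain (Suc k) X c \<longrightarrow> cochain_eval \<phi> (chain_boundary (Suc k) c) = 0) \<longrightarrow>
      (\<exists>\<psi>. \<forall>c. singular_chain k X c \<longrightarrow> cochain_eval \<phi> c = cochain_eval \<psi> (chain_boundary k c)))"

lemma cohomology_vanishesE:
  assumes "cohomology_vanishes k X"
    and "\<And>c. singular_chain (Suc k) X c \<Longrightarrow> cochain_eval \<phi> (chain_boundary (Suc k) c) = 0"
  obtains \<psi> where "\<And>c. singular_chain k X c \<Longrightarrow> cochain_eval \<phi> c = cochain_eval \<psi> (chain_boundary k c)"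
  using assms unfolding cohomology_vanishes_def by blast

lemma cohomology_vanishes_empty: "topspace X = {} \<Longrightarrow> cohomology_vanishes k X"
  by (simp add: cohomology_vanishes_def singular_chain_empty)

section \<open>Comparison with the group of cocycles modulo coboundaries\<close>

lemma singular_coboundary_eval:
  "singular_coboundary k X \<phi> =
    (\<lambda>\<sigma>. if singular_simplex (Suc k) X \<sigma>
         then cochain_eval \<phi> (chain_boundary (Suc k) (frag_of \<sigma>)) else 0)"
  unfolding singular_coboundary_def chain_boundary_of
  by (simp add: cochain_eval_sum cochain_eval_cmul fun_eq_iff del: sum.atMost_Suc)

lemma cochain_eval_singular_coboundary:
  assumes "singular_chain (Suc k) X c"
  shows "cochain_eval (singular_coboundary k X \<phi>) c = cochain_eval \<phi> (chain_boundary (Suc k) c)"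
  by (rule singular_chain_eqI [OF assms, where f = "cochain_eval (singular_coboundary k X \<phi>)"
        and g = "\<lambda>c. cochain_eval \<phi> (chain_boundary (Suc k) c)"])
     (simp_all add: cochain_eval_diff chain_boundary_diff singular_coboundary_eval)

lemma singular_coboundary_coboundary:
  "singular_coboundary (Suc k) X (singular_coboundary k X \<phi>) = (\<lambda>\<sigma>. 0)"
proof
  fix \<sigma>
  show "singular_coboundary (Suc k) X (singular_coboundary k X \<phi>) \<sigma> = 0"
  proof (cases "singular_simplex (Suc (Suc k)) X \<sigma>")
    case True
    then have c: "singular_chain (Suc (Suc k)) X (frag_of \<sigma>)"
      by (simp add: singular_chain_of)
    have "chain_boundary (Suc k) (chain_boundary (Suc (Suc k)) (frag_of \<sigma>)) = 0"
      using chain_boundary_boundary [OF c] by simp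
    then show ?thesis
      using True singular_chain_boundary_alt [OF c]
      by (simp add: singular_coboundary_eval [of "Suc k"] cochain_eval_singular_coboundary)
  qed (simp add: singular_coboundary_def)
qed

lemma singular_coboundary_add:
  "singular_coboundary k X (\<lambda>\<sigma>. \<phi> \<sigma> + \<psi> \<sigma>) =
    (\<lambda>\<sigma>. singular_coboundary k X \<phi> \<sigma> + singular_coboundary k X \<psi> \<sigma>)"
  by (auto simp: singular_coboundary_def sum.distrib distrib_left fun_eq_iff simp del: sum.atMost_Suc)

lemma singular_coboundary_uminus:
  "singular_coboundary k X (\<lambda>\<sigma>. - \<phi> \<sigma>) = (\<lambda>\<sigma>. - singular_coboundary k X \<phi> \<sigma>)"
  by (auto simp: singular_coboundary_def sum_negf fun_eq_iff simp del: sum.atMost_Suc)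

lemma singular_coboundary_0: "singular_coboundary k X (\<lambda>\<sigma>. 0) = (\<lambda>\<sigma>. 0)"
  by (auto simp: singular_coboundary_def fun_eq_iff)

lemma comm_group_singular_cochain_group: "comm_group (singular_cochain_group k X)"
proof (rule comm_groupI)
  fix x assume "x \<in> carrier (singular_cochain_group k X)"
  then show "\<exists>y\<in>carrier (singular_cochain_group k X).
      y \<otimes>\<^bsub>singular_cochain_group k X\<^esub> x = \<one>\<^bsub>singular_cochain_group k X\<^esub>"
    by (intro bexI [of _ "\<lambda>\<sigma>. - x \<sigma>"]) (auto simp: singular_cochain_group_def)
qed (auto simp: singular_cochain_group_def add.assoc add.commute)

lemma inv_singular_cochain_group:
  assumes "x \<in> carrier (singular_cochain_group k X)"
  shows "inv\<^bsub>singular_cochain_group k X\<^esub> x = (\<lambda>\<sigma>. - x \<sigma>)"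
proof -
  interpret comm_group "singular_cochain_group k X"
    by (rule comm_group_singular_cochain_group)
  show ?thesis
    using assms by (intro inv_equality) (auto simp: singular_cochain_group_def)
qed

lemma subgroup_singular_cocycles: "subgroup (singular_cocycles k X) (singular_cochain_group k X)"
proof -
  interpret comm_group "singular_cochain_group k X"
    by (rule comm_group_singular_cochain_group)
  show ?thesis
  proof (rule subgroupI)
    have "(\<lambda>\<sigma>. 0) \<in> singular_cocycles k X"
      by (simp add: singular_cocycles_def singular_cochain_group_def singular_coboundary_0)
    then show "singular_cocycles k X \<noteq> {}" by blast
  next
    fix a assume "a \<in> singular_cocycles k X"
    then show "inv\<^bsub>singular_cochain_group k X\<^esub> a \<in> singular_cocycles k X"
      by (auto simp: singular_cocycles_def inv_singular_cochain_group singular_coboundary_uminus)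
         (auto simp: singular_cochain_group_def)
  qed (auto simp: singular_cocycles_def singular_cochain_group_def singular_coboundary_add)
qed

lemma singular_cocycles_subset_coboundaries:
  assumes "cohomology_vanishes k X"
  shows "singular_cocycles k X \<subseteq> singular_coboundaries k X"
proof
  fix \<phi> assume \<phi>: "\<phi> \<in> singular_cocycles k X"
  then have out: "\<phi> \<sigma> = 0" if "\<not> singular_simplex k X \<sigma>" for \<sigma>
    using that by (simp add: singular_cocycles_def singular_cochain_group_def)
  have "cochain_eval \<phi> (chain_boundary (Suc k) c) = 0" if "singular_chain (Suc k) X c" for c
  proof -
    have "singular_coboundary k X \<phi> = (\<lambda>\<sigma>. 0)"
      using \<phi> by (simp add: singular_cocycles_def)
    moreover have "cochain_eval (\<lambda>\<sigma>. 0) c = 0"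
      using cochain_eval_simplexwise [of "\<lambda>x. 0" c] by simp
    ultimately show ?thesis
      using cochain_eval_singular_coboundary [OF that, of \<phi>] by simp
  qed
  then obtain \<psi> where \<psi>: "\<And>c. singular_chain k X c \<Longrightarrow> cochain_eval \<phi> c = cochain_eval \<psi> (chain_boundary k c)"
    using assms cohomology_vanishesE by blast
  show "\<phi> \<in> singular_coboundaries k X"
  proof (cases k)
    case 0
    have "\<phi> \<sigma> = 0" for \<sigma>
      using out [of \<sigma>] \<psi> [of "frag_of \<sigma>"] 0 by (auto simp: singular_chain_of chain_boundary_def)
    then show ?thesis
      using 0 by (auto simp: singular_coboundaries_def)
  next
    case (Suc j)
    \<comment> \<open>Cochains in the group vanish off the singular simplices, whereas
      \<open>\<psi>\<close> is an arbitrary function; cutting it off does not change its values on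
      chains of X.\<close>
    define \<psi>' where "\<psi>' = (\<lambda>\<tau>. if singular_simplex j X \<tau> then \<psi> \<tau> else 0)"
    have eq: "cochain_eval \<psi>' c = cochain_eval \<psi> c" if "singular_chain j X c" for c
      by (rule singular_chain_eqI [OF that, where f = "cochain_eval \<psi>'" and g = "cochain_eval \<psi>"]) (simp_all add: cochain_eval_diff \<psi>'_def)
    have "\<phi> = singular_coboundary j X \<psi>'"
    proof
      fix \<sigma>
      show "\<phi> \<sigma> = singular_coboundary j X \<psi>' \<sigma>"
      proof (cases "singular_simplex k X \<sigma>")
        case True
        then have c: "singular_chain (Suc j) X (frag_of \<sigma>)"
          by (simp add: singular_chain_of Suc)
        then show ?thesis
          using \<psi> [of "frag_of \<sigma>"] True eq [OF singular_chain_boundary_alt [OF c]]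
          by (simp add: Suc singular_coboundary_eval)
      qed (simp add: out Suc singular_coboundary_def)
    qed
    moreover have "\<psi>' \<in> carrier (singular_cochain_group j X)"
      by (simp add: singular_cochain_group_def \<psi>'_def)
    ultimately show ?thesis
      by (auto simp: singular_coboundaries_def Suc)
  qed
qed

lemma singular_coboundaries_subset_cocycles:
  "singular_coboundaries k X \<subseteq> singular_cocycles k X"
proof (cases k)
  case 0
  then show ?thesis
    by (simp add: singular_coboundaries_def singular_cocycles_def singular_cochain_group_def singular_coboundary_0)
next
  case (Suc j)
  have "singular_coboundary j X \<psi> \<in> carrier (singular_cochain_group (Suc j) X)" for \<psi>
    by (simp add: singular_coboundary_def singular_cochain_group_def)
  then show ?thesis
    by (auto simp: Suc singular_coboundaries_def singular_cocycles_def singular_coboundary_coboundary)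
qed

lemma trivial_group_singular_cohomology:
  assumes "cohomology_vanishes k X"
  shows "trivial_group (singular_cohomology_group k X)"
proof -
  let ?G = "singular_cochain_group k X" and ?Z = "singular_cocycles k X"
  interpret comm_group ?G
    by (rule comm_group_singular_cochain_group)
  \<comment> \<open>Once both sets agree, the quotient is a group modulo its own carrier, which is
    isomorphic to its trivial subgroup.\<close>
  have B: "singular_coboundaries k X = ?Z"
    using singular_cocycles_subset_coboundaries [OF assms] singular_coboundaries_subset_cocycles by blast
  have car: "carrier (subgroup_generated ?G ?Z) = ?Z"
    by (rule subgroup.carrier_subgroup_generated_subgroup [OF subgroup_singular_cocycles])
  interpret Z: comm_group "subgroup_generated ?G ?Z"
    by (rule abelian_subgroup_generated) (rule comm_group_axioms)
  let ?H = "subgroup_generated ?G ?Z"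
  have "?H Mod carrier ?H \<cong> ?H\<lparr>carrier := {\<one>\<^bsub>?H\<^esub>}\<rparr>"
    using Z.self_factor_iso by (rule is_isoI)
  moreover have "group (?H Mod carrier ?H)"
    by (intro normal.factorgroup_is_group Z.subgroup_imp_normal Z.subgroup_self)
  moreover have grp: "group (?H\<lparr>carrier := {\<one>\<^bsub>?H\<^esub>}\<rparr>)"
    by (rule Z.subgroup_imp_group [OF Z.triv_subgroup])
  moreover have "trivial_group (?H\<lparr>carrier := {\<one>\<^bsub>?H\<^esub>}\<rparr>)"
    using grp by (simp add: trivial_group_def)
  ultimately have "trivial_group (?H Mod carrier ?H)"
    using isomorphic_group_triviality by blast
  then show ?thesis
    unfolding singular_cohomology_group_def B car .
qed

section \<open>Small chains and Mayer--Vietoris\<close>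

lemma singular_simplex_subtopology_Int:
  "singular_simplex p (subtopology X (U \<inter> V)) \<sigma> \<longleftrightarrow>
    singular_simplex p (subtopology X U) \<sigma> \<and> singular_simplex p (subtopology X V) \<sigma>"
  by (auto simp: singular_simplex_subtopology)

text \<open>The subgroup C_p(U) + C_p(V) of the singular chains of X, described by supports.\<close>

definition small_chain :: "nat \<Rightarrow> 'a topology \<Rightarrow> 'a set \<Rightarrow> 'a set \<Rightarrow> 'a chain \<Rightarrow> bool"
  where "small_chain p X U V c \<longleftrightarrow> Poly_Mapping.keys c \<subseteq>
    singular_simplex_set p (subtopology X U) \<union> singular_simplex_set p (subtopology X V)"

lemma small_chain_0 [simp]: "small_chain p X U V 0"
  by (simp add: small_chain_def)

lemma small_chain_add: "small_chain p X U V a \<Longrightarrow> small_chain p X U V b \<Longrightarrow> small_chain p X U V (a + b)"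
  unfolding small_chain_def using keys_add [of a b] by blast

lemma small_chain_diff: "small_chain p X U V a \<Longrightarrow> small_chain p X U V b \<Longrightarrow> small_chain p X U V (a - b)"
  unfolding small_chain_def using keys_diff [of a b] by blast

lemma small_chain_sum: "(\<And>i. i \<in> I \<Longrightarrow> small_chain p X U V (f i)) \<Longrightarrow> small_chain p X U V (sum f I)"
  by (induction I rule: infinite_finite_induct) (auto simp: small_chain_add)

lemma small_chain_cmul: "small_chain p X U V a \<Longrightarrow> small_chain p X U V (frag_cmul k a)"
  unfolding small_chain_def using keys_cmul [of k a] by blast

lemma small_chain_left: "singular_chain p (subtopology X U) c \<Longrightarrow> small_chain p X U V c"
  and small_chain_right: "singular_chain p (subtopology X V) c \<Longrightarrow> small_chain p X U V c"
  by (auto simp: small_chain_def singular_chain_def)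

lemma small_chain_eqI:
  assumes "small_chain p X U V c"
    and "\<And>a b. f (a - b) = f a - (f b :: 'c :: ab_group_add)" "\<And>a b. g (a - b) = g a - g b"
    and "\<And>\<sigma>. singular_simplex p (subtopology X U) \<sigma> \<Longrightarrow> f (frag_of \<sigma>) = g (frag_of \<sigma>)"
    and "\<And>\<sigma>. singular_simplex p (subtopology X V) \<sigma> \<Longrightarrow> f (frag_of \<sigma>) = g (frag_of \<sigma>)"
  shows "f c = g c"
  by (rule additive_eq_on_frag [of c
        "singular_simplex_set p (subtopology X U) \<union> singular_simplex_set p (subtopology X V)" f g])
     (use assms in \<open>auto simp: small_chain_def\<close>)

lemma small_chain_split:
  assumes "small_chain p X U V c"
  obtains d e where "singular_chain p (subtopology X U) d" "singular_chain p (subtopology X V) e" "c = d + e"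
  using frag_split [OF assms [unfolded small_chain_def]] unfolding singular_chain_def by metis

text \<open>Operators that respect every subspace act separately on the U part and on the V part.
  Boundary, subdivision and the subdivision homotopy are of this kind.\<close>

lemma small_chain_additive_image:
  assumes "small_chain p X U V c" and add: "\<And>a b. f (a + b) = f a + f b"
    and "\<And>S c. singular_chain p (subtopology X S) c \<Longrightarrow> singular_chain q (subtopology X S) (f c)"
  shows "small_chain q X U V (f c)"
  by (rule small_chain_split [OF assms(1)])
     (auto simp: add intro!: small_chain_add intro: small_chain_left small_chain_right assms(3))

lemma small_chain_boundary:
  "small_chain p X U V c \<Longrightarrow> small_chain (p - Suc 0) X U V (chain_boundary p c)"
  by (rule small_chain_additive_image [where f = "chain_boundary p"])
     (auto simp: chain_boundary_add singular_chain_boundary)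

section \<open>Iterated subdivision and the deformation onto small chains\<close>

lemma small_chain_iterated_subdivision:
  assumes "small_chain p X U V c"
  shows "small_chain p X U V ((singular_subdivision p ^^ n) c)"
proof (induction n)
  case (Suc n)
  then show ?case
    using small_chain_additive_image [where f = "singular_subdivision p", OF Suc]
    by (simp add: singular_subdivision_add singular_chain_singular_subdivision)
qed (use assms in simp)

lemma singular_chain_iterated_subdivision:
  "singular_chain p X c \<Longrightarrow> singular_chain p X ((singular_subdivision p ^^ n) c)"
  by (induction n) (auto simp: singular_chain_singular_subdivision)

lemma chain_boundary_iterated_subdivision:
  assumes "singular_chain p X c"
  shows "chain_boundary p ((singular_subdivision p ^^ n) c) =
    (singular_subdivision (p - Suc 0) ^^ n) (chain_boundary p c)"
proof (induction n)
  case (Suc n)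
  then show ?case
    using chain_boundary_singular_subdivision [OF singular_chain_iterated_subdivision [OF assms, of n]] by simp
qed simp

lemma additive_laws:
  assumes "\<And>a b. f (a - b) = f a - (f b :: 'c :: ab_group_add)"
  shows "f 0 = 0" "f (- a) = - f a" "f (a + b) = f a + f (b :: 'd :: ab_group_add)"
proof -
  show f0: "f 0 = 0"
    using assms [of 0 0] by simp
  have m: "f (- a) = - f a" for a
    using assms [of 0 a] f0 by simp
  then show "f (- a) = - f a" .
  show "f (a + b) = f a + f b"
    using assms [of a "- b"] m by simp
qed

lemma additive_sum:
  assumes "\<And>a b. f (a - b) = f a - (f b :: 'c :: ab_group_add)"
  shows "f (sum g I) = (\<Sum>i\<in>I. f (g i :: 'd :: ab_group_add))"
  by (induction I rule: infinite_finite_induct) (simp_all add: additive_laws [of f] assms)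

lemma additive_frag_cmul:
  assumes f: "\<And>a b. f (a - b) = f a - (f b :: 'c \<Rightarrow>\<^sub>0 int)"
  shows "f (frag_cmul k a) = frag_cmul k (f (a :: 'd \<Rightarrow>\<^sub>0 int))"
proof -
  have nat: "f (frag_cmul (int n) a) = frag_cmul (int n) (f a)" for n
    by (induction n) (simp_all add: additive_laws [of f, OF f] frag_cmul_distrib)
  show ?thesis
  proof (cases k)
    case (nonneg n) then show ?thesis by (simp add: nat)
  next
    case (neg n)
    have "f (frag_cmul (- int (Suc n)) a) = - f (frag_cmul (int (Suc n)) a)"
      by (simp only: additive_laws(2) [of f, OF f] minus_frag_cmul [symmetric])
    then show ?thesis
      using neg by (simp only: nat minus_frag_cmul)
  qed
qed

text \<open>Taking the maximum over the faces makes the depth monotone under passing to faces; smallness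
  alone would not, since faces may cancel in the boundary of a subdivided simplex.\<close>
primrec subdivision_depth :: "nat \<Rightarrow> 'a topology \<Rightarrow> 'a set \<Rightarrow> 'a set \<Rightarrow> ((nat \<Rightarrow> real) \<Rightarrow> 'a) \<Rightarrow> nat"
  where
    "subdivision_depth 0 X U V \<sigma> =
      (LEAST n. \<forall>m\<ge>n. small_chain 0 X U V ((singular_subdivision 0 ^^ m) (frag_of \<sigma>)))"
  | "subdivision_depth (Suc p) X U V \<sigma> =
      max (LEAST n. \<forall>m\<ge>n. small_chain (Suc p) X U V ((singular_subdivision (Suc p) ^^ m) (frag_of \<sigma>)))
          (MAX j\<in>{..Suc p}. subdivision_depth p X U V (singular_face (Suc p) j \<sigma>))"

lemma subdivision_depth_ge_Least:
  "(LEAST n. \<forall>m\<ge>n. small_chain p X U V ((singular_subdivision p ^^ m) (frag_of \<sigma>)))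
    \<le> subdivision_depth p X U V \<sigma>"
  by (cases p) simp_all

lemma subdivision_depth_face:
  "j \<le> Suc p \<Longrightarrow> subdivision_depth p X U V (singular_face (Suc p) j \<sigma>) \<le> subdivision_depth (Suc p) X U V \<sigma>"
  by (auto intro!: Max_ge le_max_iff_disj [THEN iffD2] disjI2)

text \<open>This is what makes the deformation below the identity on small chains. The induction
  runs over the faces, which are small again.\<close>

lemma subdivision_depth_small:
  assumes "small_chain p X U V (frag_of \<sigma>)"
  shows "subdivision_depth p X U V \<sigma> = 0"
  using assms
proof (induction p arbitrary: \<sigma>)
  case 0
  then show ?case
    by (auto intro!: Least_eq_0 simp: small_chain_iterated_subdivision)
next
  case (Suc p)
  have L: "(LEAST n. \<forall>m\<ge>n. small_chain (Suc p) X U V ((singular_subdivision (Suc p) ^^ m) (frag_of \<sigma>))) = 0"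
    using Suc.prems by (auto intro!: Least_eq_0 simp: small_chain_iterated_subdivision)
  have "small_chain p X U V (frag_of (singular_face (Suc p) j \<sigma>))" if "j \<le> Suc p" for j
    using Suc.prems that singular_simplex_singular_face [of "Suc p" _ \<sigma> j]
    by (fastforce simp: small_chain_def)
  then have "(\<lambda>j. subdivision_depth p X U V (singular_face (Suc p) j \<sigma>)) ` {..Suc p} = {0}"
    using Suc.IH by auto
  then show ?case
    by (simp add: L del: atMost_Suc)
qed

text \<open>By a Lebesgue number argument some number of subdivisions suffices, and so do all larger
  ones; hence the least number in \<open>subdivision_depth\<close> is attained.\<close>

lemma small_chain_subdivision_depth:
  assumes "openin X U" "openin X V" "topspace X \<subseteq> U \<union> V" "singular_simplex p X \<sigma>"
    and "subdivision_depth p X U V \<sigma> \<le> m"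
  shows "small_chain p X U V ((singular_subdivision p ^^ m) (frag_of \<sigma>))"
proof -
  let ?P = "\<lambda>n. \<forall>m\<ge>n. small_chain p X U V ((singular_subdivision p ^^ m) (frag_of \<sigma>))"
  have c: "singular_chain p X (frag_of \<sigma>)"
    using assms by (simp add: singular_chain_of)
  obtain n where n: "\<And>m f. \<lbrakk>n \<le> m; f \<in> Poly_Mapping.keys ((singular_subdivision p ^^ m) (frag_of \<sigma>))\<rbrakk>
                      \<Longrightarrow> \<exists>W \<in> {U, V}. f \<in> (standard_simplex p) \<rightarrow> W"
    by (rule sufficient_iterated_singular_subdivision_exists [of "{U, V}" X p "frag_of \<sigma>"]) (use assms c in auto)
  have "small_chain p X U V ((singular_subdivision p ^^ m) (frag_of \<sigma>))" if "n \<le> m" for m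
    unfolding small_chain_def
  proof
    fix f assume f: "f \<in> Poly_Mapping.keys ((singular_subdivision p ^^ m) (frag_of \<sigma>))"
    then have "singular_simplex p X f"
      using singular_chain_iterated_subdivision [OF c, of m] by (auto simp: singular_chain_def)
    then show "f \<in> singular_simplex_set p (subtopology X U) \<union> singular_simplex_set p (subtopology X V)"
      using n [OF that f] by (auto simp: singular_simplex_subtopology)
  qed
  then have "?P n" by blast
  then have "?P (LEAST n. ?P n)" by (rule LeastI)
  then show ?thesis
    using subdivision_depth_ge_Least [of p X U V \<sigma>] assms(5) by (meson order_trans)
qed

text \<open>The operators \<open>\<rho>\<close> and \<open>D\<close> deform singular chains into small ones: each simplex is subdivided
  until it is small, and \<open>D\<close> sums up the chain homotopies of the single subdivision steps.\<close>
lemma small_chain_deformation: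
  fixes X :: "'a topology"
  assumes "openin X U" "openin X V" "topspace X \<subseteq> U \<union> V"
  shows "\<exists>(D :: nat \<Rightarrow> 'a chain \<Rightarrow> 'a chain) (\<rho> :: nat \<Rightarrow> 'a chain \<Rightarrow> 'a chain).
    (\<forall>p a b. D p (a - b) = D p a - D p b) \<and>
    (\<forall>p a b. \<rho> p (a - b) = \<rho> p a - \<rho> p b) \<and>
    (\<forall>p c. singular_chain p X c \<longrightarrow> singular_chain (Suc p) X (D p c)) \<and>
    (\<forall>p c. singular_chain p X c \<longrightarrow> small_chain p X U V (\<rho> p c)) \<and>
    (\<forall>p c. singular_chain p X c \<longrightarrow> chain_boundary p (\<rho> p c) = \<rho> (p - Suc 0) (chain_boundary p c)) \<and>
    (\<forall>p c. \<rho> p c = c + chain_boundary (Suc p) (D p c) + D (p - Suc 0) (chain_boundary p c)) \<and>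
    (\<forall>p c. small_chain p X U V c \<longrightarrow> \<rho> p c = c)"
proof -
  obtain h :: "nat \<Rightarrow> 'a chain \<Rightarrow> 'a chain" where
    h0: "\<And>p. h p 0 = 0" and
    hdiff: "\<And>p c1 c2. h p (c1-c2) = h p c1 - h p c2" and
    hch: "\<And>p X c. singular_chain p X c \<Longrightarrow> singular_chain (Suc p) X (h p c)" and
    hbd: "\<And>p X c. singular_chain p X c
                 \<Longrightarrow> chain_boundary (Suc p) (h p c) + h (p - Suc 0) (chain_boundary p c) = singular_subdivision p c - c"
    by (blast intro: chain_homotopic_singular_subdivision)
  define S where "S = (\<lambda>p n. singular_subdivision p ^^ n :: 'a chain \<Rightarrow> 'a chain)"
  \<comment> \<open>\<open>E p n\<close> adds up the homotopies of the first n subdivision steps, so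
    by telescoping it joins the identity to the n-fold subdivision.\<close>
  define E where "E = (\<lambda>p n c. \<Sum>i<n. h p (S p i c))"
  define N where "N = (\<lambda>p. subdivision_depth p X U V)"
  define D where "D = (\<lambda>p. frag_extend (\<lambda>\<sigma>. E p (N p \<sigma>) (frag_of \<sigma>)))"
  \<comment> \<open>Defined by the homotopy formula itself, so that the relation between
    \<open>\<rho>\<close> and \<open>D\<close> is immediate and smallness is what remains to be
    proved.\<close>
  define \<rho> where "\<rho> = (\<lambda>p c. c + chain_boundary (Suc p) (D p c) + D (p - Suc 0) (chain_boundary p c))"
  have Sdiff: "S p n (a - b) = S p n a - S p n b" for p n a b
    by (simp add: S_def singular_subdivision_power_diff)
  have Ediff: "E p n (a - b) = E p n a - E p n b" for p n a b
    by (simp add: E_def Sdiff hdiff sum_subtractf)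
  have Ddiff: "D p (a - b) = D p a - D p b" for p a b
    by (simp add: D_def frag_extend_diff)
  have Dof: "D p (frag_of \<sigma>) = E p (N p \<sigma>) (frag_of \<sigma>)" for p \<sigma>
    by (simp add: D_def)
  have \<rho>diff: "\<rho> p (a - b) = \<rho> p a - \<rho> p b" for p a b
    by (simp add: \<rho>_def Ddiff chain_boundary_diff)
  have Sch: "singular_chain p X c \<Longrightarrow> singular_chain p X (S p n c)" for p n c
    by (simp add: S_def singular_chain_iterated_subdivision)
  have Ech: "singular_chain p X c \<Longrightarrow> singular_chain (Suc p) X (E p n c)" for p n c
    by (auto simp: E_def intro!: singular_chain_sum hch Sch)
  have Dch: "singular_chain (Suc p) X (D p c)" if "singular_chain p X c" for p c
    unfolding D_def
    by (rule singular_chain_extend) (use that in \<open>auto simp: singular_chain_def [of p] singular_chain_of intro!: Ech\<close>)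
  have hsmall: "small_chain (Suc p) X U V (h p c)" if "small_chain p X U V c" for p c
    by (rule small_chain_additive_image [OF that]) (auto simp: hch additive_laws [of "h p", OF hdiff])
  have Ebd: "chain_boundary (Suc p) (E p n c) + E (p - Suc 0) n (chain_boundary p c) = S p n c - c"
    if c: "singular_chain p X c" for p n c
  proof (induction n)
    case (Suc n)
    have step: "chain_boundary (Suc p) (h p (S p n c)) + h (p - Suc 0) (S (p - Suc 0) n (chain_boundary p c))
      = S p (Suc n) c - S p n c"
      using hbd [OF Sch [OF c, of n]] chain_boundary_iterated_subdivision [OF c, of n] by (simp add: S_def)
    have "chain_boundary (Suc p) (E p (Suc n) c) + E (p - Suc 0) (Suc n) (chain_boundary p c)
      = (chain_boundary (Suc p) (E p n c) + E (p - Suc 0) n (chain_boundary p c)) +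
        (chain_boundary (Suc p) (h p (S p n c)) + h (p - Suc 0) (S (p - Suc 0) n (chain_boundary p c)))"
      by (simp add: E_def chain_boundary_add ac_simps)
    then show ?case
      by (simp only: Suc step) simp
  qed (simp add: E_def S_def)
  have \<rho>small_of: "small_chain p X U V (\<rho> p (frag_of \<sigma>))" if \<sigma>: "singular_simplex p X \<sigma>" for p \<sigma>
  proof -
    have c: "singular_chain p X (frag_of \<sigma>)"
      using \<sigma> by (simp add: singular_chain_of)
    \<comment> \<open>Subdivision at the depth of \<open>\<sigma>\<close>, followed by a correction:
      on the boundary \<open>D\<close> uses the depths of the single faces where \<open>E\<close>
      uses the depth of \<open>\<sigma>\<close>.\<close>
    have eq: "\<rho> p (frag_of \<sigma>) = S p (N p \<sigma>) (frag_of \<sigma>) +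
        (D (p - Suc 0) (chain_boundary p (frag_of \<sigma>)) - E (p - Suc 0) (N p \<sigma>) (chain_boundary p (frag_of \<sigma>)))"
      using Ebd [OF c, of "N p \<sigma>"] by (simp add: \<rho>_def Dof algebra_simps)
    have "small_chain p X U V (S p (N p \<sigma>) (frag_of \<sigma>))"
      unfolding S_def N_def by (rule small_chain_subdivision_depth) (use assms \<sigma> in auto)
    moreover have "small_chain p X U V
      (D (p - Suc 0) (chain_boundary p (frag_of \<sigma>)) - E (p - Suc 0) (N p \<sigma>) (chain_boundary p (frag_of \<sigma>)))"
    proof (cases p)
      case 0
      then show ?thesis
        by (simp add: chain_boundary_def D_def E_def S_def h0)
    next
      case (Suc q)
      let ?f = "\<lambda>j. singular_face p j \<sigma>"
      \<comment> \<open>Only the stages from the face's own depth up to that of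
        \<open>\<sigma>\<close> survive, and from its own depth on the subdivided face is
        small.\<close>
      have "D q (frag_of (?f j)) - E q (N p \<sigma>) (frag_of (?f j)) =
          - (\<Sum>i\<in>{N q (?f j)..<N p \<sigma>}. h q (S q i (frag_of (?f j))))" if "j \<le> p" for j
      proof -
        have "N q (?f j) \<le> N p \<sigma>"
          using subdivision_depth_face that by (metis N_def Suc)
        then have "{..<N p \<sigma>} = {..<N q (?f j)} \<union> {N q (?f j)..<N p \<sigma>}"
          by auto
        then show ?thesis
          by (simp add: Dof E_def sum.union_disjoint ivl_disj_int)
      qed
      moreover have "small_chain p X U V (\<Sum>i\<in>{N q (?f j)..<N p \<sigma>}. h q (S q i (frag_of (?f j))))"
        if "j \<le> p" for j
      proof (rule small_chain_sum)
        fix i assume i: "i \<in> {N q (?f j)..<N p \<sigma>}"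
        have "singular_simplex q X (?f j)"
          using singular_simplex_singular_face [OF \<sigma>] that Suc by simp
        then have "small_chain q X U V (S q i (frag_of (?f j)))"
          unfolding S_def using i by (intro small_chain_subdivision_depth) (use assms in \<open>auto simp: N_def\<close>)
        then show "small_chain p X U V (h q (S q i (frag_of (?f j))))"
          using hsmall Suc by blast
      qed
      ultimately have small: "small_chain p X U V (D q (frag_of (?f j)) - E q (N p \<sigma>) (frag_of (?f j)))"
        if "j \<le> p" for j
        using that small_chain_diff [OF small_chain_0, of p X U V] by simp
      have cmul_diff: "frag_cmul k (a - b) = frag_cmul k a - frag_cmul k b" for k and a b :: "'a chain"
        by (simp add: poly_mapping_eqI lookup_minus right_diff_distrib)
      have "D q (chain_boundary p (frag_of \<sigma>)) - E q (N p \<sigma>) (chain_boundary p (frag_of \<sigma>))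
        = (\<Sum>j\<le>p. frag_cmul ((-1) ^ j) (D q (frag_of (?f j)) - E q (N p \<sigma>) (frag_of (?f j))))"
        using Suc
        by (simp add: chain_boundary_of additive_sum [of "D q", OF Ddiff] additive_sum [of "E q _", OF Ediff]
            additive_frag_cmul [of "D q", OF Ddiff] additive_frag_cmul [of "E q _", OF Ediff]
            cmul_diff sum_subtractf del: sum.atMost_Suc)
      then show ?thesis
        using Suc small by (auto intro!: small_chain_sum small_chain_cmul simp del: sum.atMost_Suc)
    qed
    ultimately show ?thesis
      unfolding eq by (rule small_chain_add)
  qed
  have \<rho>small: "small_chain p X U V (\<rho> p c)" if "singular_chain p X c" for p c
    using that unfolding singular_chain_def
  proof (induction c rule: frag_induction)
    case zero
    have "\<rho> p 0 = 0" using additive_laws(1) [of "\<rho> p"] \<rho>diff by blast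
    then show ?case by simp
  next
    case (one x) then show ?case using \<rho>small_of by auto
  next
    case (diff a b) then show ?case by (simp add: \<rho>diff small_chain_diff)
  qed
  have "chain_boundary p (\<rho> p c) = \<rho> (p - Suc 0) (chain_boundary p c)" if c: "singular_chain p X c" for p c
  proof (cases p)
    case 0
    then show ?thesis
      using additive_laws(1) [of "\<rho> 0"] \<rho>diff by (simp add: chain_boundary_def)
  next
    case (Suc q)
    have "chain_boundary p (chain_boundary (Suc p) (D p c)) = 0"
      using chain_boundary_boundary [OF Dch [OF c]] by simp
    moreover have "chain_boundary q (chain_boundary p c) = 0"
      using chain_boundary_boundary [OF c] Suc by simp
    ultimately show ?thesis
      using Suc additive_laws(1) [of "D (q - Suc 0)"] Ddiff by (simp add: \<rho>_def chain_boundary_add)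
  qed
  moreover have "\<rho> p c = c" if c: "small_chain p X U V c" for p c
  proof -
    have Dsmall: "D p c = 0" if "small_chain p X U V c" for p c
    proof (rule small_chain_eqI [OF that, where g = "\<lambda>_. 0"])
      fix \<sigma>
      assume "singular_simplex p (subtopology X U) \<sigma>"
      then show "D p (frag_of \<sigma>) = 0"
        by (simp add: Dof N_def E_def subdivision_depth_small small_chain_left singular_chain_of)
    next
      fix \<sigma>
      assume "singular_simplex p (subtopology X V) \<sigma>"
      then show "D p (frag_of \<sigma>) = 0"
        by (simp add: Dof N_def E_def subdivision_depth_small small_chain_right singular_chain_of)
    qed (auto simp: Ddiff)
    show ?thesis
      using Dsmall [OF c] Dsmall [OF small_chain_boundary [OF c]] by (simp add: \<rho>_def)
  qed
  ultimately show ?thesis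
    using Ddiff \<rho>diff Dch \<rho>small \<rho>_def by (intro exI [of _ D] exI [of _ \<rho>]) blast
qed

section \<open>Mayer-Vietoris at the level of cochains\<close>

lemma cochain_eval_rep:
  assumes "\<And>a b. f (a - b) = f a - (f b :: 'a chain)"
  obtains \<psi> where "\<And>c. cochain_eval \<psi> c = cochain_eval \<phi> (f c)"
proof -
  have "cochain_eval (\<lambda>\<sigma>. cochain_eval \<phi> (f (frag_of \<sigma>))) c = cochain_eval \<phi> (f c)" for c
    by (rule cochain_eval_simplexwise [where f = "\<lambda>c. cochain_eval \<phi> (f c)"])
       (simp add: assms cochain_eval_diff)
  then show thesis
    using that by blast
qed

lemma cochain_eval_difference: "cochain_eval (\<lambda>\<sigma>. \<phi> \<sigma> - \<psi> \<sigma>) c = cochain_eval \<phi> c - cochain_eval \<psi> c"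
  by (rule additive_eq_on_frag [of c UNIV "cochain_eval _" "\<lambda>c. cochain_eval \<phi> c - cochain_eval \<psi> c"])
     (simp_all add: cochain_eval_diff)

text \<open>Primitives \<open>\<alpha>\<close> on U and \<open>\<beta>\<close> on V differ on the
  intersection by a cocycle, hence by the coboundary of some \<open>\<gamma>\<close>. After
  correction by it they glue to a primitive on small chains, which the deformation carries over to
  all chains.\<close>

lemma Mayer_Vietoris_union:
  fixes X :: "'a topology"
  assumes UV: "openin X U" "openin X V" "topspace X \<subseteq> U \<union> V"
    and vU: "cohomology_vanishes (Suc p) (subtopology X U)"
    and vV: "cohomology_vanishes (Suc p) (subtopology X V)"
    and vI: "cohomology_vanishes p (subtopology X (U \<inter> V))"
  shows "cohomology_vanishes (Suc p) X"
  unfolding cohomology_vanishes_def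
proof (intro allI impI)
  fix \<phi>
  assume coc: "\<forall>c. singular_chain (Suc (Suc p)) X c \<longrightarrow> cochain_eval \<phi> (chain_boundary (Suc (Suc p)) c) = 0"
  have sub: "singular_chain q X c" if "singular_chain q (subtopology X S) c" for q S c
    using that by (simp add: singular_chain_subtopology)
  obtain \<alpha> where \<alpha>: "\<And>c. singular_chain (Suc p) (subtopology X U) c \<Longrightarrow>
      cochain_eval \<phi> c = cochain_eval \<alpha> (chain_boundary (Suc p) c)"
    by (rule cohomology_vanishesE [OF vU, of \<phi>]) (use coc sub in blast)+
  obtain \<beta> where \<beta>: "\<And>c. singular_chain (Suc p) (subtopology X V) c \<Longrightarrow>
      cochain_eval \<phi> c = cochain_eval \<beta> (chain_boundary (Suc p) c)"
    by (rule cohomology_vanishesE [OF vV, of \<phi>]) (use coc sub in blast)+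
  obtain \<gamma> where \<gamma>: "\<And>c. singular_chain p (subtopology X (U \<inter> V)) c \<Longrightarrow>
      cochain_eval (\<lambda>\<sigma>. \<alpha> \<sigma> - \<beta> \<sigma>) c = cochain_eval \<gamma> (chain_boundary p c)"
  proof (rule cohomology_vanishesE [OF vI, of "\<lambda>\<sigma>. \<alpha> \<sigma> - \<beta> \<sigma>"])
    fix c assume "singular_chain (Suc p) (subtopology X (U \<inter> V)) c"
    then have "singular_chain (Suc p) (subtopology X U) c" "singular_chain (Suc p) (subtopology X V) c"
      by (auto simp: singular_chain_subtopology)
    then show "cochain_eval (\<lambda>\<sigma>. \<alpha> \<sigma> - \<beta> \<sigma>) (chain_boundary (Suc p) c) = 0"
      by (simp add: cochain_eval_difference flip: \<alpha> \<beta>)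
  qed (rule that)
  \<comment> \<open>\<open>\<gamma>\<close> is a function on all simplices, so the correction makes
    sense on U without extending \<open>\<gamma>\<close> from the intersection.\<close>
  define \<psi> where "\<psi> = (\<lambda>\<sigma>. if singular_simplex p (subtopology X U) \<sigma>
    then \<alpha> \<sigma> - cochain_eval \<gamma> (chain_boundary p (frag_of \<sigma>)) else \<beta> \<sigma>)"
  have \<psi>U: "cochain_eval \<psi> c = cochain_eval \<alpha> c - cochain_eval \<gamma> (chain_boundary p c)"
    if "singular_chain p (subtopology X U) c" for c
    by (rule singular_chain_eqI [OF that, where f = "cochain_eval \<psi>"
          and g = "\<lambda>c. cochain_eval \<alpha> c - cochain_eval \<gamma> (chain_boundary p c)"])
       (simp_all add: cochain_eval_diff chain_boundary_diff \<psi>_def)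
  have \<psi>V: "cochain_eval \<psi> c = cochain_eval \<beta> c" if "singular_chain p (subtopology X V) c" for c
  proof (rule singular_chain_eqI [OF that, where f = "cochain_eval \<psi>" and g = "cochain_eval \<beta>"])
    fix \<sigma> assume \<sigma>: "singular_simplex p (subtopology X V) \<sigma>"
    show "cochain_eval \<psi> (frag_of \<sigma>) = cochain_eval \<beta> (frag_of \<sigma>)"
    proof (cases "singular_simplex p (subtopology X U) \<sigma>")
      case True
      then have "singular_chain p (subtopology X (U \<inter> V)) (frag_of \<sigma>)"
        using \<sigma> by (simp add: singular_chain_of singular_simplex_subtopology_Int)
      from \<gamma> [OF this] True show ?thesis
        by (simp add: \<psi>_def)
    qed (simp add: \<psi>_def)
  qed (simp_all add: cochain_eval_diff)
  have small: "cochain_eval \<phi> c = cochain_eval \<psi> (chain_boundary (Suc p) c)"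
    if "small_chain (Suc p) X U V c" for c
  proof -
    obtain d e where d: "singular_chain (Suc p) (subtopology X U) d"
      and e: "singular_chain (Suc p) (subtopology X V) e" and c: "c = d + e"
      using small_chain_split [OF \<open>small_chain (Suc p) X U V c\<close>] by blast
    have "chain_boundary p (chain_boundary (Suc p) d) = 0"
      using chain_boundary_boundary [OF d] by simp
    then have "cochain_eval \<phi> d = cochain_eval \<psi> (chain_boundary (Suc p) d)"
      using \<alpha> [OF d] \<psi>U [OF singular_chain_boundary_alt [OF d]] by simp
    moreover have "cochain_eval \<phi> e = cochain_eval \<psi> (chain_boundary (Suc p) e)"
      using \<beta> [OF e] \<psi>V [OF singular_chain_boundary_alt [OF e]] by simp
    ultimately show ?thesis
      by (simp add: c cochain_eval_add chain_boundary_add)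
  qed
  obtain D \<rho> :: "nat \<Rightarrow> 'a chain \<Rightarrow> 'a chain" where
    Ddiff: "\<forall>p a b. D p (a - b) = D p a - D p b" and
    \<rho>diff: "\<forall>p a b. \<rho> p (a - b) = \<rho> p a - \<rho> p b" and
    Dch: "\<forall>p c. singular_chain p X c \<longrightarrow> singular_chain (Suc p) X (D p c)" and
    \<rho>small: "\<forall>p c. singular_chain p X c \<longrightarrow> small_chain p X U V (\<rho> p c)" and
    \<rho>bd: "\<forall>p c. singular_chain p X c \<longrightarrow> chain_boundary p (\<rho> p c) = \<rho> (p - Suc 0) (chain_boundary p c)" and
    \<rho>: "\<forall>p c. \<rho> p c = c + chain_boundary (Suc p) (D p c) + D (p - Suc 0) (chain_boundary p c)" and
    \<rho>id: "\<forall>p c. small_chain p X U V c \<longrightarrow> \<rho> p c = c"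
    using small_chain_deformation [OF UV] by (elim exE conjE)
  obtain \<psi>1 where \<psi>1: "\<And>c. cochain_eval \<psi>1 c = cochain_eval \<psi> (\<rho> p c)"
    using cochain_eval_rep [of "\<rho> p"] \<rho>diff by blast
  obtain \<psi>2 where \<psi>2: "\<And>c. cochain_eval \<psi>2 c = cochain_eval \<phi> (D p c)"
    using cochain_eval_rep [of "D p"] Ddiff by blast
  \<comment> \<open>Evaluate \<open>\<phi>\<close> on the deformed chain: the boundary term drops
    out because \<open>\<phi>\<close> is a cocycle, and the term with \<open>D\<close> is moved to
    the other side.\<close>
  have "cochain_eval \<phi> c = cochain_eval (\<lambda>\<sigma>. \<psi>1 \<sigma> - \<psi>2 \<sigma>) (chain_boundary (Suc p) c)"
    if c: "singular_chain (Suc p) X c" for c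
  proof -
    have "cochain_eval \<phi> (\<rho> (Suc p) c) = cochain_eval \<phi> c + cochain_eval \<phi> (D p (chain_boundary (Suc p) c))"
      using coc Dch [rule_format, OF c] by (simp add: \<rho> cochain_eval_add)
    moreover have "cochain_eval \<phi> (\<rho> (Suc p) c) = cochain_eval \<psi> (\<rho> p (chain_boundary (Suc p) c))"
      using small [OF \<rho>small [rule_format, OF c]] \<rho>bd [rule_format, OF c] by simp
    ultimately show ?thesis
      by (simp add: cochain_eval_difference \<psi>1 \<psi>2)
  qed
  then show "\<exists>\<psi>. \<forall>c. singular_chain (Suc p) X c \<longrightarrow>
      cochain_eval \<phi> c = cochain_eval \<psi> (chain_boundary (Suc p) c)"
    by blast
qed

text \<open>A class on U dies on the intersection, so it extends by zero over V to a class on X,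
  where it dies as well.\<close>

lemma Mayer_Vietoris_left:
  fixes X :: "'a topology"
  assumes UV: "openin X U" "openin X V" "topspace X \<subseteq> U \<union> V"
    and vX: "cohomology_vanishes p X"
    and vI: "cohomology_vanishes p (subtopology X (U \<inter> V))"
  shows "cohomology_vanishes p (subtopology X U)"
  unfolding cohomology_vanishes_def
proof (intro allI impI)
  fix \<phi>
  assume coc: "\<forall>c. singular_chain (Suc p) (subtopology X U) c \<longrightarrow> cochain_eval \<phi> (chain_boundary (Suc p) c) = 0"
  have sub: "singular_chain q X c" if "singular_chain q (subtopology X S) c" for q S c
    using that by (simp add: singular_chain_subtopology)
  obtain \<gamma> where \<gamma>: "\<And>c. singular_chain p (subtopology X (U \<inter> V)) c \<Longrightarrow>
      cochain_eval \<phi> c = cochain_eval \<gamma> (chain_boundary p c)"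
    by (rule cohomology_vanishesE [OF vI, of \<phi>]) (use coc singular_chain_mono in blast)+
  \<comment> \<open>Subtracting the coboundary of \<open>\<gamma>\<close> makes the cochain vanish
    on every simplex lying in both sets, so the extension by zero is consistent with it on
    V.\<close>
  define \<psi> where "\<psi> = (\<lambda>\<sigma>. if singular_simplex p (subtopology X U) \<sigma>
    then \<phi> \<sigma> - cochain_eval \<gamma> (chain_boundary p (frag_of \<sigma>)) else 0)"
  have \<psi>U: "cochain_eval \<psi> c = cochain_eval \<phi> c - cochain_eval \<gamma> (chain_boundary p c)"
    if "singular_chain p (subtopology X U) c" for c
    by (rule singular_chain_eqI [OF that, where f = "cochain_eval \<psi>"
          and g = "\<lambda>c. cochain_eval \<phi> c - cochain_eval \<gamma> (chain_boundary p c)"])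
       (simp_all add: cochain_eval_diff chain_boundary_diff \<psi>_def)
  have \<psi>V: "cochain_eval \<psi> c = 0" if "singular_chain p (subtopology X V) c" for c
  proof (rule singular_chain_eqI [OF that, where f = "cochain_eval \<psi>" and g = "\<lambda>_. 0"])
    fix \<sigma> assume \<sigma>: "singular_simplex p (subtopology X V) \<sigma>"
    show "cochain_eval \<psi> (frag_of \<sigma>) = 0"
    proof (cases "singular_simplex p (subtopology X U) \<sigma>")
      case True
      then have "singular_chain p (subtopology X (U \<inter> V)) (frag_of \<sigma>)"
        using \<sigma> by (simp add: singular_chain_of singular_simplex_subtopology_Int)
      from \<gamma> [OF this] show ?thesis
        by (simp add: \<psi>_def)
    qed (simp add: \<psi>_def)
  qed (simp_all add: cochain_eval_diff)
  have small: "cochain_eval \<psi> (chain_boundary (Suc p) c) = 0"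
    if "small_chain (Suc p) X U V c" for c
  proof -
    obtain d e where d: "singular_chain (Suc p) (subtopology X U) d"
      and e: "singular_chain (Suc p) (subtopology X V) e" and c: "c = d + e"
      using small_chain_split [OF \<open>small_chain (Suc p) X U V c\<close>] by blast
    have "chain_boundary p (chain_boundary (Suc p) d) = 0"
      using chain_boundary_boundary [OF d] by simp
    then have "cochain_eval \<psi> (chain_boundary (Suc p) d) = 0"
      using coc d \<psi>U [OF singular_chain_boundary_alt [OF d]] by simp
    moreover have "cochain_eval \<psi> (chain_boundary (Suc p) e) = 0"
      using \<psi>V [OF singular_chain_boundary_alt [OF e]] by simp
    ultimately show ?thesis
      by (simp add: c cochain_eval_add chain_boundary_add)
  qed
  obtain D \<rho> :: "nat \<Rightarrow> 'a chain \<Rightarrow> 'a chain" where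
    Ddiff: "\<forall>p a b. D p (a - b) = D p a - D p b" and
    \<rho>diff: "\<forall>p a b. \<rho> p (a - b) = \<rho> p a - \<rho> p b" and
    Dch: "\<forall>p c. singular_chain p X c \<longrightarrow> singular_chain (Suc p) X (D p c)" and
    \<rho>small: "\<forall>p c. singular_chain p X c \<longrightarrow> small_chain p X U V (\<rho> p c)" and
    \<rho>bd: "\<forall>p c. singular_chain p X c \<longrightarrow> chain_boundary p (\<rho> p c) = \<rho> (p - Suc 0) (chain_boundary p c)" and
    \<rho>: "\<forall>p c. \<rho> p c = c + chain_boundary (Suc p) (D p c) + D (p - Suc 0) (chain_boundary p c)" and
    \<rho>id: "\<forall>p c. small_chain p X U V c \<longrightarrow> \<rho> p c = c"
    using small_chain_deformation [OF UV] by (elim exE conjE)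
  obtain \<psi>1 where \<psi>1: "\<And>c. cochain_eval \<psi>1 c = cochain_eval \<psi> (\<rho> p c)"
    using cochain_eval_rep [of "\<rho> p"] \<rho>diff by blast
  obtain \<theta> where \<theta>: "\<And>c. singular_chain p X c \<Longrightarrow> cochain_eval \<psi>1 c = cochain_eval \<theta> (chain_boundary p c)"
  proof (rule cohomology_vanishesE [OF vX, of \<psi>1])
    fix c assume c: "singular_chain (Suc p) X c"
    then show "cochain_eval \<psi>1 (chain_boundary (Suc p) c) = 0"
      using small [OF \<rho>small [rule_format, OF c]] \<rho>bd [rule_format, OF c] by (simp add: \<psi>1)
  qed (rule that)
  have sum: "cochain_eval (\<lambda>\<sigma>. \<theta> \<sigma> - (- \<gamma> \<sigma>)) c = cochain_eval \<theta> c + cochain_eval \<gamma> c" for c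
    using cochain_eval_difference [of "\<lambda>_. 0" \<gamma> c] cochain_eval_difference [of \<theta> "\<lambda>\<sigma>. - \<gamma> \<sigma>" c]
      cochain_eval_simplexwise [of "\<lambda>_. 0" c] by simp
  \<comment> \<open>\<open>\<rho>\<close> fixes chains in U, so the primitive found on X restricts
    to one of \<open>\<psi>\<close>; adding \<open>\<gamma>\<close> back gives one of
    \<open>\<phi>\<close>.\<close>
  have "cochain_eval \<phi> c = cochain_eval (\<lambda>\<sigma>. \<theta> \<sigma> - (- \<gamma> \<sigma>)) (chain_boundary p c)"
    if c: "singular_chain p (subtopology X U) c" for c
    using \<theta> [OF sub [OF c]] \<psi>1 [of c] \<rho>id [rule_format, OF small_chain_left [OF c]] \<psi>U [OF c]
    by (simp only: sum)
  then show "\<exists>\<psi>. \<forall>c. singular_chain p (subtopology X U) c \<longrightarrow>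
      cochain_eval \<phi> c = cochain_eval \<psi> (chain_boundary p c)"
    by blast
qed

text \<open>A standard simplex is connected, so every singular simplex is constant here. Each point
  contributes a complex with one generator per degree, whose boundary maps are alternately zero and
  the identity.\<close>

lemma cohomology_vanishes_discrete:
  assumes disc: "\<And>x. x \<in> topspace X \<Longrightarrow> openin X {x}" and "p > 0"
  shows "cohomology_vanishes p X"
proof -
  obtain q where p: "p = Suc q"
    using \<open>p > 0\<close> by (cases p) auto
  define K where "K = (\<lambda>n x. restrict (\<lambda>_. x) (standard_simplex n) :: (nat \<Rightarrow> real) \<Rightarrow> 'a)"
  have K: "singular_simplex n X (K n x)" if "x \<in> topspace X" for n x
    using that by (auto simp: singular_simplex_def K_def)
  have const: "\<exists>x\<in>topspace X. \<sigma> = K n x" if \<sigma>: "singular_simplex n X \<sigma>" for n \<sigma>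
  proof -
    have cm: "continuous_map (subtopology (powertop_real UNIV) (standard_simplex n)) X \<sigma>"
      and ext: "\<sigma> \<in> extensional (standard_simplex n)"
      using \<sigma> by (auto simp: singular_simplex_def)
    obtain z where z: "z \<in> standard_simplex n"
      using nonempty_standard_simplex by blast
    have con: "connectedin X (\<sigma> ` standard_simplex n)"
      using connectedin_continuous_map_image [OF cm, of "standard_simplex n"] connectedin_standard_simplex
      by (simp add: connectedin_subtopology)
    have im: "\<sigma> ` standard_simplex n \<subseteq> topspace X"
      using con connectedin_subset_topspace by blast
    have "\<sigma> w = \<sigma> z" if w: "w \<in> standard_simplex n" for w
    proof (rule ccontr)
      assume ne: "\<sigma> w \<noteq> \<sigma> z"
      have "openin X (topspace X - {\<sigma> z})"
      proof -
        have "openin X (\<Union>x\<in>topspace X - {\<sigma> z}. {x})"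
          by (rule openin_Union) (use disc in blast)
        then show ?thesis by simp
      qed
      moreover have "openin X {\<sigma> z}" using disc im z by blast
      ultimately show False
        by (rule connectedinD [OF con]) (use im z w ne in auto)
    qed
    then have "\<sigma> = K n (\<sigma> z)"
      using ext by (auto simp: K_def extensional_def restrict_def fun_eq_iff)
    then show ?thesis using im z by blast
  qed
  have face: "singular_face (Suc n) j (K (Suc n) x) = K n x" if "j \<le> Suc n" for n j x
    using that by (auto simp: singular_face_def K_def simplical_face_in_standard_simplex intro!: restrict_ext)
  have bd: "chain_boundary (Suc n) (frag_of (K (Suc n) x)) = (if odd n then frag_of (K n x) else 0)" for n x
  proof -
    have "chain_boundary (Suc n) (frag_of (K (Suc n) x)) = (\<Sum>j\<le>Suc n. frag_cmul ((-1) ^ j) (frag_of (K n x)))"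
      unfolding chain_boundary_of using face by (auto intro!: sum.cong)
    also have "\<dots> = (if odd n then frag_of (K n x) else 0)"
    proof -
      have "(\<Sum>j\<le>Suc m. frag_cmul ((-1) ^ j) c) = (if odd m then c else 0)" for m and c :: "'a chain"
        by (induction m) auto
      then show ?thesis by blast
    qed
    finally show ?thesis .
  qed
  show ?thesis
    unfolding cohomology_vanishes_def
  proof (intro allI impI)
    fix \<phi>
    assume coc: "\<forall>c. singular_chain (Suc p) X c \<longrightarrow> cochain_eval \<phi> (chain_boundary (Suc p) c) = 0"
    \<comment> \<open>For odd q the boundary of the constant p-simplex is the constant q-simplex,
      whose point is read off by evaluation anywhere. For even q the constant p-simplex is itself a
      boundary, so \<open>\<phi>\<close> vanishes on it.\<close>
    define \<psi> where "\<psi> = (\<lambda>\<tau>. if odd q then \<phi> (K p (\<tau> (SOME z. z \<in> standard_simplex q))) else 0)"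
    have Kz: "K q x (SOME z. z \<in> standard_simplex q) = x" for x
      using nonempty_standard_simplex by (simp add: K_def some_in_eq)
    have "cochain_eval \<phi> c = cochain_eval \<psi> (chain_boundary p c)" if c: "singular_chain p X c" for c
    proof (rule singular_chain_eqI [OF c, where f = "cochain_eval \<phi>"
          and g = "\<lambda>c. cochain_eval \<psi> (chain_boundary p c)"])
      fix \<sigma> assume "singular_simplex p X \<sigma>"
      then obtain x where x: "x \<in> topspace X" "\<sigma> = K p x"
        using const by blast
      show "cochain_eval \<phi> (frag_of \<sigma>) = cochain_eval \<psi> (chain_boundary p (frag_of \<sigma>))"
      proof (cases "odd q")
        case True
        then show ?thesis by (simp add: x p bd \<psi>_def Kz)
      next
        case False
        have "singular_chain (Suc p) X (frag_of (K (Suc p) x))"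
          by (simp add: singular_chain_of K x)
        then have "\<phi> (K p x) = 0"
          using coc [rule_format, of "frag_of (K (Suc p) x)"] False by (simp add: bd p)
        then show ?thesis using False by (simp add: x p bd)
      qed
    qed (simp_all add: cochain_eval_diff chain_boundary_diff)
    then show "\<exists>\<psi>. \<forall>c. singular_chain p X c \<longrightarrow> cochain_eval \<phi> c = cochain_eval \<psi> (chain_boundary p c)"
      by blast
  qed
qed

section \<open>Homotopy invariance\<close>

abbreviation simplex_topology :: "nat \<Rightarrow> (nat \<Rightarrow> real) topology"
  where "simplex_topology q \<equiv> subtopology (powertop_real UNIV) (standard_simplex q)"

abbreviation cylinder :: "'a topology \<Rightarrow> (real \<times> 'a) topology"
  where "cylinder X \<equiv> prod_topology (top_of_set {0..1}) X"

abbreviation identity_simplex :: "nat \<Rightarrow> (nat \<Rightarrow> real) chain"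
  where "identity_simplex q \<equiv> frag_of (restrict id (standard_simplex q))"

text \<open>The prism operator attached to a chain \<open>P\<close> on the cylinder over the
  standard simplex: \<open>P\<close> is pushed forward along each simplex.\<close>

definition prism :: "nat \<Rightarrow> (real \<times> (nat \<Rightarrow> real)) chain \<Rightarrow> 'a chain \<Rightarrow> (real \<times> 'a) chain"
  where "prism q P = frag_extend (\<lambda>\<sigma>. chain_map (Suc q) (map_prod id \<sigma>) P)"

lemma prism_diff: "prism q P (a - b) = prism q P a - prism q P b"
  by (simp add: prism_def frag_extend_diff)

lemma prism_of: "prism q P (frag_of \<sigma>) = chain_map (Suc q) (map_prod id \<sigma>) P"
  by (simp add: prism_def)

lemma continuous_map_cylinder:
  "continuous_map X Y g \<Longrightarrow> continuous_map (cylinder X) (cylinder Y) (map_prod id g)"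
  using continuous_map_fst continuous_map_compose [OF continuous_map_snd]
  by (fastforce simp: map_prod_def case_prod_unfold continuous_map_paired o_def)

lemma continuous_map_cylinder_end:
  "t \<in> {0..1} \<Longrightarrow> continuous_map X (cylinder X) (Pair t)"
  by (simp add: continuous_map_pairwise o_def)

lemma singular_chain_prism:
  assumes P: "singular_chain (Suc q) (cylinder (simplex_topology q)) P" and c: "singular_chain q X c"
  shows "singular_chain (Suc q) (cylinder X) (prism q P c)"
  unfolding prism_def
proof (rule singular_chain_extend)
  fix \<sigma> assume "\<sigma> \<in> Poly_Mapping.keys c"
  then have "continuous_map (simplex_topology q) X \<sigma>"
    using c by (auto simp: singular_chain_def singular_simplex_def)
  then show "singular_chain (Suc q) (cylinder X) (chain_map (Suc q) (map_prod id \<sigma>) P)"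
    by (intro singular_chain_chain_map [OF P] continuous_map_cylinder)
qed

text \<open>Naturality, by which boundary formulas are transported from the identity simplex to all
  simplices.\<close>

lemma chain_map_prism:
  fixes g :: "'a \<Rightarrow> 'b"
  assumes P: "singular_chain (Suc q) (cylinder (simplex_topology q)) P"
  shows "chain_map (Suc q) (map_prod id g) (prism q P c) = prism q P (chain_map q g c)"
proof (rule additive_eq_on_frag [of c UNIV "\<lambda>c. chain_map (Suc q) (map_prod id g) (prism q P c)"
      "\<lambda>c. prism q P (chain_map q g c)"])
  fix \<sigma> :: "(nat \<Rightarrow> real) \<Rightarrow> 'a"
  have "chain_map (Suc q) (map_prod id g) (prism q P (frag_of \<sigma>)) =
      chain_map (Suc q) (map_prod id g \<circ> map_prod id \<sigma>) P"
    by (simp add: prism_of chain_map_compose)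
  also have "\<dots> = chain_map (Suc q) (map_prod id (simplex_map q g \<sigma>)) P"
    by (rule chain_map_eq [OF P]) (auto simp: simplex_map_def)
  finally show "chain_map (Suc q) (map_prod id g) (prism q P (frag_of \<sigma>)) = prism q P (chain_map q g (frag_of \<sigma>))"
    by (simp add: prism_of)
qed (auto simp: chain_map_diff prism_diff)

lemma chain_boundary_prism_simplex:
  assumes P: "singular_chain (Suc q) (cylinder (simplex_topology q)) P"
    and bd: "chain_boundary (Suc q) P =
      chain_map q (Pair 1) (identity_simplex q) - chain_map q (Pair 0) (identity_simplex q) - B"
    and \<sigma>: "singular_simplex q X \<sigma>"
  shows "chain_boundary (Suc q) (prism q P (frag_of \<sigma>)) =
    chain_map q (Pair 1) (frag_of \<sigma>) - chain_map q (Pair 0) (frag_of \<sigma>) - chain_map q (map_prod id \<sigma>) B"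
proof -
  have "chain_map q (map_prod id \<sigma>) (chain_map q (Pair t) (identity_simplex q)) =
      chain_map q (Pair t) (frag_of \<sigma>)" for t :: real
  proof -
    have "map_prod id \<sigma> \<circ> Pair t = Pair t \<circ> \<sigma>" by auto
    then have "chain_map q (map_prod id \<sigma>) (chain_map q (Pair t) (identity_simplex q)) =
        chain_map q (Pair t) (chain_map q \<sigma> (identity_simplex q))"
      by (metis chain_map_compose comp_apply)
    then show ?thesis
      by (simp only: singular_simplex_chain_map_id [OF \<sigma>])
  qed
  then show ?thesis
    using chain_boundary_chain_map [OF P, of "map_prod id \<sigma>"]
    by (simp only: prism_of bd chain_map_diff diff_Suc_Suc diff_zero)
qed

lemma singular_simplex_identity: "singular_chain q (simplex_topology q) (identity_simplex q)"
  by (auto simp: singular_chain_of singular_simplex_def continuous_map_in_subtopology continuous_map_from_subtopology)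

text \<open>Contracting the interval linearly makes \<open>z\<close> homologous to its collapse,
  which is 0. From a primitive \<open>d\<close> its own collapse is subtracted; as the collapse is
  idempotent, the result is again killed by it.\<close>

lemma collapse_chain_map:
  fixes X :: "'a topology"
  defines "r \<equiv> (\<lambda>(t, x). (0, x)) :: real \<times> 'a \<Rightarrow> real \<times> 'a"
  assumes z: "singular_chain q (cylinder X) z" "chain_boundary q z = 0" "chain_map q r z = 0"
  obtains P where "singular_chain (Suc q) (cylinder X) P" "chain_boundary (Suc q) P = z"
    "chain_map (Suc q) r P = 0"
proof -
  have cmr: "continuous_map (cylinder X) (cylinder X) r"
    unfolding r_def case_prod_unfold by (simp add: continuous_map_paired continuous_map_snd)
  have "homotopic_with (\<lambda>h. h \<in> {} \<rightarrow> {}) (cylinder X) (cylinder X) id r"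
    unfolding homotopic_with_def
  proof (intro exI conjI)
    let ?h = "\<lambda>(t::real, y). ((1 - t) * fst y, snd y) :: real \<times> 'a"
    have "continuous_map (prod_topology (top_of_set {0..1}) (cylinder X)) (cylinder X)
        (\<lambda>p. ((1 - fst p) * fst (snd p), snd (snd p)))"
    proof (subst continuous_map_paired, intro conjI)
      let ?T = "prod_topology (top_of_set {0..1::real}) (cylinder X)"
      have 1: "continuous_map ?T euclideanreal (\<lambda>p. fst p)"
        using continuous_map_fst [of "top_of_set {0..1::real}" "cylinder X"]
        by (auto simp: continuous_map_in_subtopology)
      have s: "continuous_map ?T (cylinder X) snd"
        by (rule continuous_map_snd)
      have 2: "continuous_map ?T euclideanreal (\<lambda>p. fst (snd p))"
        using continuous_map_compose [OF s continuous_map_fst]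
        by (auto simp: continuous_map_in_subtopology o_def)
      show "continuous_map ?T X (\<lambda>p. snd (snd p))"
        using continuous_map_compose [OF s continuous_map_snd] by (simp add: o_def)
      show "continuous_map ?T (top_of_set {0..1}) (\<lambda>p. (1 - fst p) * fst (snd p))"
        unfolding continuous_map_in_subtopology
        by (auto intro!: continuous_map_real_mult continuous_map_diff 1 2 mult_le_one)
    qed
    then show "continuous_map (prod_topology (top_of_set {0..1}) (cylinder X)) (cylinder X) ?h"
      by (simp add: case_prod_unfold)
  qed (auto simp: r_def)
  then have "homologous_rel q (cylinder X) {} (chain_map q id z) (chain_map q r z)"
    by (rule homotopic_imp_homologous_rel_chain_maps) (simp add: singular_cycle z)
  then have "singular_relboundary q (cylinder X) {} z"
    using z by (simp add: homologous_rel_def chain_map_ident)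
  then obtain d where d: "singular_chain (Suc q) (cylinder X) d" "chain_boundary (Suc q) d = z"
    unfolding singular_boundary by blast
  show thesis
  proof
    show "singular_chain (Suc q) (cylinder X) (d - chain_map (Suc q) r d)"
      by (intro singular_chain_diff singular_chain_chain_map [OF _ cmr] d)
    show "chain_boundary (Suc q) (d - chain_map (Suc q) r d) = z"
      using d z by (simp add: chain_boundary_diff chain_boundary_chain_map)
    have "r \<circ> r = r" by (auto simp: r_def)
    then have "chain_map (Suc q) r (chain_map (Suc q) r d) = chain_map (Suc q) r d"
      by (metis chain_map_compose comp_apply)
    then show "chain_map (Suc q) r (d - chain_map (Suc q) r d) = 0"
      by (simp add: chain_map_diff)
  qed
qed

text \<open>The universal prisms, by acyclic models: a chain killed by the collapse \<open>(t, x) \<mapsto> (0, x)\<close> of the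
  cylinder is a boundary as soon as it is a cycle, and this property is kept as an invariant.\<close>
lemma universal_prisms_exist:
  obtains P :: "nat \<Rightarrow> (real \<times> (nat \<Rightarrow> real)) chain" where
    "\<And>q. singular_chain (Suc q) (cylinder (simplex_topology q)) (P q)"
    "\<And>q. chain_boundary (Suc q) (P q) =
      chain_map q (Pair 1) (identity_simplex q) - chain_map q (Pair 0) (identity_simplex q) -
      (if q = 0 then 0 else prism (q - Suc 0) (P (q - Suc 0)) (chain_boundary q (identity_simplex q)))"
proof -
  let ?\<iota> = identity_simplex
  define r :: "real \<times> (nat \<Rightarrow> real) \<Rightarrow> real \<times> (nat \<Rightarrow> real)" where "r = (\<lambda>(t, x). (0, x))"
  define E where "E = (\<lambda>q. chain_map q (Pair (1::real)) (?\<iota> q) - chain_map q (Pair 0) (?\<iota> q))"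
  \<comment> \<open>The last clause concerns cycles only, for which the correction by lower prisms
    disappears; the next step applies it to the boundary of the identity simplex.\<close>
  define good where "good = (\<lambda>q P. singular_chain (Suc q) (cylinder (simplex_topology q)) P \<and>
    chain_map (Suc q) r P = 0 \<and> (\<forall>(X::(nat \<Rightarrow> real) topology) c. singular_chain q X c \<longrightarrow> chain_boundary q c = 0 \<longrightarrow>
      chain_boundary (Suc q) (prism q P c) = chain_map q (Pair 1) c - chain_map q (Pair 0) c))"
  define linked where "linked = (\<lambda>q P P'. chain_boundary (Suc (Suc q)) P' = E (Suc q) - prism q P (chain_boundary (Suc q) (?\<iota> (Suc q))))"
  have rE: "chain_map q r (E q) = 0" for q
  proof -
    have "chain_map q r (chain_map q (Pair t) (?\<iota> q)) = chain_map q (Pair 0) (?\<iota> q)" for t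
    proof -
      have "r \<circ> Pair t = Pair 0" by (auto simp: r_def)
      then show ?thesis by (metis chain_map_compose comp_apply)
    qed
    then show ?thesis by (simp add: E_def chain_map_diff)
  qed
  have Ech: "singular_chain q (cylinder (simplex_topology q)) (E q)" for q
    unfolding E_def
    by (intro singular_chain_diff singular_chain_chain_map [OF singular_simplex_identity] continuous_map_cylinder_end) auto
  have E0: "chain_boundary 0 c = 0" for c :: "'b chain"
    by (simp add: chain_boundary_def)
  have "\<exists>P. \<forall>n. good n (P n) \<and> linked n (P n) (P (Suc n))"
  proof (rule dependent_nat_choice)
    obtain P where P: "singular_chain (Suc 0) (cylinder (simplex_topology 0)) P"
      "chain_boundary (Suc 0) P = E 0" "chain_map (Suc 0) r P = 0"
      unfolding r_def
      by (rule collapse_chain_map [OF Ech [of 0] E0 rE [of 0, unfolded r_def]])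
    have "chain_boundary (Suc 0) (prism 0 P c) = chain_map 0 (Pair 1) c - chain_map 0 (Pair 0) c"
      if "singular_chain 0 X c" for X and c :: "(nat \<Rightarrow> real) chain"
      by (rule singular_chain_eqI [OF that, where f = "\<lambda>c. chain_boundary (Suc 0) (prism 0 P c)"
            and g = "\<lambda>c. chain_map 0 (Pair 1) c - chain_map 0 (Pair 0) c"])
         (simp_all add: prism_diff chain_boundary_diff chain_map_diff
           chain_boundary_prism_simplex [OF P(1), of 0] P(2) E_def)
    then show "\<exists>P. good 0 P"
      using P by (auto simp: good_def)
  next
    fix P q assume good: "good q P"
    then have P: "singular_chain (Suc q) (cylinder (simplex_topology q)) P" and rP: "chain_map (Suc q) r P = 0"
      by (auto simp: good_def)
    define b where "b = chain_boundary (Suc q) (?\<iota> (Suc q))"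
    have b: "singular_chain q (simplex_topology (Suc q)) b" "chain_boundary q b = 0"
      unfolding b_def
      using singular_chain_boundary_alt [OF singular_simplex_identity]
        chain_boundary_boundary [OF singular_simplex_identity, of "Suc q"] by auto
    \<comment> \<open>The prescribed boundary of the next prism. It is a cycle by the clause on
      cycles in \<open>good\<close>, and the collapse kills it because it kills
      \<open>E (Suc q)\<close> and \<open>P\<close>.\<close>
    define z where "z = E (Suc q) - prism q P b"
    have z1: "singular_chain (Suc q) (cylinder (simplex_topology (Suc q))) z"
      unfolding z_def by (intro singular_chain_diff Ech singular_chain_prism P b)
    have "chain_boundary (Suc q) (E (Suc q)) = chain_map q (Pair 1) b - chain_map q (Pair 0) b"
      by (simp only: E_def chain_boundary_diff b_def chain_boundary_chain_map [OF singular_simplex_identity]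
          diff_Suc_Suc diff_zero)
    then have z2: "chain_boundary (Suc q) z = 0"
      using good b by (simp add: z_def chain_boundary_diff good_def)
    have "chain_map (Suc q) r (prism q P b) = 0"
    proof (rule additive_eq_on_frag [of b UNIV "\<lambda>b. chain_map (Suc q) r (prism q P b)" "\<lambda>_. 0"])
      fix \<sigma> :: "(nat \<Rightarrow> real) \<Rightarrow> nat \<Rightarrow> real"
      have comm: "r \<circ> map_prod id \<sigma> = map_prod id \<sigma> \<circ> r" by (auto simp: r_def)
      have "chain_map (Suc q) r (prism q P (frag_of \<sigma>)) = chain_map (Suc q) (r \<circ> map_prod id \<sigma>) P"
        by (simp add: prism_of chain_map_compose)
      also have "\<dots> = chain_map (Suc q) (map_prod id \<sigma>) (chain_map (Suc q) r P)"
        by (simp only: comm) (simp add: chain_map_compose)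
      finally have "chain_map (Suc q) r (prism q P (frag_of \<sigma>)) =
        chain_map (Suc q) (map_prod id \<sigma>) (chain_map (Suc q) r P)" .
      then show "chain_map (Suc q) r (prism q P (frag_of \<sigma>)) = 0"
        by (simp add: rP)
    qed (auto simp: chain_map_diff prism_diff)
    then have z3: "chain_map (Suc q) r z = 0"
      by (simp add: z_def chain_map_diff rE)
    obtain P' where P': "singular_chain (Suc (Suc q)) (cylinder (simplex_topology (Suc q))) P'"
      "chain_boundary (Suc (Suc q)) P' = z" "chain_map (Suc (Suc q)) r P' = 0"
      unfolding r_def by (rule collapse_chain_map [OF z1 z2 z3 [unfolded r_def]])
    have main: "chain_boundary (Suc (Suc q)) (prism (Suc q) P' c) =
        chain_map (Suc q) (Pair 1) c - chain_map (Suc q) (Pair 0) c - prism q P (chain_boundary (Suc q) c)"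
      if "singular_chain (Suc q) X c" for X and c :: "(nat \<Rightarrow> real) chain"
    proof (rule singular_chain_eqI [OF that, where f = "\<lambda>c. chain_boundary (Suc (Suc q)) (prism (Suc q) P' c)"
          and g = "\<lambda>c. chain_map (Suc q) (Pair 1) c - chain_map (Suc q) (Pair 0) c - prism q P (chain_boundary (Suc q) c)"])
      fix \<sigma> assume \<sigma>: "singular_simplex (Suc q) X \<sigma>"
      have "chain_map (Suc q) (map_prod id \<sigma>) (prism q P b) = prism q P (chain_boundary (Suc q) (frag_of \<sigma>))"
        using chain_map_prism [OF P, of \<sigma> b] chain_boundary_chain_map [OF singular_simplex_identity, of "Suc q" \<sigma>]
          singular_simplex_chain_map_id [OF \<sigma>] by (simp add: b_def)
      then show "chain_boundary (Suc (Suc q)) (prism (Suc q) P' (frag_of \<sigma>)) =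
          chain_map (Suc q) (Pair 1) (frag_of \<sigma>) - chain_map (Suc q) (Pair 0) (frag_of \<sigma>) -
          prism q P (chain_boundary (Suc q) (frag_of \<sigma>))"
        using chain_boundary_prism_simplex [OF P'(1) _ \<sigma>, of "prism q P b"] P'(2) by (simp add: z_def E_def)
    qed (auto simp: prism_diff chain_boundary_diff chain_map_diff)
    have p0: "prism q P 0 = (0 :: (real \<times> (nat \<Rightarrow> real)) chain)"
      by (simp add: prism_def)
    show "\<exists>P'. good (Suc q) P' \<and> linked q P P'"
      using P' main p0 by (intro exI [of _ P']) (simp add: good_def linked_def z_def b_def)
  qed
  then obtain P where good: "\<And>q. good q (P q)" and nxt: "\<And>q. linked q (P q) (P (Suc q))"
    by blast
  show thesis
  proof
    show "singular_chain (Suc q) (cylinder (simplex_topology q)) (P q)" for q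
      using good by (simp add: good_def)
    show "chain_boundary (Suc q) (P q) =
      chain_map q (Pair 1) (?\<iota> q) - chain_map q (Pair 0) (?\<iota> q) -
      (if q = 0 then 0 else prism (q - Suc 0) (P (q - Suc 0)) (chain_boundary q (?\<iota> q)))" for q
    proof (cases q)
      case 0
      \<comment> \<open>The identity simplex pushes \<open>P 0\<close> to itself, so the clause on
        cycles becomes the boundary formula for \<open>P 0\<close>.\<close>
      have id: "prism 0 (P 0) (?\<iota> 0) = P 0"
        using good [of 0] by (auto simp: good_def prism_of intro!: chain_map_id_gen)
      have "chain_boundary 0 (?\<iota> 0) = 0"
        by (simp add: chain_boundary_def)
      then have "chain_boundary (Suc 0) (prism 0 (P 0) (?\<iota> 0)) =
          chain_map 0 (Pair 1) (?\<iota> 0) - chain_map 0 (Pair 0) (?\<iota> 0)"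
        using good [of 0] singular_simplex_identity [of 0] unfolding good_def by blast
      then show ?thesis by (simp add: id 0)
    next
      case (Suc p)
      then show ?thesis using nxt [of p] by (simp add: linked_def E_def)
    qed
  qed
qed

text \<open>The prisms are pushed through the homotopy. The result is kept as an additive operator
  on chains because cochains are going to be pulled back along it; agreement on homology classes
  would not suffice.\<close>

lemma homotopic_chain_homotopy:
  fixes X :: "'a topology" and Y :: "'b topology"
  assumes "homotopic_with (\<lambda>_. True) X Y f g"
  shows "\<exists>K :: nat \<Rightarrow> 'a chain \<Rightarrow> 'b chain. (\<forall>q a b. K q (a - b) = K q a - K q b) \<and>
    (\<forall>q c. singular_chain q X c \<longrightarrow> singular_chain (Suc q) Y (K q c)) \<and>
    (\<forall>q c. singular_chain q X c \<longrightarrow>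
      chain_boundary (Suc q) (K q c) = chain_map q g c - chain_map q f c - K (q - Suc 0) (chain_boundary q c))"
proof -
  obtain h where h: "continuous_map (cylinder X) Y h" "\<And>x. h (0, x) = f x" "\<And>x. h (1, x) = g x"
    using assms unfolding homotopic_with_def by blast
  obtain P :: "nat \<Rightarrow> (real \<times> (nat \<Rightarrow> real)) chain" where
    P: "\<And>q. singular_chain (Suc q) (cylinder (simplex_topology q)) (P q)" and
    Pbd: "\<And>q. chain_boundary (Suc q) (P q) =
      chain_map q (Pair 1) (identity_simplex q) - chain_map q (Pair 0) (identity_simplex q) -
      (if q = 0 then 0 else prism (q - Suc 0) (P (q - Suc 0)) (chain_boundary q (identity_simplex q)))"
    using universal_prisms_exist by metis
  define K where "K = (\<lambda>q c. chain_map (Suc q) h (prism q (P q) c))"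
  have bd: "chain_boundary (Suc q) (prism q (P q) c) = chain_map q (Pair 1) c - chain_map q (Pair 0) c -
      (if q = 0 then 0 else prism (q - Suc 0) (P (q - Suc 0)) (chain_boundary q c))"
    if "singular_chain q X c" for q c
  proof (rule singular_chain_eqI [OF that, where f = "\<lambda>c. chain_boundary (Suc q) (prism q (P q) c)"
        and g = "\<lambda>c. chain_map q (Pair 1) c - chain_map q (Pair 0) c -
      (if q = 0 then 0 else prism (q - Suc 0) (P (q - Suc 0)) (chain_boundary q c))"])
    fix \<sigma> assume \<sigma>: "singular_simplex q X \<sigma>"
    have "chain_map q (map_prod id \<sigma>) (prism (q - Suc 0) (P (q - Suc 0)) (chain_boundary q (identity_simplex q)))
        = prism (q - Suc 0) (P (q - Suc 0)) (chain_boundary q (frag_of \<sigma>))" if "q \<noteq> 0"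
      using chain_map_prism [OF P [of "q - Suc 0"], of \<sigma> "chain_boundary q (identity_simplex q)"]
        chain_boundary_chain_map [OF singular_simplex_identity, of q \<sigma>]
        singular_simplex_chain_map_id [OF \<sigma>] that by simp
    then show "chain_boundary (Suc q) (prism q (P q) (frag_of \<sigma>)) =
        chain_map q (Pair 1) (frag_of \<sigma>) - chain_map q (Pair 0) (frag_of \<sigma>) -
        (if q = 0 then 0 else prism (q - Suc 0) (P (q - Suc 0)) (chain_boundary q (frag_of \<sigma>)))"
      using chain_boundary_prism_simplex [OF P Pbd \<sigma>] by simp
  qed (auto simp: prism_diff chain_boundary_diff chain_map_diff)
  have ends: "chain_map q h (chain_map q (Pair 1) c) = chain_map q g c"
    "chain_map q h (chain_map q (Pair 0) c) = chain_map q f c" for q and c :: "'a chain"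
  proof -
    have "h \<circ> Pair 1 = g" "h \<circ> Pair 0 = f" using h by auto
    then show "chain_map q h (chain_map q (Pair 1) c) = chain_map q g c"
      "chain_map q h (chain_map q (Pair 0) c) = chain_map q f c"
      by (metis chain_map_compose comp_apply)+
  qed
  have "chain_boundary (Suc q) (K q c) = chain_map q g c - chain_map q f c - K (q - Suc 0) (chain_boundary q c)"
    if c: "singular_chain q X c" for q c
  proof -
    have "chain_boundary (Suc q) (K q c) = chain_map q h (chain_boundary (Suc q) (prism q (P q) c))"
      using chain_boundary_chain_map [OF singular_chain_prism [OF P c]] by (simp add: K_def)
    also have "\<dots> = chain_map q g c - chain_map q f c - K (q - Suc 0) (chain_boundary q c)"
    proof (cases q)
      case 0
      \<comment> \<open>In degree 0 the index \<open>q - Suc 0\<close> is 0 again, and the extra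
        term is the prism of the zero chain.\<close>
      have "chain_boundary 0 c = 0" by (simp add: chain_boundary_def)
      moreover have "prism 0 (P 0) 0 = (0 :: (real \<times> 'a) chain)" by (simp add: prism_def)
      ultimately show ?thesis using bd [OF c] by (simp add: 0 chain_map_diff ends K_def)
    next
      case (Suc p)
      then show ?thesis using bd [OF c] by (simp add: chain_map_diff ends K_def)
    qed
    finally show ?thesis .
  qed
  then show ?thesis
    by (intro exI [of _ K])
       (auto simp: K_def prism_diff chain_map_diff intro!: singular_chain_chain_map [OF _ h(1)] singular_chain_prism P)
qed

text \<open>A cocycle on X pulled back along \<open>g\<close> has a primitive on Y. Pulling this
  back along \<open>f\<close> gives a primitive of the cocycle pulled back along
  \<open>g \<circ> f\<close>, which differs from the cocycle by a homotopy term; a one-sided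
  homotopy inverse thus suffices.\<close>

lemma cohomology_vanishes_dominated:
  assumes f: "continuous_map X Y f" and g: "continuous_map Y X g"
    and hom: "homotopic_with (\<lambda>_. True) X X (g \<circ> f) id"
    and van: "cohomology_vanishes p Y"
  shows "cohomology_vanishes p X"
  unfolding cohomology_vanishes_def
proof (intro allI impI)
  fix \<phi>
  assume coc: "\<forall>c. singular_chain (Suc p) X c \<longrightarrow> cochain_eval \<phi> (chain_boundary (Suc p) c) = 0"
  obtain \<phi>g where \<phi>g: "\<And>c. cochain_eval \<phi>g c = cochain_eval \<phi> (chain_map p g c)"
  proof -
    have "cochain_eval (\<lambda>\<sigma>. cochain_eval \<phi> (chain_map p g (frag_of \<sigma>))) c = cochain_eval \<phi> (chain_map p g c)" for c
      by (rule cochain_eval_simplexwise [where f = "\<lambda>c. cochain_eval \<phi> (chain_map p g c)"])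
         (simp add: chain_map_diff cochain_eval_diff)
    then show thesis using that by blast
  qed
  obtain \<psi> where \<psi>: "\<And>c. singular_chain p Y c \<Longrightarrow> cochain_eval \<phi>g c = cochain_eval \<psi> (chain_boundary p c)"
  proof (rule cohomology_vanishesE [OF van, of \<phi>g])
    fix c assume c: "singular_chain (Suc p) Y c"
    then show "cochain_eval \<phi>g (chain_boundary (Suc p) c) = 0"
      using coc [rule_format, OF singular_chain_chain_map [OF c g]] chain_boundary_chain_map [OF c, of g]
      by (simp add: \<phi>g)
  qed (rule that)
  obtain K where Kdiff: "\<forall>q a b. K q (a - b) = K q a - K q b"
    and Kch: "\<forall>q c. singular_chain q X c \<longrightarrow> singular_chain (Suc q) X (K q c)"
    and Kbd: "\<forall>q c. singular_chain q X c \<longrightarrow>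
      chain_boundary (Suc q) (K q c) = chain_map q id c - chain_map q (g \<circ> f) c - K (q - Suc 0) (chain_boundary q c)"
    using homotopic_chain_homotopy [OF hom] by (elim exE conjE)
  \<comment> \<open>The primitive on X: that of Y pulled back along \<open>f\<close>, plus
    \<open>\<phi>\<close> pulled back along the chain homotopy.\<close>
  define F where "F = (\<lambda>c. cochain_eval \<psi> (chain_map (p - Suc 0) f c) + cochain_eval \<phi> (K (p - Suc 0) c))"
  have F: "cochain_eval (\<lambda>\<sigma>. F (frag_of \<sigma>)) c = F c" for c
    by (rule cochain_eval_simplexwise) (simp add: F_def chain_map_diff cochain_eval_diff Kdiff)
  have "cochain_eval \<phi> c = F (chain_boundary p c)" if c: "singular_chain p X c" for c
  proof -
    have "cochain_eval \<phi> (chain_map p (g \<circ> f) c) = cochain_eval \<psi> (chain_map (p - Suc 0) f (chain_boundary p c))"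
      using \<psi> [OF singular_chain_chain_map [OF c f]] chain_boundary_chain_map [OF c, of f]
      by (simp add: \<phi>g chain_map_compose)
    moreover have "cochain_eval \<phi> (chain_boundary (Suc p) (K p c)) = 0"
      using coc Kch c by blast
    ultimately show ?thesis
      using Kbd [rule_format, OF c] c by (simp add: F_def cochain_eval_diff chain_map_ident)
  qed
  then show "\<exists>\<psi>. \<forall>c. singular_chain p X c \<longrightarrow> cochain_eval \<phi> c = cochain_eval \<psi> (chain_boundary p c)"
    by (intro exI [of _ "\<lambda>\<sigma>. F (frag_of \<sigma>)"]) (simp add: F)
qed

section \<open>Subspaces of a complex torus\<close>

text \<open>Unions of fibres of the quotient map from C^n to E^n. Subsets of E^n are handled through
  such sets upstairs, where vectors can be added.\<close>

definition torus_saturated :: "complex set \<Rightarrow> (complex ^ 'n) set \<Rightarrow> bool"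
  where "torus_saturated L S \<longleftrightarrow> (\<forall>z\<in>S. \<forall>w. ell_power_point L w = ell_power_point L z \<longrightarrow> w \<in> S)"

definition torus_subspace :: "complex set \<Rightarrow> (complex ^ 'n) set \<Rightarrow> (complex ^ 'n) set topology"
  where "torus_subspace L S = subtopology (ell_power_topology L) (ell_power_point L ` S)"

definition torus_vanishes :: "complex set \<Rightarrow> nat \<Rightarrow> (complex ^ 'n) set \<Rightarrow> bool"
  where "torus_vanishes L k S \<longleftrightarrow> cohomology_vanishes k (torus_subspace L S)"

lemma torus_saturated_Int: "torus_saturated L S \<Longrightarrow> torus_saturated L S' \<Longrightarrow> torus_saturated L (S \<inter> S')"
  and torus_saturated_Un: "torus_saturated L S \<Longrightarrow> torus_saturated L S' \<Longrightarrow> torus_saturated L (S \<union> S')"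
  unfolding torus_saturated_def by blast+

lemma torus_saturated_image_Int:
  "torus_saturated L S \<Longrightarrow> ell_power_point L ` S \<inter> ell_power_point L ` S' = ell_power_point L ` (S \<inter> S')"
  unfolding torus_saturated_def by (auto simp: image_iff)

lemma openin_ell_power_topology:
  fixes U :: "(complex ^ 'n) set set"
  shows "openin (ell_power_topology L) U \<longleftrightarrow> U \<subseteq> ell_power L \<and> open (ell_power_point L -` U)"
proof -
  have "istopology (\<lambda>U :: (complex ^ 'n) set set. U \<subseteq> ell_power L \<and> open (ell_power_point L -` U))"
    unfolding istopology_def by (auto simp: vimage_Union)
  then show ?thesis
    unfolding ell_power_topology_def by (simp only: topology_inverse')
qed

lemma topspace_ell_power_topology:
  "topspace (ell_power_topology L) = (ell_power L :: (complex ^ 'n) set set)"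
proof -
  have "openin (ell_power_topology L) (ell_power L :: (complex ^ 'n) set set)"
    by (simp add: openin_ell_power_topology ell_power_def vimage_def)
  then show ?thesis
    by (meson openin_ell_power_topology openin_subset openin_topspace subset_antisym)
qed

lemma topspace_torus_subspace [simp]: "topspace (torus_subspace L S) = ell_power_point L ` S"
  by (auto simp: torus_subspace_def topspace_ell_power_topology ell_power_def)

lemma torus_vanishes_empty: "torus_vanishes L k {}"
  by (simp add: torus_vanishes_def cohomology_vanishes_empty)

lemma subtopology_torus_subspace:
  "S' \<subseteq> S \<Longrightarrow> subtopology (torus_subspace L S) (ell_power_point L ` S') = torus_subspace L S'"
  unfolding torus_subspace_def subtopology_subtopology by (simp add: image_mono inf.absorb2)

text \<open>The quotient arguments here rest on the group structure of the lattice; coordinates with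
  respect to the periods enter with \<open>period_pair\<close>.\<close>

locale additive_subgroup =
  fixes L :: "complex set"
  assumes zero_mem: "0 \<in> L" and diff_mem: "\<And>a b. a \<in> L \<Longrightarrow> b \<in> L \<Longrightarrow> a - b \<in> L"
begin

lemma minus_mem: "a \<in> L \<Longrightarrow> - a \<in> L"
  using diff_mem [OF zero_mem] by simp

lemma add_mem: "a \<in> L \<Longrightarrow> b \<in> L \<Longrightarrow> a + b \<in> L"
  using diff_mem [of a "- b"] minus_mem by simp

lemma ell_point_eq_iff: "ell_point L z = ell_point L w \<longleftrightarrow> z - w \<in> L"
proof
  assume "ell_point L z = ell_point L w"
  then show "z - w \<in> L"
    using zero_mem by (auto simp: ell_point_def)
next
  assume zw: "z - w \<in> L"
  have "v - z \<in> L \<longleftrightarrow> v - w \<in> L" for v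
    using add_mem [OF _ zw, of "v - z"] diff_mem [OF _ zw, of "v - w"] by auto
  then show "ell_point L z = ell_point L w"
    by (simp add: ell_point_def)
qed

lemma ell_power_point_eq_iff: "ell_power_point L z = ell_power_point L w \<longleftrightarrow> (\<forall>i. z $ i - w $ i \<in> L)"
proof
  assume "ell_power_point L z = ell_power_point L w"
  moreover have "z \<in> ell_power_point L z"
    using zero_mem by (simp add: ell_power_point_def)
  ultimately show "\<forall>i. z $ i - w $ i \<in> L"
    by (auto simp: ell_power_point_def)
next
  assume zw: "\<forall>i. z $ i - w $ i \<in> L"
  have "v $ i - z $ i \<in> L \<longleftrightarrow> v $ i - w $ i \<in> L" for v :: "complex ^ 'a" and i
    using add_mem [of "v $ i - z $ i" "z $ i - w $ i"] diff_mem [of "v $ i - w $ i" "z $ i - w $ i"] zw by auto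
  then show "ell_power_point L z = ell_power_point L w"
    by (simp add: ell_power_point_def)
qed

lemma ell_power_point_translate:
  "ell_power_point L z = ell_power_point L z' \<Longrightarrow> ell_power_point L (z + v) = ell_power_point L (z' + v)"
  by (simp add: ell_power_point_eq_iff)

text \<open>The quotient map is open, since saturating an open set amounts to taking the union of
  its translates by lattice vectors.\<close>

lemma openin_ell_power_point_image:
  assumes "open U"
  shows "openin (ell_power_topology L) (ell_power_point L ` U)"
proof -
  have "ell_power_point L -` (ell_power_point L ` U) = (\<Union>v\<in>{v. \<forall>i. v $ i \<in> L}. (+) v ` U)"
  proof (intro Set.set_eqI iffI)
    fix z assume "z \<in> ell_power_point L -` (ell_power_point L ` U)"
    then obtain u where u: "u \<in> U" "ell_power_point L z = ell_power_point L u" by auto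
    then have "z - u \<in> {v. \<forall>i. v $ i \<in> L}" "z \<in> (+) (z - u) ` U"
      by (auto simp: ell_power_point_eq_iff intro: image_eqI [of _ _ u])
    then show "z \<in> (\<Union>v\<in>{v. \<forall>i. v $ i \<in> L}. (+) v ` U)" by blast
  next
    fix z assume "z \<in> (\<Union>v\<in>{v. \<forall>i. v $ i \<in> L}. (+) v ` U)"
    then obtain v u where "\<forall>i. v $ i \<in> L" "u \<in> U" "z = v + u" by auto
    then have "ell_power_point L z = ell_power_point L u"
      by (simp add: ell_power_point_eq_iff)
    then show "z \<in> ell_power_point L -` (ell_power_point L ` U)"
      using \<open>u \<in> U\<close> by auto
  qed
  then show ?thesis
    using assms by (auto simp: openin_ell_power_topology ell_power_def intro!: open_UN open_translation)
qed

lemma openin_torus_subspace_image: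
  assumes "torus_saturated L S" "openin (top_of_set S) U"
  shows "openin (torus_subspace L S) (ell_power_point L ` U)"
proof -
  obtain W where W: "open W" "U = S \<inter> W"
    using assms(2) by (auto simp: openin_open)
  then have "ell_power_point L ` U = ell_power_point L ` W \<inter> ell_power_point L ` S"
    using torus_saturated_image_Int [OF assms(1), of W] by blast
  then show ?thesis
    unfolding torus_subspace_def openin_subtopology using openin_ell_power_point_image [OF W(1)] by blast
qed

section \<open>Mayer-Vietoris, maps and homotopies on saturated sets\<close>

lemma torus_vanishes_union:
  assumes U: "torus_saturated L U" "openin (top_of_set (U \<union> V)) U"
    and V: "torus_saturated L V" "openin (top_of_set (U \<union> V)) V"
    and "torus_vanishes L (Suc k) U" "torus_vanishes L (Suc k) V" "torus_vanishes L k (U \<inter> V)"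
  shows "torus_vanishes L (Suc k) (U \<union> V)"
  unfolding torus_vanishes_def
proof (rule Mayer_Vietoris_union)
  have sat: "torus_saturated L (U \<union> V)"
    by (rule torus_saturated_Un) fact+
  show "openin (torus_subspace L (U \<union> V)) (ell_power_point L ` U)"
    "openin (torus_subspace L (U \<union> V)) (ell_power_point L ` V)"
    by (rule openin_torus_subspace_image [OF sat]; fact)+
qed (use assms in \<open>auto simp: torus_vanishes_def subtopology_torus_subspace torus_saturated_image_Int [OF U(1)] le_infI1\<close>)

lemma torus_vanishes_left:
  assumes U: "torus_saturated L U" "openin (top_of_set (U \<union> V)) U"
    and V: "torus_saturated L V" "openin (top_of_set (U \<union> V)) V"
    and "torus_vanishes L k (U \<union> V)" "torus_vanishes L k (U \<inter> V)"
  shows "torus_vanishes L k U"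
proof -
  have sat: "torus_saturated L (U \<union> V)"
    by (rule torus_saturated_Un) fact+
  have "cohomology_vanishes k (subtopology (torus_subspace L (U \<union> V)) (ell_power_point L ` U))"
  proof (rule Mayer_Vietoris_left)
    show "openin (torus_subspace L (U \<union> V)) (ell_power_point L ` U)"
      "openin (torus_subspace L (U \<union> V)) (ell_power_point L ` V)"
      by (rule openin_torus_subspace_image [OF sat]; fact)+
  qed (use assms in \<open>auto simp: torus_vanishes_def subtopology_torus_subspace torus_saturated_image_Int [OF U(1)] le_infI1\<close>)
  then show ?thesis
    by (simp add: torus_vanishes_def subtopology_torus_subspace)
qed

text \<open>The quotient map stays open after taking the product with the interval, so continuity is
  checked on boxes upstairs and pushed down.\<close>

lemma torus_homotopy_descends:
  fixes G :: "real \<Rightarrow> complex ^ 'n \<Rightarrow> complex ^ 'n"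
  assumes Y: "torus_saturated L Y"
    and cont: "continuous_on ({0..1} \<times> Y) (\<lambda>p. G (fst p) (snd p))"
    and GB: "\<And>t z. t \<in> {0..1} \<Longrightarrow> z \<in> Y \<Longrightarrow> G t z \<in> B"
    and inv: "\<And>t z z'. t \<in> {0..1} \<Longrightarrow> z \<in> Y \<Longrightarrow> z' \<in> Y \<Longrightarrow> ell_power_point L z = ell_power_point L z' \<Longrightarrow>
      ell_power_point L (G t z) = ell_power_point L (G t z')"
  shows "\<exists>F. continuous_map (prod_topology (top_of_set {0..1::real}) (torus_subspace L Y)) (torus_subspace L B) F \<and>
    (\<forall>t\<in>{0..1}. \<forall>z\<in>Y. F (t, ell_power_point L z) = ell_power_point L (G t z))"
proof -
  let ?\<pi> = "ell_power_point L :: complex ^ 'n \<Rightarrow> _"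
  define F where "F = (\<lambda>(t, x). ?\<pi> (G t (SOME z. z \<in> Y \<and> ?\<pi> z = x)))"
  have F: "F (t, ?\<pi> z) = ?\<pi> (G t z)" if "t \<in> {0..1}" "z \<in> Y" for t z
  proof -
    have "\<exists>z'. z' \<in> Y \<and> ?\<pi> z' = ?\<pi> z" using that by blast
    then have s: "(SOME z'. z' \<in> Y \<and> ?\<pi> z' = ?\<pi> z) \<in> Y \<and> ?\<pi> (SOME z'. z' \<in> Y \<and> ?\<pi> z' = ?\<pi> z) = ?\<pi> z"
      by (rule someI_ex)
    show ?thesis
      using inv [OF that(1) conjunct1 [OF s] that(2) conjunct2 [OF s]] by (simp add: F_def)
  qed
  let ?T = "prod_topology (top_of_set {0..1::real}) (torus_subspace L Y)"
  have "continuous_map ?T (torus_subspace L B) F"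
    unfolding continuous_map_def
  proof (intro conjI allI impI)
    show "F \<in> topspace ?T \<rightarrow> topspace (torus_subspace L B)"
      using F GB by auto
  next
    fix U assume "openin (torus_subspace L B) U"
    then obtain W where W: "openin (ell_power_topology L) W" "U = W \<inter> ?\<pi> ` B"
      by (auto simp: torus_subspace_def openin_subtopology)
    then have opW: "open (?\<pi> -` W)"
      by (simp add: openin_ell_power_topology)
    then obtain Q where Q: "open Q"
      "Q \<inter> ({0..1} \<times> Y) = (\<lambda>p. G (fst p) (snd p)) -` (?\<pi> -` W) \<inter> ({0..1} \<times> Y)"
      using cont [unfolded continuous_on_open_invariant, rule_format, OF opW] by blast
    show "openin ?T {x \<in> topspace ?T. F x \<in> U}"
      unfolding openin_subopen [of ?T "{x \<in> topspace ?T. F x \<in> U}"]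
    proof
      fix p assume "p \<in> {x \<in> topspace ?T. F x \<in> U}"
      then obtain t z where tz: "t \<in> {0..1}" "z \<in> Y" "p = (t, ?\<pi> z)" "F (t, ?\<pi> z) \<in> U"
        by auto
      then have "(t, z) \<in> Q"
        using Q(2) F W(2) by auto
      then obtain A C where AC: "open A" "open C" "t \<in> A" "z \<in> C" "A \<times> C \<subseteq> Q"
        using Q(1) by (metis mem_Sigma_iff open_prod_elim)
      show "\<exists>V. openin ?T V \<and> p \<in> V \<and> V \<subseteq> {x \<in> topspace ?T. F x \<in> U}"
      proof (intro exI conjI)
        have "openin (top_of_set {0..1}) ({0..1} \<inter> A)"
          using AC by auto
        moreover have "openin (torus_subspace L Y) (?\<pi> ` (Y \<inter> C))"
          using AC by (intro openin_torus_subspace_image Y) auto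
        ultimately show "openin ?T (({0..1} \<inter> A) \<times> ?\<pi> ` (Y \<inter> C))"
          by (simp add: openin_prod_Times_iff)
        show "p \<in> ({0..1} \<inter> A) \<times> ?\<pi> ` (Y \<inter> C)"
          using tz AC by auto
        show "({0..1} \<inter> A) \<times> ?\<pi> ` (Y \<inter> C) \<subseteq> {x \<in> topspace ?T. F x \<in> U}"
        proof
          fix q assume "q \<in> ({0..1} \<inter> A) \<times> ?\<pi> ` (Y \<inter> C)"
          then obtain s y where sy: "s \<in> {0..1}" "s \<in> A" "y \<in> Y" "y \<in> C" "q = (s, ?\<pi> y)"
            by auto
          then have "(s, y) \<in> Q \<inter> ({0..1} \<times> Y)"
            using AC by auto
          then have "?\<pi> (G s y) \<in> W"
            using Q(2) by auto
          then show "q \<in> {x \<in> topspace ?T. F x \<in> U}"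
            using sy F GB W(2) by auto
        qed
      qed
    qed
  qed
  then show ?thesis
    using F by (intro exI [of _ F]) simp
qed

text \<open>Maps are given by displacements that are constant on the fibres of the quotient map;
  adding such a displacement respects the fibres automatically.\<close>

lemma torus_map_descends:
  fixes v :: "complex ^ 'n \<Rightarrow> complex ^ 'n"
  assumes Y: "torus_saturated L Y" and cont: "continuous_on Y v"
    and vB: "\<And>z. z \<in> Y \<Longrightarrow> z + v z \<in> B"
    and inv: "\<And>z z'. z \<in> Y \<Longrightarrow> z' \<in> Y \<Longrightarrow> ell_power_point L z = ell_power_point L z' \<Longrightarrow> v z = v z'"
  shows "\<exists>f. continuous_map (torus_subspace L Y) (torus_subspace L B) f \<and>
    (\<forall>z\<in>Y. f (ell_power_point L z) = ell_power_point L (z + v z))"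
proof -
  have "continuous_on ({0..1::real} \<times> Y) (\<lambda>p. snd p + v (snd p))"
    by (intro continuous_intros continuous_on_compose2 [OF cont]) auto
  moreover have "ell_power_point L (z + v z) = ell_power_point L (z' + v z')"
    if "z \<in> Y" "z' \<in> Y" "ell_power_point L z = ell_power_point L z'" for z z'
    using that inv [OF that] ell_power_point_translate by metis
  ultimately have "\<exists>F. continuous_map (prod_topology (top_of_set {0..1::real}) (torus_subspace L Y)) (torus_subspace L B) F \<and>
    (\<forall>t\<in>{0..1}. \<forall>z\<in>Y. F (t, ell_power_point L z) = ell_power_point L (z + v z))"
    using vB by (intro torus_homotopy_descends Y)
  then obtain F where
    F: "continuous_map (prod_topology (top_of_set {0..1::real}) (torus_subspace L Y)) (torus_subspace L B) F"
    "\<forall>t\<in>{0..1}. \<forall>z\<in>Y. F (t, ell_power_point L z) = ell_power_point L (z + v z)"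
    by (elim exE conjE)
  \<comment> \<open>The map is a slice of a homotopy that is constant in time.\<close>
  have "continuous_map (torus_subspace L Y) (torus_subspace L B) (F \<circ> Pair 0)"
    by (rule continuous_map_compose [OF continuous_map_cylinder_end F(1)]) auto
  then show ?thesis
    using F(2) by (intro exI [of _ "F \<circ> Pair 0"]) auto
qed

text \<open>Both maps are displacements, so their composite is one too, and the homotopy to the
  identity scales it down linearly; \<open>seg\<close> keeps the homotopy inside the set.\<close>

lemma torus_vanishes_dominated:
  fixes v v' :: "complex ^ 'n \<Rightarrow> complex ^ 'n"
  assumes Y: "torus_saturated L Y" and B: "torus_saturated L B"
    and v: "continuous_on Y v" "\<And>z. z \<in> Y \<Longrightarrow> z + v z \<in> B"
      "\<And>z z'. z \<in> Y \<Longrightarrow> z' \<in> Y \<Longrightarrow> ell_power_point L z = ell_power_point L z' \<Longrightarrow> v z = v z'"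
    and v': "continuous_on B v'" "\<And>z. z \<in> B \<Longrightarrow> z + v' z \<in> Y"
      "\<And>z z'. z \<in> B \<Longrightarrow> z' \<in> B \<Longrightarrow> ell_power_point L z = ell_power_point L z' \<Longrightarrow> v' z = v' z'"
    and seg: "\<And>t z. 0 \<le> t \<Longrightarrow> t \<le> 1 \<Longrightarrow> z \<in> Y \<Longrightarrow> z + t *\<^sub>R (v z + v' (z + v z)) \<in> Y"
    and van: "torus_vanishes L k B"
  shows "torus_vanishes L k Y"
proof -
  let ?\<pi> = "ell_power_point L :: complex ^ 'n \<Rightarrow> _"
  have "\<exists>f. continuous_map (torus_subspace L Y) (torus_subspace L B) f \<and> (\<forall>z\<in>Y. f (?\<pi> z) = ?\<pi> (z + v z))"
    by (intro torus_map_descends Y v)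
  then obtain f where f: "continuous_map (torus_subspace L Y) (torus_subspace L B) f"
    "\<forall>z\<in>Y. f (?\<pi> z) = ?\<pi> (z + v z)"
    by (elim exE conjE)
  have "\<exists>g. continuous_map (torus_subspace L B) (torus_subspace L Y) g \<and> (\<forall>z\<in>B. g (?\<pi> z) = ?\<pi> (z + v' z))"
    by (intro torus_map_descends B v')
  then obtain g where g: "continuous_map (torus_subspace L B) (torus_subspace L Y) g"
    "\<forall>z\<in>B. g (?\<pi> z) = ?\<pi> (z + v' z)"
    by (elim exE conjE)
  define u where "u = (\<lambda>z. v z + v' (z + v z))"
  have u_inv: "u z = u z'" if "z \<in> Y" "z' \<in> Y" "?\<pi> z = ?\<pi> z'" for z z'
  proof -
    have "?\<pi> (z + v z) = ?\<pi> (z' + v z')"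
      using v(3) [OF that] ell_power_point_translate [OF that(3)] by simp
    then show ?thesis
      using v'(3) [OF v(2) [OF that(1)] v(2) [OF that(2)]] v(3) [OF that] by (simp add: u_def)
  qed
  have u_cont: "continuous_on Y u"
    unfolding u_def using v(2)
    by (intro continuous_intros v(1) continuous_on_compose2 [OF v'(1)]) auto
  \<comment> \<open>At time 0 the full displacement is applied and at time 1 none, as the homotopy
    has to lead from the composite to the identity.\<close>
  have "continuous_on ({0..1::real} \<times> Y) (\<lambda>p. snd p + (1 - fst p) *\<^sub>R u (snd p))"
    by (intro continuous_intros continuous_on_compose2 [OF u_cont]) auto
  moreover have "z + (1 - t) *\<^sub>R u z \<in> Y" if "t \<in> {0..1}" "z \<in> Y" for t z
    using seg [of "1 - t" z] that by (simp add: u_def)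
  moreover have "?\<pi> (z + (1 - t) *\<^sub>R u z) = ?\<pi> (z' + (1 - t) *\<^sub>R u z')"
    if "z \<in> Y" "z' \<in> Y" "?\<pi> z = ?\<pi> z'" for t z z'
    using u_inv [OF that] ell_power_point_translate [OF that(3)] by simp
  ultimately have "\<exists>H. continuous_map (prod_topology (top_of_set {0..1::real}) (torus_subspace L Y)) (torus_subspace L Y) H \<and>
    (\<forall>t\<in>{0..1}. \<forall>z\<in>Y. H (t, ?\<pi> z) = ?\<pi> (z + (1 - t) *\<^sub>R u z))"
    by (intro torus_homotopy_descends Y)
  then obtain H where
    H: "continuous_map (prod_topology (top_of_set {0..1::real}) (torus_subspace L Y)) (torus_subspace L Y) H"
    "\<forall>t\<in>{0..1}. \<forall>z\<in>Y. H (t, ?\<pi> z) = ?\<pi> (z + (1 - t) *\<^sub>R u z)"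
    by (elim exE conjE)
  have "homotopic_with (\<lambda>_. True) (torus_subspace L Y) (torus_subspace L Y) (g \<circ> f) id"
  proof (subst homotopic_with, simp, intro exI conjI ballI)
    fix x assume "x \<in> topspace (torus_subspace L Y)"
    then obtain z where z: "z \<in> Y" "x = ?\<pi> z" by auto
    then show "H (0, x) = (g \<circ> f) x"
      using H(2) f(2) g(2) v(2) by (simp add: u_def add.assoc)
    show "H (1, x) = id x"
      using H(2) z by simp
  qed (use H in auto)
  then show ?thesis
    using cohomology_vanishes_dominated [OF f(1) g(1)] van unfolding torus_vanishes_def by blast
qed

lemma torus_vanishes_discrete:
  assumes S: "torus_saturated L S" and "k > 0"
    and isol: "\<And>z. z \<in> S \<Longrightarrow> \<exists>U. open U \<and> S \<inter> U = {z}"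
  shows "torus_vanishes L k S"
  unfolding torus_vanishes_def
proof (rule cohomology_vanishes_discrete [OF _ \<open>k > 0\<close>])
  fix x assume "x \<in> topspace (torus_subspace L S)"
  then obtain z where z: "z \<in> S" "x = ell_power_point L z" by auto
  obtain U where "open U" "S \<inter> U = {z}"
    using isol z by blast
  then have "openin (top_of_set S) {z}"
    by (metis openin_open)
  from openin_torus_subspace_image [OF S this] show "openin (torus_subspace L S) {x}"
    using z by simp
qed

end

section \<open>Fibrations over an elliptic curve\<close>

lemma frac_eq_of_diff_Ints:
  fixes a b :: real
  assumes "a - b \<in> \<int>"
  shows "frac a = frac b"
proof -
  obtain n where "a = b + of_int n"
    using assms by (auto elim!: Ints_cases simp: algebra_simps)
  then show ?thesis
    by (simp add: frac_def)
qed

text \<open>Positivity of \<open>frac\<close> is kept as an inequality, so that arcs can be compared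
  by linear arithmetic.\<close>

declare frac_gt_0_iff [simp del]

text \<open>The preimage of the open arc of length \<open>\<alpha>\<close> that starts at
  \<open>p\<close> in R/Z; for \<open>\<alpha>\<close> = 1 only the point \<open>p\<close> is left
  out.\<close>

definition arc_preimage :: "('a \<Rightarrow> real) \<Rightarrow> real \<Rightarrow> real \<Rightarrow> 'a set"
  where "arc_preimage g p \<alpha> = {z. 0 < frac (g z - p) \<and> frac (g z - p) < \<alpha>}"

text \<open>As \<open>frac\<close> jumps at the integers, the arc is rewritten as a union of open
  conditions, one for each integer part.\<close>

lemma open_arc_preimage:
  fixes g :: "'a :: topological_space \<Rightarrow> real"
  assumes g: "continuous_on UNIV g" and "\<alpha> \<le> 1"
  shows "open (arc_preimage g p \<alpha>)"
proof -
  have "arc_preimage g p \<alpha> = {z. \<exists>n::int. of_int n < g z - p \<and> g z - p < of_int n + \<alpha>}"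
  proof (intro Set.set_eqI iffI)
    fix z assume "z \<in> arc_preimage g p \<alpha>"
    then show "z \<in> {z. \<exists>n::int. of_int n < g z - p \<and> g z - p < of_int n + \<alpha>}"
      by (auto simp: arc_preimage_def frac_def intro!: exI [of _ "\<lfloor>g z - p\<rfloor>"])
  next
    fix z assume "z \<in> {z. \<exists>n::int. of_int n < g z - p \<and> g z - p < of_int n + \<alpha>}"
    then obtain n :: int where n: "of_int n < g z - p" "g z - p < of_int n + \<alpha>" by blast
    then have "frac (g z - p) = g z - p - of_int n"
      using \<open>\<alpha> \<le> 1\<close> by (auto simp: frac_unique_iff)
    then show "z \<in> arc_preimage g p \<alpha>"
      using n by (simp add: arc_preimage_def)
  qed
  moreover have "open {z. \<exists>n::int. of_int n < g z - p \<and> g z - p < of_int n + \<alpha>}"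
    by (intro open_Collect_ex open_Collect_conj open_Collect_less continuous_intros g)
  ultimately show ?thesis by simp
qed

lemma continuous_on_frac:
  fixes g :: "'a :: topological_space \<Rightarrow> real"
  assumes "continuous_on S g" "\<And>z. z \<in> S \<Longrightarrow> g z \<notin> \<int>"
  shows "continuous_on S (\<lambda>z. frac (g z))"
proof (rule continuous_on_compose2 [of "- \<int>" frac, OF _ assms(1)])
  show "continuous_on (- \<int>) (frac :: real \<Rightarrow> real)"
    by (intro continuous_at_imp_continuous_on ballI continuous_frac) auto
qed (use assms(2) in auto)

context additive_subgroup
begin

text \<open>A continuous real lift of a map from E^n to the circle R/Z.\<close>

definition circle_valued :: "(complex ^ 'n \<Rightarrow> real) \<Rightarrow> bool"
  where "circle_valued g \<longleftrightarrow> continuous_on UNIV g \<and>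
    (\<forall>z z'. ell_power_point L z = ell_power_point L z' \<longrightarrow> g z - g z' \<in> \<int>)"

lemma frac_circle_valued:
  assumes "circle_valued g" "ell_power_point L z = ell_power_point L z'"
  shows "frac (g z - p) = frac (g z' - p)"
  using assms by (intro frac_eq_of_diff_Ints) (auto simp: circle_valued_def)

lemma torus_saturated_arc_preimage:
  assumes g: "circle_valued g"
  shows "torus_saturated L (arc_preimage g p \<alpha>)"
  unfolding torus_saturated_def arc_preimage_def
proof (intro ballI allI impI)
    fix z w assume "z \<in> {z. 0 < frac (g z - p) \<and> frac (g z - p) < \<alpha>}" "ell_power_point L w = ell_power_point L z"
    then show "w \<in> {z. 0 < frac (g z - p) \<and> frac (g z - p) < \<alpha>}"
      using frac_circle_valued [OF g, of w z p] by simp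
qed

lemma torus_vanishes_disjoint_union:
  assumes "torus_saturated L U" "openin (top_of_set (U \<union> V)) U"
    and "torus_saturated L V" "openin (top_of_set (U \<union> V)) V"
    and "U \<inter> V = {}" "torus_vanishes L (Suc k) U" "torus_vanishes L (Suc k) V"
  shows "torus_vanishes L (Suc k) (U \<union> V)"
  using assms by (intro torus_vanishes_union) (auto simp: torus_vanishes_empty)

text \<open>The circle minus 0 and the circle minus 1/2 are arcs that meet in two disjoint half
  circles, so Mayer-Vietoris raises the bound by one.\<close>

lemma torus_vanishes_circle:
  assumes S: "torus_saturated L S" and g: "circle_valued g"
    and van: "\<And>j p \<alpha>. j \<ge> Suc k \<Longrightarrow> 0 < \<alpha> \<Longrightarrow> \<alpha> \<le> 1 \<Longrightarrow> torus_vanishes L j (S \<inter> arc_preimage g p \<alpha>)"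
    and "j \<ge> Suc (Suc k)"
  shows "torus_vanishes L j S"
proof -
  let ?A = "\<lambda>p \<alpha>. S \<inter> arc_preimage g p \<alpha>"
  have sat: "torus_saturated L (?A p \<alpha>)" for p \<alpha>
    by (intro torus_saturated_Int S torus_saturated_arc_preimage g)
  have op: "openin (top_of_set W) (?A p \<alpha>)" if "?A p \<alpha> \<subseteq> W" "W \<subseteq> S" "\<alpha> \<le> 1" for W p \<alpha>
  proof -
    have "?A p \<alpha> = W \<inter> arc_preimage g p \<alpha>" using that by blast
    then show ?thesis
      using open_arc_preimage [of g \<alpha> p] g that(3) by (simp add: circle_valued_def openin_open_Int)
  qed
  obtain i where j: "j = Suc (Suc i)" "i \<ge> k"
    using \<open>j \<ge> Suc (Suc k)\<close> by (metis Suc_le_D Suc_le_mono)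
  have half: "frac (x - 1/2) = (if frac x < 1/2 then frac x + 1/2 else frac x - 1/2)" for x :: real
    unfolding frac_unique_iff
  proof (intro conjI)
    have "x - 1/2 - (if frac x < 1/2 then frac x + 1/2 else frac x - 1/2) =
        (if frac x < 1/2 then of_int (\<lfloor>x\<rfloor> - 1) else of_int \<lfloor>x\<rfloor>)"
      by (simp add: frac_def)
    then show "x - 1/2 - (if frac x < 1/2 then frac x + 1/2 else frac x - 1/2) \<in> \<int>"
      by simp
  qed (use frac_lt_1 [of x] frac_ge_0 [of x] in auto)
  have "0 < frac x \<or> 0 < frac (x - 1/2)" for x :: real
    using frac_ge_0 [of x] unfolding half by (split if_split) linarith
  then have un: "?A 0 1 \<union> ?A (1/2) 1 = S"
    by (auto simp: arc_preimage_def frac_lt_1)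
  have int: "?A 0 1 \<inter> ?A (1/2) 1 = ?A 0 (1/2) \<union> ?A (1/2) (1/2)"
  proof -
    have "0 < frac x \<and> 0 < frac (x - 1/2) \<longleftrightarrow>
        0 < frac x \<and> frac x < 1/2 \<or> 0 < frac (x - 1/2) \<and> frac (x - 1/2) < 1/2" for x :: real
      using frac_lt_1 [of x] frac_ge_0 [of x] unfolding half by (simp only: split: if_split) linarith
    then show ?thesis
      by (auto simp: arc_preimage_def frac_lt_1)
  qed
  have disj: "?A 0 (1/2) \<inter> ?A (1/2) (1/2) = {}"
    by (auto simp: arc_preimage_def half split: if_splits)
  have "torus_vanishes L (Suc i) (?A 0 (1/2) \<union> ?A (1/2) (1/2))"
    using j(2) by (intro torus_vanishes_disjoint_union sat op disj van) auto
  then have "torus_vanishes L (Suc (Suc i)) (?A 0 1 \<union> ?A (1/2) 1)"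
    using j(2) int by (intro torus_vanishes_union sat op van) auto
  then show ?thesis
    by (simp only: un j)
qed

end

section \<open>Integral linear forms, period coordinates and fibrations over the curve\<close>

definition int_linear_form :: "int ^ 'n \<Rightarrow> complex ^ 'n \<Rightarrow> complex"
  where "int_linear_form m z = (\<Sum>i\<in>UNIV. of_int (m $ i) * z $ i)"

lemma int_linear_form_add: "int_linear_form m (z + w) = int_linear_form m z + int_linear_form m w"
  and int_linear_form_diff: "int_linear_form m (z - w) = int_linear_form m z - int_linear_form m w"
  and int_linear_form_smult: "int_linear_form m (c *s w) = c * int_linear_form m w"
  and int_linear_form_scaleR: "int_linear_form m (r *\<^sub>R w) = r *\<^sub>R int_linear_form m w"
  by (simp_all add: int_linear_form_def algebra_simps sum.distrib sum_subtractf sum_distrib_left scaleR_sum_right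
      vector_scalar_mult_def)

lemma continuous_on_int_linear_form [continuous_intros]:
  "continuous_on S f \<Longrightarrow> continuous_on S (\<lambda>z. int_linear_form m (f z))"
  unfolding int_linear_form_def by (intro continuous_intros)

lemma continuous_on_vec_smult [continuous_intros]:
  fixes u :: "complex ^ 'n"
  assumes "continuous_on S c"
  shows "continuous_on S (\<lambda>z. c z *s u)"
  unfolding vector_scalar_mult_def by (intro continuous_intros assms)

locale period_pair =
  fixes \<omega>1 \<omega>2 :: complex
  assumes nondegenerate: "nondegenerate_periods \<omega>1 \<omega>2"
begin

abbreviation "\<Lambda> \<equiv> period_lattice \<omega>1 \<omega>2"

text \<open>After division by \<open>\<omega>1\<close> the basis becomes 1 and \<tau> =
  \<open>\<omega>2 / \<omega>1\<close>, so the imaginary part determines the second coordinate and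
  the real part then gives the first.\<close>

definition coord2 :: "complex \<Rightarrow> real"
  where "coord2 w = Im (w / \<omega>1) / Im (\<omega>2 / \<omega>1)"

definition coord1 :: "complex \<Rightarrow> real"
  where "coord1 w = Re (w / \<omega>1) - coord2 w * Re (\<omega>2 / \<omega>1)"

definition of_coords :: "real \<Rightarrow> real \<Rightarrow> complex"
  where "of_coords x y = of_real x * \<omega>1 + of_real y * \<omega>2"

lemma omega1_nonzero: "\<omega>1 \<noteq> 0"
  \<comment> \<open>Division by 0 yields 0, so the condition on the imaginary part excludes
    \<open>\<omega>1\<close> = 0.\<close>
  using nondegenerate by (auto simp: nondegenerate_periods_def)

lemma of_coords_div: "of_coords x y / \<omega>1 = of_real x + of_real y * (\<omega>2 / \<omega>1)"
  using omega1_nonzero by (simp add: of_coords_def field_simps)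

lemma of_coords_coords: "of_coords (coord1 w) (coord2 w) = w"
proof -
  define \<tau> a where "\<tau> = \<omega>2 / \<omega>1" and "a = w / \<omega>1"
  have "Im \<tau> \<noteq> 0"
    using nondegenerate by (simp add: nondegenerate_periods_def \<tau>_def)
  then have "of_real (coord1 w) + of_real (coord2 w) * \<tau> = a"
    unfolding coord1_def coord2_def by (fold \<tau>_def a_def) (simp add: complex_eq_iff)
  then have "of_coords (coord1 w) (coord2 w) / \<omega>1 = w / \<omega>1"
    by (simp only: of_coords_div \<tau>_def a_def)
  then show ?thesis
    using omega1_nonzero by simp
qed

lemma coords_of_coords [simp]: "coord1 (of_coords x y) = x" "coord2 (of_coords x y) = y"
proof -
  define \<tau> where "\<tau> = \<omega>2 / \<omega>1"
  have nz: "Im \<tau> \<noteq> 0"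
    using nondegenerate by (simp add: nondegenerate_periods_def \<tau>_def)
  show "coord1 (of_coords x y) = x" "coord2 (of_coords x y) = y"
    unfolding coord1_def coord2_def of_coords_div using nz by (fold \<tau>_def) simp_all
qed

lemma of_coords_add: "of_coords (x + x') (y + y') = of_coords x y + of_coords x' y'"
  and of_coords_diff: "of_coords (x - x') (y - y') = of_coords x y - of_coords x' y'"
  and of_coords_scaleR: "of_coords (r * x) (r * y) = r *\<^sub>R of_coords x y"
  by (simp_all add: of_coords_def algebra_simps scaleR_conv_of_real)

lemma coords_add [simp]: "coord1 (v + w) = coord1 v + coord1 w" "coord2 (v + w) = coord2 v + coord2 w"
  and coords_diff [simp]: "coord1 (v - w) = coord1 v - coord1 w" "coord2 (v - w) = coord2 v - coord2 w"
  and coords_scaleR [simp]: "coord1 (r *\<^sub>R w) = r * coord1 w" "coord2 (r *\<^sub>R w) = r * coord2 w"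
  by (metis coords_of_coords of_coords_coords of_coords_add of_coords_diff of_coords_scaleR)+

lemma mem_lattice_iff: "w \<in> \<Lambda> \<longleftrightarrow> coord1 w \<in> \<int> \<and> coord2 w \<in> \<int>"
proof
  assume "w \<in> \<Lambda>"
  then obtain a b :: int where "w = of_coords (of_int a) (of_int b)"
    by (auto simp: period_lattice_def of_coords_def)
  then show "coord1 w \<in> \<int> \<and> coord2 w \<in> \<int>" by simp
next
  assume "coord1 w \<in> \<int> \<and> coord2 w \<in> \<int>"
  then obtain a b :: int where "coord1 w = of_int a" "coord2 w = of_int b"
    by (auto elim!: Ints_cases)
  then have "w = of_int a * \<omega>1 + of_int b * \<omega>2"
    using of_coords_coords [of w] by (simp add: of_coords_def)
  then show "w \<in> \<Lambda>"
    by (auto simp: period_lattice_def)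
qed

sublocale additive_subgroup \<Lambda>
proof
  show "0 \<in> \<Lambda>"
    by (auto simp: period_lattice_def intro!: exI [of _ 0])
qed (auto simp: mem_lattice_iff)

lemma continuous_on_coords [continuous_intros]:
  assumes "continuous_on S f"
  shows "continuous_on S (\<lambda>z. coord1 (f z))" "continuous_on S (\<lambda>z. coord2 (f z))"
  unfolding coord1_def coord2_def divide_inverse
  by (intro continuous_intros assms)+

lemma continuous_on_of_coords [continuous_intros]:
  "continuous_on S f \<Longrightarrow> continuous_on S g \<Longrightarrow> continuous_on S (\<lambda>z. of_coords (f z) (g z))"
  unfolding of_coords_def by (intro continuous_intros)

lemma int_linear_form_mem_lattice:
  assumes "ell_power_point \<Lambda> z = ell_power_point \<Lambda> z'"
  shows "int_linear_form m z - int_linear_form m z' \<in> \<Lambda>"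
proof -
  have mult: "of_int k * a \<in> \<Lambda>" if "a \<in> \<Lambda>" for k a
  proof -
    have "coord1 (of_int k * a) = of_int k * coord1 a" "coord2 (of_int k * a) = of_int k * coord2 a"
      using coords_scaleR [of "of_int k" a] by (simp_all add: scaleR_conv_of_real)
    then show ?thesis
      using that by (simp add: mem_lattice_iff)
  qed
  have sum: "sum f I \<in> \<Lambda>" if "\<And>i. i \<in> I \<Longrightarrow> f i \<in> \<Lambda>" for f and I :: "'a set"
    using that by (induction I rule: infinite_finite_induct) (auto simp: zero_mem add_mem)
  have "int_linear_form m (z - z') \<in> \<Lambda>"
    unfolding int_linear_form_def using assms by (intro sum mult) (simp add: ell_power_point_eq_iff)
  then show ?thesis
    by (simp add: int_linear_form_diff)
qed

text \<open>Upstairs a divisor becomes, for nonzero \<open>m\<close>, a family of parallel affine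
  hyperplanes, one for each lattice element.\<close>

abbreviation divisor_preimage :: "int ^ 'n \<Rightarrow> complex \<Rightarrow> (complex ^ 'n) set"
  where "divisor_preimage m q \<equiv> {z. int_linear_form m z - q \<in> \<Lambda>}"

lemma mem_divisor_preimage_cong:
  assumes "ell_power_point \<Lambda> z = ell_power_point \<Lambda> z'"
  shows "int_linear_form m z - q \<in> \<Lambda> \<longleftrightarrow> int_linear_form m z' - q \<in> \<Lambda>"
  using add_mem [OF int_linear_form_mem_lattice [OF assms, of m], of "int_linear_form m z' - q"]
    diff_mem [OF _ int_linear_form_mem_lattice [OF assms, of m], of "int_linear_form m z - q"] by auto

lemma torus_saturated_divisor_preimage:
  "torus_saturated \<Lambda> (divisor_preimage m q)" "torus_saturated \<Lambda> (- divisor_preimage m q)"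
  unfolding torus_saturated_def using mem_divisor_preimage_cong by blast+

lemma circle_valued_coords:
  "circle_valued (\<lambda>z. coord1 (int_linear_form m z))" "circle_valued (\<lambda>z. coord2 (int_linear_form m z))"
  using int_linear_form_mem_lattice
  by (auto simp: circle_valued_def mem_lattice_iff intro!: continuous_intros)

text \<open>\<open>m\<close> maps S to the elliptic curve, and translation along \<open>u\<close>,
  which raises the value of \<open>m\<close> at unit speed, identifies nearby fibres. This serves as
  a local trivialisation.\<close>

context
  fixes S :: "(complex ^ 'n) set" and m :: "int ^ 'n" and u :: "complex ^ 'n"
  assumes S: "torus_saturated \<Lambda> S" and Su: "\<And>z c. z \<in> S \<Longrightarrow> z + c *s u \<in> S"
    and mu: "int_linear_form m u = 1"
begin

abbreviation "strip1 \<equiv> arc_preimage (\<lambda>z. coord1 (int_linear_form m z))"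
abbreviation "strip2 \<equiv> arc_preimage (\<lambda>z. coord2 (int_linear_form m z))"

text \<open>Over an open rectangle every point slides along \<open>u\<close> to the fibre over the
  centre, and it stays inside because the rectangle is convex.\<close>

lemma torus_vanishes_box:
  assumes van: "\<And>c. torus_vanishes \<Lambda> k (S \<inter> divisor_preimage m c)"
    and \<alpha>: "0 < \<alpha>" "\<alpha> \<le> 1" and \<beta>: "0 < \<beta>" "\<beta> \<le> 1"
  shows "torus_vanishes \<Lambda> k (S \<inter> strip1 p \<alpha> \<inter> strip2 q \<beta>)"
proof -
  let ?f = "int_linear_form m"
  define X where "X = (\<lambda>z. frac (coord1 (?f z) - p))"
  define Y where "Y = (\<lambda>z. frac (coord2 (?f z) - q))"
  \<comment> \<open>The centre of the rectangle. As \<open>m\<close> takes the value 1 on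
    \<open>u\<close>, the displacement \<open>v\<close> below moves the value of \<open>m\<close>
    onto \<open>c\<close> up to a lattice element.\<close>
  define c where "c = of_coords (p + \<alpha>/2) (q + \<beta>/2)"
  define v where "v = (\<lambda>z. of_coords (\<alpha>/2 - X z) (\<beta>/2 - Y z) *s u)"
  have box: "z \<in> S \<inter> strip1 p \<alpha> \<inter> strip2 q \<beta> \<longleftrightarrow> z \<in> S \<and> 0 < X z \<and> X z < \<alpha> \<and> 0 < Y z \<and> Y z < \<beta>" for z
    by (auto simp: arc_preimage_def X_def Y_def)
  have inv: "X z = X z'" "Y z = Y z'" if "ell_power_point \<Lambda> z = ell_power_point \<Lambda> z'" for z z'
    using frac_circle_valued [OF circle_valued_coords(1) that] frac_circle_valued [OF circle_valued_coords(2) that]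
    by (auto simp: X_def Y_def)
  have XY: "coord1 (?f z) = p + of_int \<lfloor>coord1 (?f z) - p\<rfloor> + X z"
    "coord2 (?f z) = q + of_int \<lfloor>coord2 (?f z) - q\<rfloor> + Y z" for z
    by (auto simp: X_def Y_def frac_def)
  show ?thesis
  proof (rule torus_vanishes_dominated [where v = v and v' = "\<lambda>_. 0" and B = "S \<inter> divisor_preimage m c"])
    show "torus_saturated \<Lambda> (S \<inter> strip1 p \<alpha> \<inter> strip2 q \<beta>)"
      by (intro torus_saturated_Int S torus_saturated_arc_preimage circle_valued_coords)
    show "torus_saturated \<Lambda> (S \<inter> divisor_preimage m c)"
      by (intro torus_saturated_Int S torus_saturated_divisor_preimage)
    have "continuous_on (S \<inter> strip1 p \<alpha> \<inter> strip2 q \<beta>) X" "continuous_on (S \<inter> strip1 p \<alpha> \<inter> strip2 q \<beta>) Y"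
      unfolding X_def Y_def
      by (intro continuous_on_frac continuous_intros; auto simp: arc_preimage_def simp flip: frac_gt_0_iff)+
    then show "continuous_on (S \<inter> strip1 p \<alpha> \<inter> strip2 q \<beta>) v"
      unfolding v_def by (intro continuous_intros)
    show "v z = v z'" if "ell_power_point \<Lambda> z = ell_power_point \<Lambda> z'" for z z'
      using inv [OF that] by (simp add: v_def)
    show "z + v z \<in> S \<inter> divisor_preimage m c" if "z \<in> S \<inter> strip1 p \<alpha> \<inter> strip2 q \<beta>" for z
    proof -
      have "coord1 (?f (z + v z) - c) = of_int \<lfloor>coord1 (?f z) - p\<rfloor>"
        "coord2 (?f (z + v z) - c) = of_int \<lfloor>coord2 (?f z) - q\<rfloor>"
        using XY [of z] by (simp_all add: v_def c_def int_linear_form_add int_linear_form_smult mu)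
      then show ?thesis
        using that Su by (simp add: mem_lattice_iff v_def)
    qed
    show "z + 0 \<in> S \<inter> strip1 p \<alpha> \<inter> strip2 q \<beta>" if "z \<in> S \<inter> divisor_preimage m c" for z
    proof -
      have "X z = \<alpha>/2" "Y z = \<beta>/2"
        unfolding X_def Y_def frac_unique_iff
        using that \<alpha> \<beta> by (simp_all add: mem_lattice_iff c_def diff_diff_eq)
      then show ?thesis
        using that \<alpha> \<beta> unfolding box by simp
    qed
    show "z + t *\<^sub>R (v z + 0) \<in> S \<inter> strip1 p \<alpha> \<inter> strip2 q \<beta>"
      if t: "0 \<le> t" "t \<le> 1" and z: "z \<in> S \<inter> strip1 p \<alpha> \<inter> strip2 q \<beta>" for t z
    proof -
      have zX: "0 < X z" "X z < \<alpha>" "0 < Y z" "Y z < \<beta>" "z \<in> S"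
        using z unfolding box by auto
      let ?z = "z + t *\<^sub>R (v z + 0)"
      have mem: "?z \<in> S"
        using Su [OF zX(5), of "t *\<^sub>R of_coords (\<alpha>/2 - X z) (\<beta>/2 - Y z)"]
        by (simp add: v_def vector_scalar_mult_def scaleR_vec_def)
      have conv: "0 < (1 - t) * x + t * (a/2) \<and> (1 - t) * x + t * (a/2) < a" if "0 < x" "x < a" for x a :: real
      proof -
        have "(1 - t) *\<^sub>R x + t *\<^sub>R (a/2) \<in> {0<..<a}"
          using t that by (intro convexD [OF convex_real_interval(8)]) auto
        then show ?thesis by simp
      qed
      have coords: "coord1 (?f ?z) = coord1 (?f z) + t * (\<alpha>/2 - X z)" "coord2 (?f ?z) = coord2 (?f z) + t * (\<beta>/2 - Y z)"
        by (simp_all add: v_def int_linear_form_add int_linear_form_scaleR int_linear_form_smult mu)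
      \<comment> \<open>The integer parts stay fixed along the segment, so the fractional parts
        interpolate linearly between the starting point and the centre.\<close>
      have ints: "coord1 (?f ?z) - p - ((1 - t) * X z + t * (\<alpha>/2)) = of_int \<lfloor>coord1 (?f z) - p\<rfloor>"
        "coord2 (?f ?z) - q - ((1 - t) * Y z + t * (\<beta>/2)) = of_int \<lfloor>coord2 (?f z) - q\<rfloor>"
        unfolding coords using XY [of z] by (simp_all add: algebra_simps)
      have "frac (coord1 (?f ?z) - p) = (1 - t) * X z + t * (\<alpha>/2)"
        "frac (coord2 (?f ?z) - q) = (1 - t) * Y z + t * (\<beta>/2)"
        unfolding frac_unique_iff ints using conv [OF zX(1,2)] conv [OF zX(3,4)] \<alpha> \<beta> by auto
      then have "X ?z = (1 - t) * X z + t * (\<alpha>/2)" "Y ?z = (1 - t) * Y z + t * (\<beta>/2)"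
        by (simp_all only: X_def Y_def)
      then show ?thesis
        using mem conv [OF zX(1,2)] conv [OF zX(3,4)] unfolding box by simp
    qed
  qed (use van in auto)
qed

text \<open>A box costs no degree; a strip, which still runs around one circle, costs one. The whole
  curve is a circle of strips and costs two. In the punctured curve two strips meet in a box, so
  their union costs no more than a strip.\<close>

lemma
  assumes van: "\<And>j c. j \<ge> Suc k \<Longrightarrow> torus_vanishes \<Lambda> j (S \<inter> divisor_preimage m c)"
  shows torus_vanishes_fibration: "j \<ge> Suc (Suc (Suc k)) \<Longrightarrow> torus_vanishes \<Lambda> j S"
    and torus_vanishes_punctured_fibration: "j \<ge> Suc (Suc k) \<Longrightarrow> torus_vanishes \<Lambda> j (S - divisor_preimage m c)"
proof -
  have sat: "torus_saturated \<Lambda> (S \<inter> strip1 p \<alpha>)" "torus_saturated \<Lambda> (S \<inter> strip2 p \<alpha>)" for p \<alpha>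
    by (intro torus_saturated_Int S torus_saturated_arc_preimage circle_valued_coords)+
  have v1: "torus_vanishes \<Lambda> j (S \<inter> strip1 p \<alpha>)" if "j \<ge> Suc (Suc k)" "0 < \<alpha>" "\<alpha> \<le> 1" for j p \<alpha>
    using that by (intro torus_vanishes_circle [OF sat(1) circle_valued_coords(2) [of m], of k] torus_vanishes_box van)
  have v2: "torus_vanishes \<Lambda> j (S \<inter> strip2 p \<alpha>)" if "j \<ge> Suc (Suc k)" "0 < \<alpha>" "\<alpha> \<le> 1" for j p \<alpha>
  proof (rule torus_vanishes_circle [OF sat(2) circle_valued_coords(1) [of m], of k])
    fix j' p' \<alpha>' assume "Suc k \<le> j'" "0 < \<alpha>'" "\<alpha>' \<le> (1::real)"
    then have "torus_vanishes \<Lambda> j' (S \<inter> strip1 p' \<alpha>' \<inter> strip2 p \<alpha>)"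
      using that by (intro torus_vanishes_box van)
    then show "torus_vanishes \<Lambda> j' (S \<inter> strip2 p \<alpha> \<inter> strip1 p' \<alpha>')"
      by (simp add: Int_ac)
  qed (use that in auto)
  show "torus_vanishes \<Lambda> j S" if "j \<ge> Suc (Suc (Suc k))"
    using that by (intro torus_vanishes_circle [OF S circle_valued_coords(1) [of m], of "Suc k"] v1)
  show "torus_vanishes \<Lambda> j (S - divisor_preimage m c)" if j: "j \<ge> Suc (Suc k)"
  proof -
    let ?U = "S \<inter> strip1 (coord1 c) 1" and ?V = "S \<inter> strip2 (coord2 c) 1"
    \<comment> \<open>Off the divisor at least one of the two coordinate differences is not an
      integer.\<close>
    have eq: "S - divisor_preimage m c = ?U \<union> ?V"
      by (auto simp: arc_preimage_def mem_lattice_iff frac_gt_0_iff frac_lt_1)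
    obtain i where i: "j = Suc i" "i \<ge> Suc k"
      using j by (metis Suc_le_D Suc_le_mono)
    have op: "openin (top_of_set (?U \<union> ?V)) ?U" "openin (top_of_set (?U \<union> ?V)) ?V"
    proof -
      have "?U = (?U \<union> ?V) \<inter> strip1 (coord1 c) 1" "?V = (?U \<union> ?V) \<inter> strip2 (coord2 c) 1"
        by auto
      moreover have "open (strip1 (coord1 c) 1)" "open (strip2 (coord2 c) 1)"
        using circle_valued_coords by (auto simp: circle_valued_def intro!: open_arc_preimage)
      ultimately show "openin (top_of_set (?U \<union> ?V)) ?U" "openin (top_of_set (?U \<union> ?V)) ?V"
        by (metis openin_open_Int)+
    qed
    have "?U \<inter> ?V = S \<inter> strip1 (coord1 c) 1 \<inter> strip2 (coord2 c) 1"
      by auto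
    then have "torus_vanishes \<Lambda> i (?U \<inter> ?V)"
      using i by (simp only:) (intro torus_vanishes_box van; simp)
    then have "torus_vanishes \<Lambda> (Suc i) (?U \<union> ?V)"
      using i j by (intro torus_vanishes_union sat op v1 v2) auto
    then show ?thesis
      by (simp only: eq i)
  qed
qed

end

end

section \<open>Strata of an arrangement\<close>

definition real_form :: "int ^ 'n \<Rightarrow> real ^ 'n"
  where "real_form m = (\<chi> i. real_of_int (m $ i))"

definition form_rank :: "((int ^ 'n) \<times> complex) set \<Rightarrow> nat"
  where "form_rank J = dim ((\<lambda>(m, q). real_form m) ` J)"

lemma form_rank_le: "form_rank (J :: ((int ^ 'n) \<times> complex) set) \<le> CARD('n)"
  unfolding form_rank_def using dim_subset_UNIV_cart by blast

lemma form_rank_mono: "J \<subseteq> J' \<Longrightarrow> form_rank J \<le> form_rank J'"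
  unfolding form_rank_def by (intro dim_subset image_mono)

lemma form_rank_insert:
  "form_rank (insert (m, q) J) =
    (if real_form m \<in> span ((\<lambda>(m, q). real_form m) ` J) then form_rank J else form_rank J + 1)"
  by (simp add: form_rank_def dim_insert)

text \<open>For fixed \<open>\<zeta>\<close> the value is real-linear in the coefficient vector, so
  the vectors with value 0 form a subspace.\<close>

lemma int_linear_form_eq_0_span:
  fixes \<zeta> :: "complex ^ 'n"
  assumes "\<And>m q. (m, q) \<in> J \<Longrightarrow> int_linear_form m \<zeta> = 0"
    and "real_form m \<in> span ((\<lambda>(m, q). real_form m) ` J)"
  shows "int_linear_form m \<zeta> = 0"
proof -
  let ?F = "\<lambda>x :: real ^ 'n. (\<Sum>i\<in>UNIV. of_real (x $ i) * \<zeta> $ i)"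
  have F: "int_linear_form m \<zeta> = ?F (real_form m)" for m
    by (simp add: int_linear_form_def real_form_def)
  have "subspace {x. ?F x = 0}"
    by (auto simp: subspace_def distrib_right sum.distrib mult.assoc simp flip: sum_distrib_left)
  moreover have "(\<lambda>(m, q). real_form m) ` J \<subseteq> {x. ?F x = 0}"
    using assms(1) F by auto
  ultimately have "span ((\<lambda>(m, q). real_form m) ` J) \<subseteq> {x. ?F x = 0}"
    by (rule span_minimal [rotated])
  then show ?thesis
    using assms(2) F by auto
qed

lemma transverse_direction:
  fixes m :: "int ^ 'n"
  assumes "real_form m \<notin> span ((\<lambda>(m, q). real_form m) ` J)"
  obtains u where "int_linear_form m u = 1" "\<And>m' q'. (m', q') \<in> J \<Longrightarrow> int_linear_form m' u = 0"
proof -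
  let ?W = "(\<lambda>(m, q). real_form m) ` J"
  obtain y z where y: "y \<in> span ?W" and z: "\<And>w. w \<in> span ?W \<Longrightarrow> orthogonal z w" and yz: "real_form m = y + z"
    using orthogonal_subspace_decomp_exists [of ?W "real_form m"] by metis
  have z0: "z \<bullet> z \<noteq> 0"
    using assms y yz by auto
  \<comment> \<open>\<open>z\<close> is the part of the coefficient vector orthogonal to the span;
    its inner product with the whole vector is \<open>z \<bullet> z\<close>, hence the
    scaling.\<close>
  define u :: "complex ^ 'n" where "u = (\<chi> i. of_real (z $ i / (z \<bullet> z)))"
  have lin: "int_linear_form m' u = of_real ((real_form m' \<bullet> z) / (z \<bullet> z))" for m'
    by (simp add: int_linear_form_def u_def real_form_def inner_vec_def sum_divide_distrib)
  show thesis
  proof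
    have "real_form m \<bullet> z = z \<bullet> z"
      using z [OF y] by (simp add: yz inner_add_left inner_add_right orthogonal_def inner_commute)
    then show "int_linear_form m u = 1"
      using z0 by (simp add: lin)
    show "int_linear_form m' u = 0" if "(m', q') \<in> J" for m' q'
    proof -
      have "real_form m' \<in> span ?W"
        using that by (intro span_base) force
      from z [OF this] show ?thesis
        by (simp add: lin orthogonal_def inner_commute)
    qed
  qed
qed

lemma axis_outside_span:
  assumes "form_rank (J :: ((int ^ 'n) \<times> complex) set) < CARD('n)"
  obtains m :: "int ^ 'n" where "real_form m \<notin> span ((\<lambda>(m, q). real_form m) ` J)"
proof -
  let ?W = "(\<lambda>(m, q). real_form m) ` J"
  have "\<exists>m :: int ^ 'n. real_form m \<notin> span ?W"
  proof (rule ccontr)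
    assume "\<not> ?thesis"
    then have "real_form (axis i 1) \<in> span ?W" for i
      by blast
    moreover have "real_form (axis i 1) = axis i 1" for i :: 'n
      by (simp add: real_form_def axis_def vec_eq_iff)
    ultimately have "Basis \<subseteq> span ?W"
      by (auto simp: Basis_vec_def)
    then have "span ?W = UNIV"
      by (metis span_Basis span_minimal subspace_span top.extremum_uniqueI)
    then have "dim ?W = CARD('n)"
      by (metis dim_span dim_UNIV DIM_cart DIM_real mult.right_neutral)
    then show False
      using assms by (simp add: form_rank_def)
  qed
  then show thesis
    using that by blast
qed

section \<open>Strata and their local structure\<close>

context period_pair
begin

definition stratum :: "((int ^ 'n) \<times> complex) set \<Rightarrow> ((int ^ 'n) \<times> complex) set \<Rightarrow> (complex ^ 'n) set"
  where "stratum J A = {z. (\<forall>(m, q)\<in>J. z \<in> divisor_preimage m q) \<and> (\<forall>(m, q)\<in>A. z \<notin> divisor_preimage m q)}"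

lemma stratum_insert:
  "stratum (insert (m, q) J) A = stratum J A \<inter> divisor_preimage m q"
  "stratum J (insert (m, q) A) = stratum J A - divisor_preimage m q"
  by (auto simp: stratum_def)

lemma stratum_translate:
  assumes u: "\<And>m q. (m, q) \<in> J \<union> A \<Longrightarrow> int_linear_form m u = 0" and z: "z \<in> stratum J A"
  shows "z + c *s u \<in> stratum J A"
proof -
  have "int_linear_form m (z + c *s u) = int_linear_form m z" if "(m, q) \<in> J \<union> A" for m q
    using u [OF that] by (simp add: int_linear_form_add int_linear_form_smult)
  then have "(m, q) \<in> J \<Longrightarrow> int_linear_form m (z + c *s u) = int_linear_form m z"
    "(m, q) \<in> A \<Longrightarrow> int_linear_form m (z + c *s u) = int_linear_form m z" for m q
    by blast+
  then show ?thesis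
    using z unfolding stratum_def by auto
qed

lemma torus_saturated_stratum: "torus_saturated \<Lambda> (stratum J A)"
  unfolding torus_saturated_def
proof (intro ballI allI impI)
  fix z w :: "complex ^ 'a" assume z: "z \<in> stratum J A" and eq: "ell_power_point \<Lambda> w = ell_power_point \<Lambda> z"
  show "w \<in> stratum J A"
    using z mem_divisor_preimage_cong [OF eq] unfolding stratum_def by simp
qed

lemma closed_divisor_preimage: "closed (divisor_preimage m q)"
proof -
  have "divisor_preimage m q = (\<lambda>z. coord1 (int_linear_form m z - q)) -` \<int> \<inter> (\<lambda>z. coord2 (int_linear_form m z - q)) -` \<int>"
    by (auto simp: mem_lattice_iff)
  moreover have "closed \<dots>"
    by (intro closed_Int continuous_closed_vimage closed_Ints continuous_on_eq_continuous_at [THEN iffD1, rule_format, OF open_UNIV]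
        continuous_intros) auto
  ultimately show ?thesis by simp
qed

text \<open>On the stratum the values of an equation in J differ by lattice elements. Close to
  \<open>z0\<close> the coordinates of such a difference are below 1 in absolute value, so it
  vanishes; linearity extends this to the span.\<close>

lemma stratum_locally_constant:
  fixes J :: "((int ^ 'n) \<times> complex) set"
  assumes "finite J" and z0: "z0 \<in> stratum J A"
  obtains U where "open U" "z0 \<in> U"
    "\<And>z m. z \<in> stratum J A \<Longrightarrow> z \<in> U \<Longrightarrow> real_form m \<in> span ((\<lambda>(m, q). real_form m) ` J) \<Longrightarrow>
      int_linear_form m z = int_linear_form m z0"
proof -
  let ?V = "\<lambda>m. {z. \<bar>coord1 (int_linear_form m (z - z0))\<bar> < 1 \<and> \<bar>coord2 (int_linear_form m (z - z0))\<bar> < 1}"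
  let ?U = "\<Inter>(m, q)\<in>J. ?V m"
  have "open (?V m)" for m
    by (intro open_Collect_conj open_Collect_less continuous_intros)
  then have "open ?U"
    using \<open>finite J\<close> by (intro open_INT) auto
  moreover
  have zero: "int_linear_form m 0 = 0" for m :: "int ^ 'n"
    using int_linear_form_diff [of m 0 0] by simp
  have c0: "coord1 0 = 0" "coord2 0 = 0"
    using coords_diff [of 0 0] by simp_all
  have "z0 \<in> ?U"
    by (auto simp: zero c0)
  moreover have "int_linear_form m z = int_linear_form m z0"
    if z: "z \<in> stratum J A" "z \<in> ?U" and m: "real_form m \<in> span ((\<lambda>(m, q). real_form m) ` J)" for z m
  proof -
    have "int_linear_form m' (z - z0) = 0" if J: "(m', q') \<in> J" for m' q'
    proof -
      have "int_linear_form m' z - q' \<in> \<Lambda>" "int_linear_form m' z0 - q' \<in> \<Lambda>"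
        using J z(1) z0 by (auto simp: stratum_def)
      then have "int_linear_form m' (z - z0) \<in> \<Lambda>"
        using diff_mem by (fastforce simp: int_linear_form_diff)
      moreover have "z \<in> ?V m'"
        using z(2) J by auto
      ultimately have "coord1 (int_linear_form m' (z - z0)) = 0" "coord2 (int_linear_form m' (z - z0)) = 0"
        by (auto simp: mem_lattice_iff elim!: Ints_cases)
      then show ?thesis
        using of_coords_coords [of "int_linear_form m' (z - z0)"] by (simp add: of_coords_def)
    qed
    then have "int_linear_form m (z - z0) = 0"
      using m by (rule int_linear_form_eq_0_span)
    then show ?thesis
      by (simp add: int_linear_form_diff)
  qed
  ultimately show thesis
    using that [of ?U] by blast
qed

text \<open>A form independent of J fibres the stratum over the whole curve, which costs two
  degrees; at full rank the stratum is discrete.\<close>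

lemma torus_vanishes_closed_stratum:
  fixes J :: "((int ^ 'n) \<times> complex) set"
  assumes "finite J" "k > 2 * CARD('n) - 2 * form_rank J"
  shows "torus_vanishes \<Lambda> k (stratum J {})"
  using assms
proof (induction "CARD('n) - form_rank J" arbitrary: J k)
  case 0
  let ?W = "(\<lambda>(m, q). real_form m) ` J"
  have "dim ?W = DIM(real ^ 'n)"
    using 0 form_rank_le [of J] by (simp add: form_rank_def)
  then have full: "span ?W = UNIV"
    by (rule dim_eq_full [THEN iffD1])
  show ?case
  proof (rule torus_vanishes_discrete [OF torus_saturated_stratum])
    fix z0 assume z0: "z0 \<in> stratum J {}"
    obtain U where U: "open U" "z0 \<in> U"
      "\<And>z m. z \<in> stratum J {} \<Longrightarrow> z \<in> U \<Longrightarrow> real_form m \<in> span ?W \<Longrightarrow>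
      int_linear_form m z = int_linear_form m z0"
      using stratum_locally_constant [OF \<open>finite J\<close> z0] by metis
    \<comment> \<open>At full rank the unit vectors lie in the span, so the coordinates themselves
      are locally constant.\<close>
    have "z = z0" if "z \<in> stratum J {}" "z \<in> U" for z
    proof -
      have "int_linear_form (axis i 1) z = int_linear_form (axis i 1) z0" for i
        using U(3) [OF that] full by simp
      moreover have "int_linear_form (axis i 1) w = w $ i" for i and w :: "complex ^ 'n"
        by (simp add: int_linear_form_def axis_def if_distrib [of of_int] if_distrib [of "\<lambda>x. x * _"] cong: if_cong)
      ultimately show ?thesis
        by (simp add: vec_eq_iff)
    qed
    then show "\<exists>U. open U \<and> stratum J {} \<inter> U = {z0}"
      using U z0 by blast
  qed (use 0 in auto)
next
  case (Suc d)
  then have less: "form_rank J < CARD('n)" by linarith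
  obtain m :: "int ^ 'n" where m: "real_form m \<notin> span ((\<lambda>(m, q). real_form m) ` J)"
    using axis_outside_span [OF less] by blast
  obtain u where u: "int_linear_form m u = 1" "\<And>m' q'. (m', q') \<in> J \<Longrightarrow> int_linear_form m' u = 0"
    using transverse_direction [OF m] by blast
  have rk: "form_rank (insert (m, c) J) = form_rank J + 1" for c
    using m by (simp add: form_rank_insert)
  \<comment> \<open>The bound of the fibres, whose rank is larger by one.\<close>
  let ?k = "2 * CARD('n) - 2 * form_rank J - 2"
  show ?case
  proof (rule torus_vanishes_fibration [OF torus_saturated_stratum _ u(1), where k = ?k])
    show "z + c *s u \<in> stratum J {}" if "z \<in> stratum J {}" for z c
      using that u(2) by (auto simp: stratum_def int_linear_form_add int_linear_form_smult split: prod.splits)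
    show "torus_vanishes \<Lambda> j (stratum J {} \<inter> divisor_preimage m c)" if "Suc ?k \<le> j" for j c
    proof -
      have "torus_vanishes \<Lambda> j (stratum (insert (m, c) J) {})"
        using Suc that less by (intro Suc.hyps(1)) (auto simp: rk)
      then show ?thesis
        by (simp only: stratum_insert)
    qed
    show "k \<ge> Suc (Suc (Suc ?k))"
      using Suc.prems less by linarith
  qed
qed

text \<open>Dependence makes the form locally constant on the stratum, so the intersection in
  Mayer-Vietoris is empty and no degree is lost.\<close>

lemma torus_vanishes_dependent_divisor:
  assumes "finite J" "real_form m \<in> span ((\<lambda>(m, q). real_form m) ` J)"
    and van: "torus_vanishes \<Lambda> k (stratum J A)"
  shows "torus_vanishes \<Lambda> k (stratum J A - divisor_preimage m q)"
proof (rule torus_vanishes_left [where V = "stratum J A \<inter> divisor_preimage m q"])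
  let ?S = "stratum J A" and ?D = "divisor_preimage m q"
  have un: "(?S - ?D) \<union> ?S \<inter> ?D = ?S" by blast
  show "torus_saturated \<Lambda> (?S - ?D)" "torus_saturated \<Lambda> (?S \<inter> ?D)"
    unfolding Diff_eq by (intro torus_saturated_Int torus_saturated_stratum torus_saturated_divisor_preimage)+
  show "openin (top_of_set (?S - ?D \<union> ?S \<inter> ?D)) (?S - ?D)"
    unfolding un using openin_open_Int [of "- ?D" ?S] closed_divisor_preimage [of m q] by (simp add: Diff_eq open_Compl)
  show "openin (top_of_set (?S - ?D \<union> ?S \<inter> ?D)) (?S \<inter> ?D)"
    unfolding un
  proof (subst openin_subopen, intro ballI)
    fix z0 assume z0: "z0 \<in> ?S \<inter> ?D"
    then have "z0 \<in> ?S" by blast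
    obtain U where U: "open U" "z0 \<in> U"
      "\<And>z m. z \<in> ?S \<Longrightarrow> z \<in> U \<Longrightarrow> real_form m \<in> span ((\<lambda>(m, q). real_form m) ` J) \<Longrightarrow>
      int_linear_form m z = int_linear_form m z0"
      using stratum_locally_constant [OF \<open>finite J\<close> \<open>z0 \<in> ?S\<close>] by metis
    have "?S \<inter> U \<subseteq> ?S \<inter> ?D"
      using U(3) assms(2) z0 by auto
    then show "\<exists>T. openin (top_of_set ?S) T \<and> z0 \<in> T \<and> T \<subseteq> ?S \<inter> ?D"
      using U z0 by (intro exI [of _ "?S \<inter> U"]) auto
  qed
  show "torus_vanishes \<Lambda> k (?S - ?D \<union> ?S \<inter> ?D)"
    unfolding un by (rule van)
  have "(?S - ?D) \<inter> (?S \<inter> ?D) = {}" by blast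
  then show "torus_vanishes \<Lambda> k ((?S - ?D) \<inter> (?S \<inter> ?D))"
    by (simp only: torus_vanishes_empty)
qed

end

section \<open>Deletion of a divisor\<close>

lemma norm_vec_smult: "norm (c *s u) = norm c * norm (u :: complex ^ 'n)"
  by (simp add: norm_vec_def vector_scalar_mult_def norm_mult L2_set_right_distrib)

lemma closed_Collect_Ints:
  fixes f :: "'a :: topological_space \<Rightarrow> real"
  shows "continuous_on UNIV f \<Longrightarrow> closed {z. f z \<in> \<int>}"
  using closed_vimage [OF closed_Ints, of f] by (simp add: vimage_def)

section \<open>Residues modulo the lattice and a tube around a divisor\<close>

context period_pair
begin

text \<open>The representative modulo 1 in [-1/2, 1/2). The shift by 1/2 moves the jump away from
  the lattice points, so residues are continuous near the divisor.\<close>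

definition residue1 :: "complex \<Rightarrow> real"
  where "residue1 w = frac (coord1 w + 1/2) - 1/2"

definition residue2 :: "complex \<Rightarrow> real"
  where "residue2 w = frac (coord2 w + 1/2) - 1/2"

lemma residue_mem_lattice: "w - of_coords (residue1 w) (residue2 w) \<in> \<Lambda>"
  by (simp add: mem_lattice_iff residue1_def residue2_def frac_def)

lemma residue_cong:
  assumes "w - w' \<in> \<Lambda>"
  shows "residue1 w = residue1 w'" "residue2 w = residue2 w'"
  using assms frac_eq_of_diff_Ints [of "coord1 w + 1/2" "coord1 w' + 1/2"]
    frac_eq_of_diff_Ints [of "coord2 w + 1/2" "coord2 w' + 1/2"]
  by (auto simp: mem_lattice_iff residue1_def residue2_def)

lemma residue_of_coords:
  assumes "w - of_coords a b \<in> \<Lambda>" "\<bar>a\<bar> < 1/2" "\<bar>b\<bar> < 1/2"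
  shows "residue1 w = a" "residue2 w = b"
proof -
  have "frac (coord1 w + 1/2) = a + 1/2" "frac (coord2 w + 1/2) = b + 1/2"
    using assms unfolding frac_unique_iff by (auto simp: mem_lattice_iff)
  then show "residue1 w = a" "residue2 w = b"
    by (simp_all add: residue1_def residue2_def)
qed

lemma residue_eq_0_iff: "residue1 w = 0 \<and> residue2 w = 0 \<longleftrightarrow> w \<in> \<Lambda>"
  using frac_unique_iff [of "coord1 w + 1/2" "1/2"] frac_unique_iff [of "coord2 w + 1/2" "1/2"]
  by (simp add: residue1_def residue2_def mem_lattice_iff)

lemma norm_of_coords_le: "norm (of_coords a b) \<le> \<bar>a\<bar> * norm \<omega>1 + \<bar>b\<bar> * norm \<omega>2"
  unfolding of_coords_def by (rule order_trans [OF norm_triangle_ineq]) (simp add: norm_mult)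

text \<open>\<open>u\<close> crosses the divisor at unit speed and preserves the equations in J, so
  it serves as normal direction; how far one may move along it is limited by the divisors in
  A.\<close>

context
  fixes J A :: "((int ^ 'n) \<times> complex) set" and m :: "int ^ 'n" and q :: complex and u :: "complex ^ 'n"
  assumes finA: "finite A" and mu: "int_linear_form m u = 1"
    and Ju: "\<And>m' q'. (m', q') \<in> J \<Longrightarrow> int_linear_form m' u = 0"
begin

definition res1 :: "complex ^ 'n \<Rightarrow> real" where "res1 z = residue1 (int_linear_form m z - q)"
definition res2 :: "complex ^ 'n \<Rightarrow> real" where "res2 z = residue2 (int_linear_form m z - q)"

text \<open>Projection along \<open>u\<close> to the divisor; the residues are the normal
  coordinates.\<close>

definition foot :: "complex ^ 'n \<Rightarrow> complex ^ 'n"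
  where "foot z = z - of_coords (res1 z) (res2 z) *s u"

text \<open>Besides the divisors in \<open>A\<close>, the obstacle contains the points where the residues jump. It is therefore
  never empty (\<open>infdist\<close> to an empty set is 0), and staying off it keeps residues below 1/2.\<close>
definition obstacle :: "(complex ^ 'n) set"
  where "obstacle = {z. coord1 (int_linear_form m z - q) + 1/2 \<in> \<int>} \<union>
    {z. coord2 (int_linear_form m z - q) + 1/2 \<in> \<int>} \<union> (\<Union>(m', q')\<in>A. divisor_preimage m' q')"

text \<open>A displacement along \<open>u\<close> with coordinates at most r in absolute value has
  length at most r times (norm \<omega>1 + norm \<omega>2) * norm u, so it does not reach the
  obstacle. The summand 1 makes the estimate strict and the denominator positive.\<close>

definition radius :: "complex ^ 'n \<Rightarrow> real"
  where "radius z = infdist z obstacle / (1 + (norm \<omega>1 + norm \<omega>2) * norm u)"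

abbreviation core :: "(complex ^ 'n) set"
  where "core \<equiv> stratum (insert (m, q) J) A"

text \<open>Square cross-sections fit the two coordinates of the curve, and the variable radius
  keeps the tube away from the divisors in A.\<close>

definition tube :: "(complex ^ 'n) set"
  where "tube = {z \<in> stratum J A. \<bar>res1 z\<bar> < radius (foot z) \<and> \<bar>res2 z\<bar> < radius (foot z)}"

section \<open>Normal coordinates on the tube\<close>

lemma res_cong:
  assumes "ell_power_point \<Lambda> z = ell_power_point \<Lambda> z'"
  shows "res1 z = res1 z'" "res2 z = res2 z'" "ell_power_point \<Lambda> (foot z) = ell_power_point \<Lambda> (foot z')"
proof -
  have "(int_linear_form m z - q) - (int_linear_form m z' - q) \<in> \<Lambda>"
    using int_linear_form_mem_lattice [OF assms, of m] by simp
  from residue_cong [OF this] show 12: "res1 z = res1 z'" "res2 z = res2 z'"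
    by (simp_all add: res1_def res2_def)
  then show "ell_power_point \<Lambda> (foot z) = ell_power_point \<Lambda> (foot z')"
    using ell_power_point_translate [OF assms, of "- (of_coords (res1 z) (res2 z) *s u)"] by (simp add: foot_def)
qed

lemma closed_obstacle: "closed obstacle"
proof -
  have "closed {z :: complex ^ 'n. coord1 (int_linear_form m z - q) + 1/2 \<in> \<int>}"
    "closed {z :: complex ^ 'n. coord2 (int_linear_form m z - q) + 1/2 \<in> \<int>}"
    by (intro closed_Collect_Ints continuous_intros)+
  then show ?thesis
    unfolding obstacle_def using finA
    by (intro closed_Un closed_UN) (auto simp: closed_divisor_preimage)
qed

lemma obstacle_cong:
  assumes "ell_power_point \<Lambda> z = ell_power_point \<Lambda> z'"
  shows "z \<in> obstacle \<longleftrightarrow> z' \<in> obstacle"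
proof -
  have int: "a \<in> \<int> \<longleftrightarrow> b \<in> \<int>" if "a - b \<in> \<int>" for a b :: real
    using that Ints_add [of "a - b" b] Ints_diff [of a "a - b"] by auto
  have L: "int_linear_form m z - int_linear_form m z' \<in> \<Lambda>"
    by (rule int_linear_form_mem_lattice [OF assms])
  have "coord1 (int_linear_form m z - q) + 1/2 \<in> \<int> \<longleftrightarrow> coord1 (int_linear_form m z' - q) + 1/2 \<in> \<int>"
    "coord2 (int_linear_form m z - q) + 1/2 \<in> \<int> \<longleftrightarrow> coord2 (int_linear_form m z' - q) + 1/2 \<in> \<int>"
    by (rule int; use L in \<open>simp add: mem_lattice_iff\<close>)+
  then show ?thesis
    using mem_divisor_preimage_cong [OF assms] by (auto simp: obstacle_def)
qed

text \<open>Half a period away from the divisor the first residue jumps. This shows that the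
  obstacle is nonempty and bounds the radius by 1/2.\<close>

lemma obstacle_nearby:
  assumes "b \<in> divisor_preimage m q"
  shows "b + of_coords (1/2) 0 *s u \<in> obstacle"
  using assms by (simp add: obstacle_def int_linear_form_add int_linear_form_smult mu mem_lattice_iff)

lemma obstacle_nonempty: "obstacle \<noteq> {}"
proof -
  have "q *s u \<in> divisor_preimage m q"
    by (simp add: int_linear_form_smult mu zero_mem)
  from obstacle_nearby [OF this] show ?thesis by blast
qed

text \<open>The obstacle is invariant under lattice vectors, so a nearest obstacle point can be
  translated along with \<open>z\<close>.\<close>

lemma radius_cong:
  assumes "ell_power_point \<Lambda> z = ell_power_point \<Lambda> z'"
  shows "radius z = radius z'"
proof -
  have "infdist z' obstacle \<le> infdist z obstacle" if eq: "ell_power_point \<Lambda> z = ell_power_point \<Lambda> z'" for z z'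
  proof -
    obtain c where c: "c \<in> obstacle" "infdist z obstacle = dist z c"
      using infdist_attains_inf [OF closed_obstacle obstacle_nonempty] by blast
    have "ell_power_point \<Lambda> (c + (z' - z)) = ell_power_point \<Lambda> c"
      using eq [symmetric] by (simp add: ell_power_point_eq_iff)
    then have "c + (z' - z) \<in> obstacle"
      using c obstacle_cong by blast
    then have "infdist z' obstacle \<le> dist z' (c + (z' - z))"
      by (rule infdist_le)
    also have "dist z' (c + (z' - z)) = dist z c"
      by (simp add: dist_norm algebra_simps)
    finally show ?thesis using c by simp
  qed
  from this [OF assms] this [OF assms [symmetric]] show ?thesis
    by (simp add: radius_def)
qed

lemma radius_denominator_pos: "0 < 1 + (norm \<omega>1 + norm \<omega>2) * norm u"
  by (intro add_pos_nonneg) auto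

lemma radius_pos_iff: "0 < radius z \<longleftrightarrow> z \<notin> obstacle"
  using in_closed_iff_infdist_zero [OF closed_obstacle obstacle_nonempty, of z] infdist_nonneg [of z obstacle]
    radius_denominator_pos
  by (auto simp: radius_def zero_less_divide_iff)

lemma radius_less_half:
  assumes "b \<in> divisor_preimage m q"
  shows "radius b < 1/2"
proof -
  have "infdist b obstacle \<le> dist b (b + of_coords (1/2) 0 *s u)"
    by (rule infdist_le [OF obstacle_nearby [OF assms]])
  also have "\<dots> = norm (of_coords (1/2) 0) * norm u"
    by (simp add: dist_norm norm_vec_smult)
  also have "\<dots> \<le> (1/2 * norm \<omega>1) * norm u"
    using norm_of_coords_le [of "1/2" 0] by (intro mult_right_mono) auto
  also have "\<dots> \<le> 1/2 * ((norm \<omega>1 + norm \<omega>2) * norm u)"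
    by (simp add: mult_right_mono)
  finally show ?thesis
    using radius_denominator_pos by (simp add: radius_def pos_divide_less_eq)
qed

lemma near_not_obstacle:
  assumes "\<bar>s\<bar> < radius b" "\<bar>t\<bar> < radius b"
  shows "b + of_coords s t *s u \<notin> obstacle"
proof
  let ?K = "(norm \<omega>1 + norm \<omega>2) * norm u"
  assume "b + of_coords s t *s u \<in> obstacle"
  then have "infdist b obstacle \<le> dist b (b + of_coords s t *s u)"
    by (rule infdist_le)
  also have "\<dots> = norm (of_coords s t) * norm u"
    by (simp add: dist_norm norm_vec_smult)
  also have "\<dots> \<le> (radius b * norm \<omega>1 + radius b * norm \<omega>2) * norm u"
    using assms by (intro mult_right_mono order_trans [OF norm_of_coords_le] add_mono) (auto intro: mult_right_mono)
  also have "\<dots> = radius b * ?K"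
    by (simp add: algebra_simps)
  also have "\<dots> < radius b * (1 + ?K)"
    using assms by (intro mult_strict_left_mono) auto
  also have "\<dots> = infdist b obstacle"
    using radius_denominator_pos by (simp add: radius_def)
  finally show False by simp
qed

lemma stratum_no_divisors_translate:
  "z + c *s u \<in> stratum J {} \<longleftrightarrow> z \<in> stratum J {}"
  using Ju by (force simp: stratum_def int_linear_form_add int_linear_form_smult)

lemma stratum_iff: "z \<in> stratum J A \<longleftrightarrow> z \<in> stratum J {} \<and> (\<forall>(m', q')\<in>A. z \<notin> divisor_preimage m' q')"
  by (auto simp: stratum_def)

lemma not_obstacle_stratum: "z \<notin> obstacle \<Longrightarrow> z \<in> stratum J {} \<Longrightarrow> z \<in> stratum J A"
  unfolding stratum_iff obstacle_def by auto

lemma foot_mem_divisor: "foot z \<in> divisor_preimage m q"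
  using residue_mem_lattice [of "int_linear_form m z - q"]
  by (simp add: foot_def int_linear_form_diff int_linear_form_smult mu res1_def res2_def algebra_simps)

lemma core_not_obstacle: "b \<in> core \<Longrightarrow> b \<notin> obstacle"
proof -
  assume b: "b \<in> core"
  have "a + 1/2 \<notin> \<int>" if "a \<in> \<int>" for a :: real
  proof
    assume "a + 1/2 \<in> \<int>"
    then have "(1/2 :: real) \<in> \<int>"
      using that Ints_diff [of "a + 1/2" a] by simp
    then show False
      by (auto elim!: Ints_cases simp: field_simps)
  qed
  then show ?thesis
    using b by (auto simp: obstacle_def stratum_def mem_lattice_iff)
qed

text \<open>Together with \<open>foot_mem_core\<close> this describes the tube as the union of
  squares of half side \<open>radius b\<close> over the core points \<open>b\<close>.\<close>

lemma tube_point: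
  assumes b: "b \<in> core" and st: "\<bar>s\<bar> < radius b" "\<bar>t\<bar> < radius b"
  defines "z \<equiv> b + of_coords s t *s u"
  shows "res1 z = s" "res2 z = t" "foot z = b" "z \<in> tube"
proof -
  have bm: "b \<in> divisor_preimage m q"
    using b by (simp add: stratum_insert)
  have half: "\<bar>s\<bar> < 1/2" "\<bar>t\<bar> < 1/2"
    using st radius_less_half [OF bm] by auto
  have "int_linear_form m z - q - of_coords s t \<in> \<Lambda>"
    using bm by (simp add: z_def int_linear_form_add int_linear_form_smult mu algebra_simps)
  from residue_of_coords [OF this half] show r: "res1 z = s" "res2 z = t"
    by (simp_all add: res1_def res2_def)
  then show f: "foot z = b"
    by (simp add: foot_def z_def)
  have "b \<in> stratum J {}"
    using b by (auto simp: stratum_def)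
  then have "z \<in> stratum J A"
    using near_not_obstacle [OF st] by (intro not_obstacle_stratum) (auto simp: z_def stratum_no_divisors_translate)
  then show "z \<in> tube"
    using st by (simp add: tube_def r f)
qed

lemma foot_mem_core:
  assumes "z \<in> tube"
  shows "foot z \<in> core"
proof -
  \<comment> \<open>The strict inequalities in \<open>tube\<close> force a positive radius, which
    places the foot off the obstacle and hence off the divisors in A.\<close>
  have "0 < radius (foot z)"
    using assms by (auto simp: tube_def)
  then have "foot z \<notin> obstacle"
    by (simp add: radius_pos_iff)
  moreover have "foot z \<in> stratum J {}"
  proof -
    have "foot z = z + (- of_coords (res1 z) (res2 z)) *s u"
      by (simp add: foot_def vec_eq_iff)
    moreover have "z \<in> stratum J {}"
      using assms by (simp add: tube_def stratum_iff)
    ultimately show ?thesis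
      by (simp only: stratum_no_divisors_translate)
  qed
  ultimately show ?thesis
    using foot_mem_divisor by (auto simp: stratum_insert not_obstacle_stratum)
qed

lemma tube_res_less_half: "z \<in> tube \<Longrightarrow> \<bar>res1 z\<bar> < 1/2 \<and> \<bar>res2 z\<bar> < 1/2"
  using radius_less_half [OF foot_mem_divisor, of z] by (auto simp: tube_def)

text \<open>The complement of the loci where the residues jump.\<close>

definition slit_complement :: "(complex ^ 'n) set"
  where "slit_complement = {z. coord1 (int_linear_form m z - q) + 1/2 \<notin> \<int>} \<inter>
    {z. coord2 (int_linear_form m z - q) + 1/2 \<notin> \<int>}"

lemma continuous_on_res:
  "continuous_on slit_complement res1" "continuous_on slit_complement res2"
  unfolding res1_def residue1_def res2_def residue2_def
  by (intro continuous_intros continuous_on_frac; auto simp: slit_complement_def)+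

lemma continuous_on_foot: "continuous_on slit_complement foot"
  unfolding foot_def by (intro continuous_intros continuous_on_res)

lemma continuous_on_radius: "continuous_on S f \<Longrightarrow> continuous_on S (\<lambda>z. radius (f z))"
  unfolding radius_def divide_inverse by (intro continuous_intros)

lemma tube_subset_slit_complement: "tube \<subseteq> slit_complement"
proof
  fix z assume "z \<in> tube"
  then have "res1 z \<noteq> - 1/2" "res2 z \<noteq> - 1/2"
    using tube_res_less_half by fastforce+
  then show "z \<in> slit_complement"
    by (auto simp: slit_complement_def res1_def res2_def residue1_def residue2_def simp flip: frac_eq_0_iff)
qed

lemma openin_tube: "openin (top_of_set (stratum J A)) tube"
proof -
  have "closed {z :: complex ^ 'n. coord1 (int_linear_form m z - q) + 1/2 \<in> \<int>}"
    "closed {z :: complex ^ 'n. coord2 (int_linear_form m z - q) + 1/2 \<in> \<int>}"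
    by (intro closed_Collect_Ints continuous_intros)+
  then have op: "open slit_complement"
    unfolding slit_complement_def by (intro open_Int) (simp_all add: closed_def Collect_neg_eq)
  let ?N = "\<lambda>r. slit_complement \<inter> (\<lambda>z. radius (foot z) - \<bar>r z\<bar>) -` {0<..}"
  have "open (?N res1)" "open (?N res2)"
    by (intro continuous_open_preimage op continuous_intros continuous_on_radius continuous_on_foot continuous_on_res open_greaterThan)+
  then have "openin (top_of_set (stratum J A)) (stratum J A \<inter> (?N res1 \<inter> ?N res2))"
    by (intro openin_open_Int) (rule open_Int)
  moreover have "tube = stratum J A \<inter> (?N res1 \<inter> ?N res2)"
    using tube_subset_slit_complement by (auto simp: tube_def)
  ultimately show ?thesis
    by simp
qed

lemma torus_saturated_core: "torus_saturated \<Lambda> core"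
  by (rule torus_saturated_stratum)

text \<open>A zero argument imposes no condition, so the arguments 1 and -1 with or without 0 give
  half planes and quadrants in the normal direction; these are convex, whence each sector retracts to the core.\<close>
definition tube_sector :: "real \<Rightarrow> real \<Rightarrow> (complex ^ 'n) set"
  where "tube_sector s t = {z \<in> tube. (s \<noteq> 0 \<longrightarrow> 0 < s * res1 z) \<and> (t \<noteq> 0 \<longrightarrow> 0 < t * res2 z)}"

lemma torus_saturated_tube_sector: "torus_saturated \<Lambda> (tube_sector s t)"
  unfolding torus_saturated_def
proof (intro ballI allI impI)
  fix z w assume z: "z \<in> tube_sector s t" and eq: "ell_power_point \<Lambda> w = ell_power_point \<Lambda> z"
  have "w \<in> stratum J A"
    using torus_saturated_stratum z eq unfolding torus_saturated_def tube_sector_def tube_def by blast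
  then show "w \<in> tube_sector s t"
    using z res_cong [OF eq] radius_cong [OF res_cong(3) [OF eq]] by (simp add: tube_sector_def tube_def)
qed

lemma openin_tube_sector: "openin (top_of_set tube) (tube_sector s t)"
proof -
  have "continuous_on tube res1" "continuous_on tube res2"
    using continuous_on_res tube_subset_slit_complement continuous_on_subset by blast+
  then have "openin (top_of_set tube) (tube \<inter> (\<lambda>z. c * res1 z) -` {0<..})"
    "openin (top_of_set tube) (tube \<inter> (\<lambda>z. c * res2 z) -` {0<..})" for c
    by (auto intro!: continuous_openin_preimage_gen continuous_intros)
  moreover have "openin (top_of_set tube) tube" by simp
  ultimately have "openin (top_of_set tube)
      ((if s = 0 then tube else tube \<inter> (\<lambda>z. s * res1 z) -` {0<..}) \<inter>
       (if t = 0 then tube else tube \<inter> (\<lambda>z. t * res2 z) -` {0<..}))"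
    by (intro openin_Int) auto
  moreover have "(if s = 0 then tube else tube \<inter> (\<lambda>z. s * res1 z) -` {0<..}) \<inter>
       (if t = 0 then tube else tube \<inter> (\<lambda>z. t * res2 z) -` {0<..}) = tube_sector s t"
    by (auto simp: tube_sector_def)
  ultimately show ?thesis by simp
qed

text \<open>The foot leads from a sector to the core, and a push to half the radius in the direction
  of the signs leads back. Sectors are convex in the normal coordinates, so the segments stay
  inside.\<close>

lemma torus_vanishes_tube_sector:
  assumes s: "s \<in> {-1, 0, 1}" and t: "t \<in> {-1, 0, 1}" and van: "torus_vanishes \<Lambda> k core"
  shows "torus_vanishes \<Lambda> k (tube_sector s t)"
proof (rule torus_vanishes_dominated [OF torus_saturated_tube_sector torus_saturated_core, where
      v = "\<lambda>z. - (of_coords (res1 z) (res2 z) *s u)" and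
      v' = "\<lambda>b. of_coords (s * radius b / 2) (t * radius b / 2) *s u"])
  have sub: "tube_sector s t \<subseteq> slit_complement"
    using tube_subset_slit_complement by (auto simp: tube_sector_def)
  show "continuous_on (tube_sector s t) (\<lambda>z. - (of_coords (res1 z) (res2 z) *s u))"
    by (intro continuous_intros continuous_on_subset [OF continuous_on_res(1) sub] continuous_on_subset [OF continuous_on_res(2) sub])
  show "continuous_on core (\<lambda>b. of_coords (s * radius b / 2) (t * radius b / 2) *s u)"
    by (intro continuous_intros continuous_on_radius) auto
  show "z + - (of_coords (res1 z) (res2 z) *s u) \<in> core" if "z \<in> tube_sector s t" for z
    using foot_mem_core [of z] that by (simp add: foot_def tube_sector_def)
  have pos: "0 < radius b" if "b \<in> core" for b
    using core_not_obstacle [OF that] by (simp add: radius_pos_iff)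
  have small: "\<bar>s * radius b / 2\<bar> < radius b" "\<bar>t * radius b / 2\<bar> < radius b" if "b \<in> core" for b
    using s t pos [OF that] by auto
  show "b + of_coords (s * radius b / 2) (t * radius b / 2) *s u \<in> tube_sector s t" if b: "b \<in> core" for b
    using tube_point [OF b small [OF b]] s t pos [OF b] by (auto simp: tube_sector_def)
  show "- (of_coords (res1 z) (res2 z) *s u) = - (of_coords (res1 z') (res2 z') *s u)"
    if "ell_power_point \<Lambda> z = ell_power_point \<Lambda> z'" for z z'
    using res_cong [OF that] by simp
  show "of_coords (s * radius b / 2) (t * radius b / 2) *s u = of_coords (s * radius b' / 2) (t * radius b' / 2) *s u"
    if "ell_power_point \<Lambda> b = ell_power_point \<Lambda> b'" for b b'
    using radius_cong [OF that] by simp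
  fix \<tau> :: real and z assume \<tau>: "0 \<le> \<tau>" "\<tau> \<le> 1" and z: "z \<in> tube_sector s t"
  let ?b = "foot z"
  let ?x = "(1 - \<tau>) * res1 z + \<tau> * (s * radius ?b / 2)" and ?y = "(1 - \<tau>) * res2 z + \<tau> * (t * radius ?b / 2)"
  have b: "?b \<in> core"
    using z by (intro foot_mem_core) (simp add: tube_sector_def)
  have conv: "\<bar>(1 - \<tau>) * a + \<tau> * c\<bar> < e" if "\<bar>a\<bar> < e" "\<bar>c\<bar> < e" for a c e :: real
  proof -
    have "(1 - \<tau>) *\<^sub>R a + \<tau> *\<^sub>R c \<in> {-e<..<e}"
      using \<tau> that by (intro convexD [OF convex_real_interval(8)]) auto
    then show ?thesis by auto
  qed
  have xy: "\<bar>?x\<bar> < radius ?b" "\<bar>?y\<bar> < radius ?b"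
    using z by (intro conv small [OF b]; simp add: tube_sector_def tube_def)+
  \<comment> \<open>Over a fixed foot the segment interpolates linearly, in normal coordinates,
    between the residues and the pushed point.\<close>
  have pt: "z + \<tau> *\<^sub>R (- (of_coords (res1 z) (res2 z) *s u) +
      of_coords (s * radius (z + - (of_coords (res1 z) (res2 z) *s u)) / 2)
        (t * radius (z + - (of_coords (res1 z) (res2 z) *s u)) / 2) *s u) = ?b + of_coords ?x ?y *s u"
  proof -
    have "z + - (of_coords (res1 z) (res2 z) *s u) = ?b"
      by (simp add: foot_def)
    moreover have "z + \<tau> *\<^sub>R (- (a *s u) + c *s u) = (z + - (a *s u)) + ((1 - \<tau>) *\<^sub>R a + \<tau> *\<^sub>R c) *s u" for a c
      by (simp add: vec_eq_iff scaleR_conv_of_real [where 'a = complex] algebra_simps)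
    moreover have "of_coords ?x ?y = (1 - \<tau>) *\<^sub>R of_coords (res1 z) (res2 z) +
        \<tau> *\<^sub>R of_coords (s * radius ?b / 2) (t * radius ?b / 2)"
      by (simp only: of_coords_add of_coords_scaleR)
    ultimately show ?thesis
      by (simp only:)
  qed
  have sgn: "0 < r * ((1 - \<tau>) * a + \<tau> * (r * e / 2))"
    if "r \<in> {-1, 1}" "0 < r * a" "0 < e" for r a e :: real
  proof -
    have "(1 - \<tau>) *\<^sub>R (r * a) + \<tau> *\<^sub>R (e / 2) \<in> {0<..}"
      using \<tau> that by (intro convexD [OF convex_real_interval(3)]) auto
    moreover have "r * ((1 - \<tau>) * a + \<tau> * (r * e / 2)) = (1 - \<tau>) * (r * a) + \<tau> * (e / 2)"
      using that(1) by (auto simp: algebra_simps)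
    ultimately show ?thesis by simp
  qed
  have "0 < s * ?x" if "s \<noteq> 0"
    using sgn [of s "res1 z" "radius ?b"] s that z pos [OF b] by (auto simp: tube_sector_def)
  moreover have "0 < t * ?y" if "t \<noteq> 0"
    using sgn [of t "res2 z" "radius ?b"] t that z pos [OF b] by (auto simp: tube_sector_def)
  ultimately show "z + \<tau> *\<^sub>R (- (of_coords (res1 z) (res2 z) *s u) +
      of_coords (s * radius (z + - (of_coords (res1 z) (res2 z) *s u)) / 2)
        (t * radius (z + - (of_coords (res1 z) (res2 z) *s u)) / 2) *s u) \<in> tube_sector s t"
    unfolding pt using tube_point [OF b xy] by (simp add: tube_sector_def)
qed (rule van)

text \<open>A sector has the bound of the core. Two opposite half planes are disjoint; the two pairs
  \<open>?X\<close> and \<open>?Y\<close> cover the tube minus the core and meet in four disjoint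
  quadrants, so Mayer-Vietoris raises the bound by one.\<close>

lemma torus_vanishes_tube_minus_core:
  assumes van: "\<And>j. j \<ge> Suc k \<Longrightarrow> torus_vanishes \<Lambda> j core" and "j \<ge> Suc (Suc k)"
  shows "torus_vanishes \<Lambda> j (tube - divisor_preimage m q)"
proof -
  let ?T = tube_sector
  obtain i where i: "j = Suc (Suc i)" "i \<ge> k"
    using \<open>j \<ge> Suc (Suc k)\<close> by (metis Suc_le_D Suc_le_mono)
  have sub: "?T s t \<subseteq> tube" for s t
    by (auto simp: tube_sector_def)
  have op: "openin (top_of_set W) (?T s t)" if "?T s t \<subseteq> W" "W \<subseteq> tube" for s t W
    using openin_subset_trans [OF openin_tube_sector] that by blast
  have opU: "openin (top_of_set W) (?T s t \<union> ?T s' t')" if "?T s t \<union> ?T s' t' \<subseteq> W" "W \<subseteq> tube" for s t s' t' W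
    using that by (intro openin_Un op) auto
  have two: "torus_vanishes \<Lambda> (Suc i') (?T s t \<union> ?T s' t')"
    if "i' \<ge> k" "?T s t \<inter> ?T s' t' = {}" "s \<in> {-1, 0, 1}" "t \<in> {-1, 0, 1}" "s' \<in> {-1, 0, 1}" "t' \<in> {-1, 0, 1}"
    for i' s t s' t'
    using that sub by (intro torus_vanishes_disjoint_union torus_saturated_tube_sector op torus_vanishes_tube_sector van) auto
  let ?X = "?T 1 0 \<union> ?T (-1) 0" and ?Y = "?T 0 1 \<union> ?T 0 (-1)"
  let ?P = "?T 1 1 \<union> ?T 1 (-1)" and ?Q = "?T (-1) 1 \<union> ?T (-1) (-1)"
  have XY: "?X \<inter> ?Y = ?P \<union> ?Q"
    by (auto simp: tube_sector_def)
  have satU: "torus_saturated \<Lambda> (?T s t \<union> ?T s' t')" for s t s' t'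
    by (intro torus_saturated_Un torus_saturated_tube_sector)
  have "torus_vanishes \<Lambda> (Suc i) (?P \<union> ?Q)"
  proof (rule torus_vanishes_disjoint_union [OF satU _ satU])
    show "?P \<inter> ?Q = {}"
      by (auto simp: tube_sector_def)
    show "torus_vanishes \<Lambda> (Suc i) ?P" "torus_vanishes \<Lambda> (Suc i) ?Q"
      by (rule two; use i in \<open>auto simp: tube_sector_def\<close>)+
    show "openin (top_of_set (?P \<union> ?Q)) ?P" "openin (top_of_set (?P \<union> ?Q)) ?Q"
      by (rule opU; use sub in auto)+
  qed
  then have "torus_vanishes \<Lambda> (Suc i) (?X \<inter> ?Y)"
    by (simp only: XY)
  moreover have vX: "torus_vanishes \<Lambda> (Suc (Suc i)) ?X" and vY: "torus_vanishes \<Lambda> (Suc (Suc i)) ?Y"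
    by (rule two; use i in \<open>auto simp: tube_sector_def\<close>)+
  moreover have opX: "openin (top_of_set (?X \<union> ?Y)) ?X" and opY: "openin (top_of_set (?X \<union> ?Y)) ?Y"
    by (rule opU; use sub in auto)+
  ultimately have "torus_vanishes \<Lambda> (Suc (Suc i)) (?X \<union> ?Y)"
    by (intro torus_vanishes_union [OF satU opX satU opY])
  moreover have "tube - divisor_preimage m q = ?X \<union> ?Y"
  proof -
    have "z \<in> divisor_preimage m q \<longleftrightarrow> \<not> (0 < res1 z \<or> res1 z < 0 \<or> 0 < res2 z \<or> res2 z < 0)" for z
      using residue_eq_0_iff [of "int_linear_form m z - q"] unfolding res1_def res2_def mem_Collect_eq by linarith
    then show ?thesis
      by (auto simp: tube_sector_def)
  qed
  ultimately show ?thesis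
    by (simp only: i)
qed

lemma torus_vanishes_deletion:
  assumes van: "\<And>j. j \<ge> Suc k \<Longrightarrow> torus_vanishes \<Lambda> j core" and "j \<ge> Suc (Suc k)"
    and S: "torus_vanishes \<Lambda> j (stratum J A)"
  shows "torus_vanishes \<Lambda> j (stratum J A - divisor_preimage m q)"
proof (rule torus_vanishes_left [where V = tube])
  let ?S = "stratum J A" and ?D = "divisor_preimage m q"
  have sat0: "torus_saturated \<Lambda> (tube_sector 0 0)"
    by (rule torus_saturated_tube_sector)
  then show "torus_saturated \<Lambda> tube"
    by (simp add: tube_sector_def)
  show "torus_saturated \<Lambda> (?S - ?D)"
    unfolding Diff_eq by (intro torus_saturated_Int torus_saturated_stratum torus_saturated_divisor_preimage)
  have "z \<in> tube" if z: "z \<in> ?S" "z \<in> ?D" for z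
  proof -
    have core: "z \<in> core"
      using z by (simp add: stratum_insert)
    have "0 < radius z"
      using core_not_obstacle [OF core] by (simp add: radius_pos_iff)
    \<comment> \<open>A core point is its own foot: displace it by 0.\<close>
    then have "z + of_coords 0 0 *s u \<in> tube"
      by (intro tube_point [OF core]) auto
    then show ?thesis by (simp add: of_coords_def)
  qed
  then have un: "(?S - ?D) \<union> tube = ?S"
    by (auto simp: tube_def)
  show "openin (top_of_set (?S - ?D \<union> tube)) (?S - ?D)"
    unfolding un using openin_open_Int [of "- ?D" ?S] closed_divisor_preimage [of m q] by (simp add: Diff_eq open_Compl)
  show "openin (top_of_set (?S - ?D \<union> tube)) tube"
    unfolding un by (rule openin_tube)
  show "torus_vanishes \<Lambda> j (?S - ?D \<union> tube)"
    unfolding un by (rule S)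
  have "(?S - ?D) \<inter> tube = tube - ?D"
    by (auto simp: tube_def)
  then show "torus_vanishes \<Lambda> j ((?S - ?D) \<inter> tube)"
    using torus_vanishes_tube_minus_core [OF van \<open>j \<ge> Suc (Suc k)\<close>] by simp
qed

end

section \<open>The vanishing theorem\<close>

lemma torus_vanishes_stratum:
  fixes J A :: "((int ^ 'n) \<times> complex) set"
  assumes "finite A" "finite J" "k > 2 * CARD('n) - form_rank J - form_rank (J \<union> A)"
  shows "torus_vanishes \<Lambda> k (stratum J A)"
  using assms
proof (induction A arbitrary: J k)
  case empty
  then show ?case
    \<comment> \<open>Without A the two ranks agree, and the bound becomes that of a closed
      stratum.\<close>
    by (intro torus_vanishes_closed_stratum) (auto simp: mult_2)
next
  case (insert a A)
  obtain m q where a: "a = (m, q)" by (cases a)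
  let ?span = "\<lambda>J. span ((\<lambda>(m, q). real_form m) ` J)"
  have goal: "torus_vanishes \<Lambda> k (stratum J A - divisor_preimage m q) \<Longrightarrow> ?case"
    by (simp only: a stratum_insert)
  have mono: "?span J \<subseteq> ?span (J \<union> A)"
    by (intro span_mono image_mono) auto
  have rk_all: "form_rank (J \<union> insert a A) =
      (if real_form m \<in> ?span (J \<union> A) then form_rank (J \<union> A) else form_rank (J \<union> A) + 1)"
    using form_rank_insert [of m q "J \<union> A"] by (simp add: a)
  have rkJ: "form_rank (insert (m, c) J) = form_rank J + 1" if "real_form m \<notin> ?span J" for c
    using that by (simp add: form_rank_insert)
  \<comment> \<open>The rank ignores the constant \<open>c\<close>, so one bound serves all
    fibres.\<close>
  have rkJA: "form_rank (insert (m, c) J \<union> A) = form_rank (J \<union> insert a A)" for c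
    using form_rank_insert [of m c "J \<union> A"] rk_all by simp
  consider (dependent) "real_form m \<in> ?span J"
    | (independent) "real_form m \<notin> ?span (J \<union> A)"
    | (deletion) "real_form m \<notin> ?span J" "real_form m \<in> ?span (J \<union> A)"
    by blast
  then show ?case
  proof cases
    case dependent
    then have "form_rank (J \<union> insert a A) = form_rank (J \<union> A)"
      using mono rk_all by auto
    then have "torus_vanishes \<Lambda> k (stratum J A)"
      using insert.prems by (intro insert.IH) simp_all
    then show ?thesis
      using goal torus_vanishes_dependent_divisor [OF \<open>finite J\<close> dependent] by blast
  next
    case independent
    then have mJ: "real_form m \<notin> ?span J"
      using mono by blast
    obtain u where u: "int_linear_form m u = 1" "\<And>m' q'. (m', q') \<in> J \<union> A \<Longrightarrow> int_linear_form m' u = 0"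
      using transverse_direction [OF independent] by blast
    \<comment> \<open>The bound of the fibres: compared with \<open>stratum J A\<close> both ranks
      grow by one. The punctured curve then adds one degree.\<close>
    let ?k = "2 * CARD('n) - form_rank J - form_rank (J \<union> A) - 2"
    have le: "form_rank J \<le> form_rank (J \<union> A)" "form_rank (J \<union> A) + 1 \<le> CARD('n)"
      using form_rank_mono [of J "J \<union> A"] form_rank_le [of "J \<union> insert a A"] rk_all independent by auto
    show ?thesis
    proof (rule goal, rule torus_vanishes_punctured_fibration [OF torus_saturated_stratum _ u(1), where k = ?k])
      show "z + c *s u \<in> stratum J A" if "z \<in> stratum J A" for z c
        using u(2) that by (rule stratum_translate)
      show "torus_vanishes \<Lambda> j (stratum J A \<inter> divisor_preimage m c)" if "Suc ?k \<le> j" for j c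
      proof -
        have "torus_vanishes \<Lambda> j (stratum (insert (m, c) J) A)"
          using that le \<open>finite J\<close> rk_all independent by (intro insert.IH) (auto simp: rkJ [OF mJ] rkJA simp del: Un_insert_left)
        then show ?thesis
          by (simp only: stratum_insert)
      qed
      show "k \<ge> Suc (Suc ?k)"
        using insert.prems(2) le rk_all independent by simp
    qed
  next
    case deletion
    obtain u where u: "int_linear_form m u = 1" "\<And>m' q'. (m', q') \<in> J \<Longrightarrow> int_linear_form m' u = 0"
      using transverse_direction [OF deletion(1)] by blast
    have rk: "form_rank (J \<union> insert a A) = form_rank (J \<union> A)"
      using rk_all deletion by simp
    have le: "form_rank J + 1 \<le> form_rank (J \<union> A)" "form_rank (J \<union> A) \<le> CARD('n)"
      using form_rank_mono [of "insert (m, q) J" "J \<union> insert a A"] form_rank_le [of "J \<union> A"] rk rkJ [OF deletion(1)]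
      by (auto simp: a)
    \<comment> \<open>The bound of the core: the new equation raises the rank of J but not that of J
      u A. The tube minus the core then has just the bound to be proved.\<close>
    let ?k = "2 * CARD('n) - form_rank J - form_rank (J \<union> A) - 1"
    show ?thesis
    proof (rule goal, rule torus_vanishes_deletion [OF \<open>finite A\<close> u, where k = ?k])
      show "torus_vanishes \<Lambda> j (stratum (insert (m, q) J) A)" if "Suc ?k \<le> j" for j
        using that le \<open>finite J\<close> rk by (intro insert.IH) (auto simp: rkJ [OF deletion(1)] rkJA simp del: Un_insert_left)
      show "k \<ge> Suc (Suc ?k)"
        using insert.prems(2) le rk by simp
      show "torus_vanishes \<Lambda> k (stratum J A)"
        using insert.prems rk by (intro insert.IH) simp_all
    qed
  qed
qed

text \<open>\<open>b\<close> lifts the constants to C. Membership in a divisor depends on the class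
  modulo the lattice, so it can be tested on any representative.\<close>

lemma arrangement_complement_eq_stratum:
  fixes A :: "((int ^ 'n) \<times> complex set) list"
  assumes b: "\<And>m Q. (m, Q) \<in> set A \<Longrightarrow> Q = ell_point \<Lambda> (b Q)"
  shows "arrangement_complement \<Lambda> A = ell_power_point \<Lambda> ` stratum {} ((\<lambda>(m, Q). (m, b Q)) ` set A)"
proof -
  have div: "ell_power_point \<Lambda> z \<in> ell_divisor \<Lambda> m Q \<longleftrightarrow> z \<in> divisor_preimage m (b Q)"
    if "(m, Q) \<in> set A" for z :: "complex ^ 'n" and m Q
  proof -
    have "ell_point \<Lambda> (int_linear_form m z) = Q \<longleftrightarrow> z \<in> divisor_preimage m (b Q)" for z
    proof -
      have "ell_point \<Lambda> (int_linear_form m z) = Q \<longleftrightarrow> ell_point \<Lambda> (int_linear_form m z) = ell_point \<Lambda> (b Q)"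
        using b [OF that] by metis
      then show ?thesis
        by (simp add: ell_point_eq_iff)
    qed
    then have "ell_divisor \<Lambda> m Q = ell_power_point \<Lambda> ` divisor_preimage m (b Q)"
      by (auto simp: ell_divisor_def int_linear_form_def)
    then show ?thesis
      using mem_divisor_preimage_cong [of z _ m "b Q"] by blast
  qed
  show ?thesis
  proof (intro Set.set_eqI iffI)
    fix x assume x: "x \<in> arrangement_complement \<Lambda> A"
    then obtain z where z: "x = ell_power_point \<Lambda> z"
      by (auto simp: arrangement_complement_def ell_power_def)
    have "z \<in> stratum {} ((\<lambda>(m, Q). (m, b Q)) ` set A)"
      using x div unfolding z arrangement_complement_def stratum_def by fastforce
    then show "x \<in> ell_power_point \<Lambda> ` stratum {} ((\<lambda>(m, Q). (m, b Q)) ` set A)"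
      using z by blast
  next
    fix x assume "x \<in> ell_power_point \<Lambda> ` stratum {} ((\<lambda>(m, Q). (m, b Q)) ` set A)"
    then obtain z where z: "x = ell_power_point \<Lambda> z" "z \<in> stratum {} ((\<lambda>(m, Q). (m, b Q)) ` set A)"
      by blast
    then have "ell_power_point \<Lambda> z \<notin> ell_divisor \<Lambda> m Q" if "(m, Q) \<in> set A" for m Q
      using div [OF that] that by (force simp: stratum_def)
    then show "x \<in> arrangement_complement \<Lambda> A"
      unfolding z arrangement_complement_def ell_power_def by auto
  qed
qed

end

theorem theorem1p7:
  fixes \<omega>1 \<omega>2 :: complex
    and A :: "((int ^ 'n) \<times> complex set) list"
    and r i :: nat
  assumes "nondegenerate_periods \<omega>1 \<omega>2"
    and "elliptic_arrangement (period_lattice \<omega>1 \<omega>2) A"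
    and "r = arrangement_rank A"
    and "i > 2 * CARD('n) - r"
  shows "trivial_group (singular_cohomology_group i
           (subtopology (ell_power_topology (period_lattice \<omega>1 \<omega>2))
              (arrangement_complement (period_lattice \<omega>1 \<omega>2) A)))"
proof -
  interpret period_pair \<omega>1 \<omega>2
    by unfold_locales (rule assms(1))
  \<comment> \<open>A lift chosen by \<open>Q\<close> alone, so that the pairs in the list can be
    mapped one by one.\<close>
  define b where "b = (\<lambda>Q. SOME q. Q = ell_point \<Lambda> q)"
  have b: "Q = ell_point \<Lambda> (b Q)" if "(m, Q) \<in> set A" for m Q
  proof -
    have "\<exists>q. Q = ell_point \<Lambda> q"
      using assms(2) that by (auto simp: elliptic_arrangement_def ell_curve_def)
    then show ?thesis
      unfolding b_def by (rule someI_ex)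
  qed
  let ?A = "(\<lambda>(m, Q). (m, b Q)) ` set A"
  \<comment> \<open>Lifting the constants leaves the coefficient vectors, and hence the rank,
    unchanged.\<close>
  have "(\<lambda>(m, q). real_form m) ` ?A = (\<lambda>(m, Q). real_form m) ` set A"
    by (force simp: image_image case_prod_unfold)
  then have "form_rank ?A = r"
    by (simp add: assms(3) form_rank_def arrangement_rank_def real_form_def)
  moreover have "form_rank ({} :: ((int ^ 'n) \<times> complex) set) = 0"
    by (simp add: form_rank_def)
  ultimately have "torus_vanishes \<Lambda> i (stratum {} ?A)"
    using assms(4) by (intro torus_vanishes_stratum) simp_all
  moreover have "arrangement_complement \<Lambda> A = ell_power_point \<Lambda> ` stratum {} ?A"
    by (rule arrangement_complement_eq_stratum) (rule b)
  ultimately have "cohomology_vanishes i (subtopology (ell_power_topology \<Lambda>) (arrangement_complement \<Lambda> A))"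
    by (simp add: torus_vanishes_def torus_subspace_def)
  then show ?thesis
    by (rule trivial_group_singular_cohomology)
qed

end
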